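(* For each positive integer $N$ let $K_N, m_N$ be positive integers, let $f_N \subseteq \{0,1\}^N \times [K_N]$ be a relation such that for every $z \in \{0,1\}^N$ there is $a \in [K_N]$ with $(z,a) \in f_N$, and let $g_N : \{0,1\}^{m_N} \to \{0,1\}$ be a Boolean function. Suppose the family $(f_N)$ is efficiently verifiable. Then $$Q(f_N \circ g_N^N) = \Theta\big(\mathrm{ADV}_{rel}^{\pm}(f_N)\, \mathrm{ADV}^{\pm}(g_N)\big),$$ i.e. there are constants $0<c\le C$ and $N_0$ such that for all $N\ge N_0$, $c\,\mathrm{ADV}_{rel}^{\pm}(f_N)\,\mathrm{ADV}^{\pm}(g_N) \le Q(f_N \circ g_N^N) \le C\,\mathrm{ADV}_{rel}^{\pm}(f_N)\,\mathrm{ADV}^{\pm}(g_N)$.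
   Context: $[K] = \{1,\dots,K\}$. The composition of a relation $f \subseteq \{0,1\}^N \times [K]$ with $g:\{0,1\}^m\to\{0,1\}$ is the relation $f\circ g^N \subseteq \{0,1\}^{Nm} \times [K]$ where, for $x = (x_1,\dots,x_N)$ with each $x_i \in \{0,1\}^m$, $(x,a) \in f \circ g^N$ iff $((g(x_1),\dots,g(x_N)),a) \in f$. Functional adversary bound: for $g:\{0,1\}^n\to\{0,1\}$, $\mathrm{ADV}^{\pm}(g)$ is the maximum of the spectral norm $\|\Gamma\|$ over real symmetric $2^n\times 2^n$ matrices $\Gamma$ (rows and columns indexed by $\{0,1\}^n$) such that $\Gamma(x,y)=0$ whenever $g(x)=g(y)$, and $\|\Gamma\circ D_i\|\le 1$ for all $i\in[n]$. Here $\circ$ between matrices is the entrywise (Hadamard) product and $D_i$ is the $0/1$ matrix with $D_i(x,y)=1$ iff $x_i\ne y_i$. Relational adversary bound: for a relation $f\subseteq\{0,1\}^n\times[K]$ (where every $x$ has some $a$ with $(x,a)\in f$), $\mathrm{ADV}_{rel}^{\pm}(f)$ is the minimum of $$\max\Big\{\max_{x}\sum_{i\in[n]}\|u_{x,i}\|^2,\ \max_{x}\sum_{i\in[n]}\|v_{x,i}\|^2\Big\}$$ over families of real vectors $u_{x,i}, v_{x,i}, \sigma_{x,a}$ of arbitrary finite dimension ($x\in\{0,1\}^n$, $i\in[n]$, $a\in[K]$; dimensions such that the inner products below make sense) satisfying $$\sum_{i: x_i\ne y_i}\langle u_{x,i},v_{y,i}\rangle = 1-\sum_{a\in[K]}\langle\sigma_{x,a},\sigma_{y,a}\rangle\quad\text{for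 all }x,y\in\{0,1\}^n,$$ and $\sigma_{x,a}=0$ whenever $(x,a)\notin f$. Efficiently verifiable: for $a\in[K_N]$ let $f_{N,a}:\{0,1\}^N\to\{0,1\}$ be the Boolean function with $f_{N,a}(z)=1$ iff $(z,a)\in f_N$. The family $(f_N)$ is efficiently verifiable if $\mathrm{ADV}^{\pm}(f_{N,a}) = o(\mathrm{ADV}_{rel}^{\pm}(f_N))$ for all $a$, i.e. for every $\epsilon>0$ there is $N_\epsilon$ such that $\mathrm{ADV}^{\pm}(f_{N,a})\le\epsilon\,\mathrm{ADV}_{rel}^{\pm}(f_N)$ for all $N\ge N_\epsilon$ and all $a\in[K_N]$. Quantum query complexity: a $T$-query quantum algorithm on inputs $x\in\{0,1\}^n$ acts on a finite-dimensional space $\mathbb{C}^n\otimes\mathbb{C}^2\otimes W$, starting from a fixed state independent of $x$, and applies $U_T O_x U_{T-1}\cdots O_x U_0$, where the $U_j$ are unitaries independent of $x$ and $O_x|i,b,w\rangle=|i,b\oplus x_i,w\rangle$; the output is the outcome of a fixed projective measurement of the final state. It computes a relation $h\subseteq\{0,1\}^n\times[K]$ if for every $x$ it outputs some $a$ with $(x,a)\in h$ with probability at least $2/3$. $Q(h)$ is the minimum $T$ over algorithms computing $h$. *)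

theory Defs
  imports "HOL-Analysis.Analysis"
begin

text \<open>
  Since all dimensions vary with the family index, vectors and matrices are functions on an
  explicit finite index set; values outside that set are never consulted.  Bit strings are
  Boolean lists, with positions counted from 0, while the output alphabet is the set of
  numbers from 1 to K.
\<close>

definition cube :: "nat \<Rightarrow> bool list set" where
  "cube n = {x. length x = n}"

definition mat_app :: "'i set \<Rightarrow> ('i \<Rightarrow> 'i \<Rightarrow> 'a::comm_semiring_0) \<Rightarrow> ('i \<Rightarrow> 'a) \<Rightarrow> 'i \<Rightarrow> 'a" where
  "mat_app S A v = (\<lambda>x. \<Sum>y\<in>S. A x y * v y)"

definition rel_comp :: "nat \<Rightarrow> nat \<Rightarrow> (bool list \<times> nat) set \<Rightarrow> (bool list \<Rightarrow> bool) \<Rightarrow> (bool list \<times> nat) set" where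
  "rel_comp N m f g =
     {(x, a). x \<in> cube (N * m) \<and> (map (\<lambda>j. g (take m (drop (j * m) x))) [0..<N], a) \<in> f}"


subsection \<open>Adversary bounds\<close>

definition spectral_norm :: "'i set \<Rightarrow> ('i \<Rightarrow> 'i \<Rightarrow> real) \<Rightarrow> real" where
  "spectral_norm S A = Sup {L2_set (mat_app S A v) S | v. L2_set v S \<le> 1}"

definition hadamard_D :: "nat \<Rightarrow> (bool list \<Rightarrow> bool list \<Rightarrow> real) \<Rightarrow> bool list \<Rightarrow> bool list \<Rightarrow> real" where
  "hadamard_D i \<Gamma> = (\<lambda>x y. \<Gamma> x y * (if x ! i \<noteq> y ! i then 1 else 0))"

definition adv_feasible :: "nat \<Rightarrow> (bool list \<Rightarrow> bool) \<Rightarrow> (bool list \<Rightarrow> bool list \<Rightarrow> real) \<Rightarrow> bool" where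
  "adv_feasible n g \<Gamma> \<longleftrightarrow>
     (\<forall>x\<in>cube n. \<forall>y\<in>cube n. \<Gamma> x y = \<Gamma> y x) \<and>
     (\<forall>x\<in>cube n. \<forall>y\<in>cube n. g x = g y \<longrightarrow> \<Gamma> x y = 0) \<and>
     (\<forall>i<n. spectral_norm (cube n) (hadamard_D i \<Gamma>) \<le> 1)"

definition ADV :: "nat \<Rightarrow> (bool list \<Rightarrow> bool) \<Rightarrow> real" where
  "ADV n g = Sup {spectral_norm (cube n) \<Gamma> | \<Gamma>. adv_feasible n g \<Gamma>}"

text \<open>
  The vectors u x i and v x i have dimension d i, and the vector s x a has dimension e a.
\<close>

definition adv_rel_feasible ::
  "nat \<Rightarrow> nat \<Rightarrow> (bool list \<times> nat) set \<Rightarrow> (nat \<Rightarrow> nat) \<Rightarrow> (nat \<Rightarrow> nat) \<Rightarrow>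
   (bool list \<Rightarrow> nat \<Rightarrow> nat \<Rightarrow> real) \<Rightarrow> (bool list \<Rightarrow> nat \<Rightarrow> nat \<Rightarrow> real) \<Rightarrow>
   (bool list \<Rightarrow> nat \<Rightarrow> nat \<Rightarrow> real) \<Rightarrow> bool" where
  "adv_rel_feasible n K f d e u v s \<longleftrightarrow>
     (\<forall>x\<in>cube n. \<forall>y\<in>cube n.
        (\<Sum>i | i < n \<and> x ! i \<noteq> y ! i. \<Sum>k<d i. u x i k * v y i k)
        = 1 - (\<Sum>a=1..K. \<Sum>k<e a. s x a k * s y a k)) \<and>
     (\<forall>x\<in>cube n. \<forall>a\<in>{1..K}. (x, a) \<notin> f \<longrightarrow> (\<forall>k<e a. s x a k = 0))"

definition adv_rel_objective ::
  "nat \<Rightarrow> (nat \<Rightarrow> nat) \<Rightarrow> (bool list \<Rightarrow> nat \<Rightarrow> nat \<Rightarrow> real) \<Rightarrow>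
   (bool list \<Rightarrow> nat \<Rightarrow> nat \<Rightarrow> real) \<Rightarrow> real" where
  "adv_rel_objective n d u v =
     max (Max ((\<lambda>x. \<Sum>i<n. (L2_set (u x i) {..<d i})\<^sup>2) ` cube n))
         (Max ((\<lambda>x. \<Sum>i<n. (L2_set (v x i) {..<d i})\<^sup>2) ` cube n))"

definition ADV_rel :: "nat \<Rightarrow> nat \<Rightarrow> (bool list \<times> nat) set \<Rightarrow> real" where
  "ADV_rel n K f =
     Inf {adv_rel_objective n d u v | d e u v s. adv_rel_feasible n K f d e u v s}"

definition efficiently_verifiable :: "(nat \<Rightarrow> nat) \<Rightarrow> (nat \<Rightarrow> (bool list \<times> nat) set) \<Rightarrow> bool" where
  "efficiently_verifiable K f \<longleftrightarrow>
     (\<forall>\<epsilon>>0. \<exists>N\<^sub>0. \<forall>N\<ge>N\<^sub>0. N \<ge> 1 \<longrightarrow>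
        (\<forall>a\<in>{1..K N}. ADV N (\<lambda>z. (z, a) \<in> f N) \<le> \<epsilon> * ADV_rel N (K N) (f N)))"


subsection \<open>Quantum query complexity\<close>

type_synonym qidx = "nat \<times> bool \<times> nat"
type_synonym qstate = "qidx \<Rightarrow> complex"
type_synonym qmat = "qidx \<Rightarrow> qidx \<Rightarrow> complex"

text \<open>
  The computational basis of the tensor product of the n-dimensional query register, the
  two-dimensional answer register and a workspace of dimension d.
\<close>

definition qbasis :: "nat \<Rightarrow> nat \<Rightarrow> qidx set" where
  "qbasis n d = {..<n} \<times> UNIV \<times> {..<d}"

text \<open>
  On a finite index set, a matrix whose adjoint is a left inverse is unitary.
\<close>

definition unitary_on :: "qidx set \<Rightarrow> qmat \<Rightarrow> bool" where
  "unitary_on S U \<longleftrightarrow>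
     (\<forall>x\<in>S. \<forall>y\<in>S. (\<Sum>z\<in>S. cnj (U z x) * U z y) = (if x = y then 1 else 0))"

text \<open>
  Orthogonal projections that sum to the identity are pairwise orthogonal, so the latter need
  not be demanded.
\<close>

definition projective_measurement_on :: "qidx set \<Rightarrow> nat set \<Rightarrow> (nat \<Rightarrow> qmat) \<Rightarrow> bool" where
  "projective_measurement_on S \<Omega> P \<longleftrightarrow>
     finite \<Omega> \<and>
     (\<forall>a\<in>\<Omega>. \<forall>x\<in>S. \<forall>y\<in>S. P a y x = cnj (P a x y)) \<and>
     (\<forall>a\<in>\<Omega>. \<forall>x\<in>S. \<forall>y\<in>S. (\<Sum>z\<in>S. P a x z * P a z y) = P a x y) \<and>
     (\<forall>x\<in>S. \<forall>y\<in>S. (\<Sum>a\<in>\<Omega>. P a x y) = (if x = y then 1 else 0))"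

text \<open>
  The oracle permutes the basis by an involution, so on amplitudes it is precomposition with
  that involution; inequality of truth values is exclusive or.
\<close>

definition oracle_app :: "bool list \<Rightarrow> qstate \<Rightarrow> qstate" where
  "oracle_app x \<psi> = (\<lambda>(i, b, w). \<psi> (i, b \<noteq> x ! i, w))"

primrec qrun :: "qidx set \<Rightarrow> (nat \<Rightarrow> qmat) \<Rightarrow> qstate \<Rightarrow> bool list \<Rightarrow> nat \<Rightarrow> qstate" where
  "qrun S U \<psi> x 0 = mat_app S (U 0) \<psi>"
| "qrun S U \<psi> x (Suc t) = mat_app S (U (Suc t)) (oracle_app x (qrun S U \<psi> x t))"

definition outcome_prob :: "qidx set \<Rightarrow> (nat \<Rightarrow> qmat) \<Rightarrow> qstate \<Rightarrow> nat \<Rightarrow> real" where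
  "outcome_prob S P \<psi> a = (L2_set (\<lambda>z. cmod (mat_app S (P a) \<psi> z)) S)\<^sup>2"

definition computable_with_queries :: "nat \<Rightarrow> (bool list \<times> nat) set \<Rightarrow> nat \<Rightarrow> bool" where
  "computable_with_queries n h T \<longleftrightarrow>
     (\<exists>d \<psi> U \<Omega> P.
        L2_set (\<lambda>z. cmod (\<psi> z)) (qbasis n d) = 1 \<and>
        (\<forall>t\<le>T. unitary_on (qbasis n d) (U t)) \<and>
        projective_measurement_on (qbasis n d) \<Omega> P \<and>
        (\<forall>x\<in>cube n.
           (\<Sum>a | a \<in> \<Omega> \<and> (x, a) \<in> h.
              outcome_prob (qbasis n d) P (qrun (qbasis n d) U \<psi> x T) a) \<ge> 2 / 3))"

definition Q :: "nat \<Rightarrow> (bool list \<times> nat) set \<Rightarrow> nat" where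
  "Q n h = (LEAST T. computable_with_queries n h T)"

end

theory Submission imports Defs begin

text \<open>
  Everything is phrased through kernels \<open>E x y\<close> of the form
  \<open>\<Sum>i | x ! i \<noteq> y ! i. \<langle>u x i, v y i\<rangle>\<close>.  Such kernels are closed under sums, under entrywise products
  with Gram matrices, and under composition, with the obvious costs.

  Upper bound.  The composition of a solution for the relation with a dual adversary solution for
  \<open>g\<close> (which exists by semidefinite duality) is converted into an algorithm that slowly rotates a
  start vector into the vectors \<open>\<sigma>\<close>, using the vectors \<open>u\<close> and \<open>v\<close> as a catalyst.  The catalyst is not
  available at the start; leaving it out costs a constant error once the number of queries is a
  large multiple of the cost.

  Lower bound.  After \<open>T\<close> queries the Gram matrix of the states differs from the all-ones matrix by a
  kernel of cost \<open>2 T\<close>.  Verifying each answer separates correct from incorrect outcomes, and the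
  incorrect part, of weight at most one third, is replaced by a near-optimal solution of cost \<open>W\<close>;
  so the optimum \<open>W\<close> satisfies \<open>W \<le> 2 T + V + W / 3\<close> up to an arbitrarily small error, where
  \<open>V\<close> is the cost of verification.  Averaging over the inputs of \<open>g\<close> with the top singular vectors of
  an adversary matrix shows that \<open>W\<close> is at least the product of the two bounds.
\<close>

subsection \<open>Gram kernels and kernels computed by queries\<close>

text \<open>The obstacle in the lower bound: a relational solution must vanish exactly on wrong
  answers, whereas an algorithm errs, and majority voting cannot amplify a relation, since repeated
  runs may return different correct answers. Verification isolates the bad part exactly, and
  substituting a whole solution for it bounds the optimum by a third of itself, so no error
  reduction is needed. For this, verification may cost only a small fraction of the product, which
  is what efficient verifiability provides. A kernel of this form vanishes on the diagonal, since no
  position distinguishes an input from itself; an approximate dual solution can therefore be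
  repaired, each off-diagonal error being corrected at one distinguishing position. The constants:
  each use of duality costs a factor 3 (two, plus the error term), near-optimality a factor 2, the
  error budget of the algorithm a factor 12, and the ratio 1/54 keeps verification below a sixth of
  the product.\<close>

lemma finite_cube [simp]: "finite (cube n)"
  using finite_lists_length_eq[of "UNIV :: bool set" n] by (simp add: cube_def)

lemma cube_nonempty [simp]: "cube n \<noteq> {}"
proof -
  have "replicate n True \<in> cube n" by (simp add: cube_def)
  then show ?thesis by blast
qed

lemma cube_differ:
  assumes "x \<in> cube n" "y \<in> cube n" "x \<noteq> y"
  obtains i where "i < n" "x ! i \<noteq> y ! i"
proof (rule ccontr)
  assume "\<not> thesis"
  then have "x ! i = y ! i" if "i < n" for i using that \<open>\<And>i. i < n \<Longrightarrow> x ! i \<noteq> y ! i \<Longrightarrow> thesis\<close> by blast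
  then have "x = y" using assms(1,2) by (intro nth_equalityI) (auto simp: cube_def)
  with assms(3) show False by simp
qed

lemma sum_times_fst_snd:
  fixes F :: "'a \<Rightarrow> real"
  shows "(\<Sum>p\<in>A \<times> B. F (fst p) * G (snd p)) = sum F A * sum G B"
  by (simp add: sum_product sum.cartesian_product split_def)

lemma sum_rotate:
  "(\<Sum>z\<in>A. \<Sum>x\<in>B. \<Sum>y\<in>C. F z x y) = (\<Sum>x\<in>B. \<Sum>y\<in>C. \<Sum>z\<in>A. F z x y)"
  by (subst sum.swap) (intro sum.cong refl sum.swap)

lemma sum_filter_less:
  "(\<Sum>i | i < n \<and> P i. F i) = (\<Sum>i<(n::nat). if P i then F i else 0)"
  by (subst sum.inter_filter[symmetric]) (auto intro!: sum.cong)

lemma sum_times_delta: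
  fixes F :: "'s \<Rightarrow> 'a::comm_semiring_1"
  assumes "finite S" "x \<in> S"
  shows "(\<Sum>y\<in>S. F y * (if x = y then 1 else 0)) = F x" "(\<Sum>y\<in>S. (if x = y then 1 else 0) * F y) = F x"
    "(\<Sum>y\<in>S. (if y = x then 1 else 0) * F y) = F x"
proof -
  have "(\<Sum>y\<in>S. F y * (if x = y then 1 else 0)) = (\<Sum>y\<in>S. if x = y then F y else 0)" by (rule sum.cong) auto
  then show "(\<Sum>y\<in>S. F y * (if x = y then 1 else 0)) = F x" using assms by (simp add: sum.delta')
  then show "(\<Sum>y\<in>S. (if x = y then 1 else 0) * F y) = F x" "(\<Sum>y\<in>S. (if y = x then 1 else 0) * F y) = F x"
    by (simp_all add: mult.commute eq_commute[of _ x])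
qed

text \<open>Positive semidefinite kernels on \<open>X\<close>, in factored form. Keeping the vectors
  existential lets kernels be combined without tracking dimensions.\<close>

definition gram :: "'x set \<Rightarrow> ('x \<Rightarrow> 'x \<Rightarrow> real) \<Rightarrow> bool" where
  "gram X B \<longleftrightarrow> (\<exists>(D::nat) r. \<forall>x\<in>X. \<forall>y\<in>X. B x y = (\<Sum>k<D. r x k * r y k))"

lemma gramI:
  assumes "finite R" "\<And>x y. x \<in> X \<Longrightarrow> y \<in> X \<Longrightarrow> B x y = (\<Sum>k\<in>R. r x k * r y k)"
  shows "gram X B"
proof -
  obtain h where h: "bij_betw h {0..<card R} R"
    using ex_bij_betw_nat_finite[OF assms(1)] by blast
  have "B x y = (\<Sum>k<card R. r x (h k) * r y (h k))" if "x \<in> X" "y \<in> X" for x y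
    using assms(2)[OF that] sum.reindex_bij_betw[OF h, of "\<lambda>k. r x k * r y k"]
    by (simp add: lessThan_atLeast0)
  then show ?thesis unfolding gram_def
    by (intro exI[of _ "card R"] exI[of _ "\<lambda>x k. r x (h k)"]) auto
qed

lemma gramE:
  assumes "gram X B"
  obtains D :: nat and r where "\<And>x y. x \<in> X \<Longrightarrow> y \<in> X \<Longrightarrow> B x y = (\<Sum>k<D. r x k * r y k)"
  using assms unfolding gram_def by blast

lemma gram_cong:
  assumes "gram X B" "\<And>x y. x \<in> X \<Longrightarrow> y \<in> X \<Longrightarrow> B x y = B' x y"
  shows "gram X B'"
proof (rule gramE[OF assms(1)])
  fix D :: nat and r
  assume "\<And>x y. x \<in> X \<Longrightarrow> y \<in> X \<Longrightarrow> B x y = (\<Sum>k<D. r x k * r y k)"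
  then show ?thesis using assms(2) by (intro gramI[of "{..<D}" X B' r]) auto
qed

lemma gram_pullback:
  assumes "gram Y B" "\<And>x. x \<in> X \<Longrightarrow> G x \<in> Y"
  shows "gram X (\<lambda>x y. B (G x) (G y))"
proof -
  obtain D :: nat and r where r: "\<And>x y. x \<in> Y \<Longrightarrow> y \<in> Y \<Longrightarrow> B x y = (\<Sum>k<D. r x k * r y k)"
    by (rule gramE[OF assms(1)]) (rule that)
  show ?thesis
    by (rule gramI[of "{..<D}" _ _ "\<lambda>x. r (G x)"]) (use r assms(2) in auto)
qed

text \<open>Schur's product theorem: the tensor products of the two families of vectors represent
  the entrywise product.\<close>

lemma gram_mult:
  assumes "gram X B" "gram X C"
  shows "gram X (\<lambda>x y. B x y * C x y)"
proof -
  obtain D :: nat and r where r: "\<And>x y. x \<in> X \<Longrightarrow> y \<in> X \<Longrightarrow> B x y = (\<Sum>k<D. r x k * r y k)"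
    by (rule gramE[OF assms(1)]) (rule that)
  obtain D' :: nat and r' where r': "\<And>x y. x \<in> X \<Longrightarrow> y \<in> X \<Longrightarrow> C x y = (\<Sum>k<D'. r' x k * r' y k)"
    by (rule gramE[OF assms(2)]) (rule that)
  show ?thesis
  proof (rule gramI[of "{..<D} \<times> {..<D'}" _ _ "\<lambda>x p. r x (fst p) * r' x (snd p)"])
    fix x y assume "x \<in> X" "y \<in> X"
    then have "B x y * C x y = (\<Sum>p\<in>{..<D} \<times> {..<D'}. (r x (fst p) * r y (fst p)) * (r' x (snd p) * r' y (snd p)))"
      by (simp add: r r' sum_product sum.cartesian_product split_def)
    then show "B x y * C x y = (\<Sum>p\<in>{..<D} \<times> {..<D'}. r x (fst p) * r' x (snd p) * (r y (fst p) * r' y (snd p)))"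
      by (simp only: mult_ac)
  qed simp
qed

lemma gram_prod:
  assumes "finite J" "\<And>j. j \<in> J \<Longrightarrow> gram X (B j)"
  shows "gram X (\<lambda>x y. \<Prod>j\<in>J. B j x y)"
  using assms
proof (induction J rule: finite_induct)
  case empty
  show ?case by (rule gramI[of "{()}" _ _ "\<lambda>_ _. 1"]) auto
next
  case (insert j J)
  then show ?case using gram_mult[of X "B j" "\<lambda>x y. \<Prod>j\<in>J. B j x y"] by simp
qed

text \<open>Padding with zeros up to the sum of the dimensions gives all kernels of the family the
  same dimension, so that direct sums can be indexed by a product set.\<close>

lemma gram_uniform:
  assumes "finite J" "\<And>j. j \<in> J \<Longrightarrow> gram X (B j)"
  obtains D :: nat and r where "\<And>j x y. j \<in> J \<Longrightarrow> x \<in> X \<Longrightarrow> y \<in> X \<Longrightarrow>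
    B j x y = (\<Sum>k<D. r j x k * r j y k)"
proof -
  have "\<forall>j. \<exists>q. j \<in> J \<longrightarrow> (\<forall>x\<in>X. \<forall>y\<in>X. B j x y = (\<Sum>k<(fst q::nat). snd q x k * snd q y k))"
    using assms(2) unfolding gram_def by fastforce
  then obtain q where q: "\<forall>j. j \<in> J \<longrightarrow>
      (\<forall>x\<in>X. \<forall>y\<in>X. B j x y = (\<Sum>k<(fst (q j)::nat). snd (q j) x k * snd (q j) y k))"
    by (rule choice[THEN exE]) (rule that)
  define D where "D = (\<Sum>j\<in>J. fst (q j))"
  define r where "r j x k = (if k < fst (q j) then snd (q j) x k else 0)" for j x k
  show ?thesis
  proof (rule that)
    fix j x y assume j: "j \<in> J" and xy: "x \<in> X" "y \<in> X"
    have "fst (q j) \<le> D" unfolding D_def using assms(1) j by (intro member_le_sum) auto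
    then have "(\<Sum>k<fst (q j). snd (q j) x k * snd (q j) y k) = (\<Sum>k<D. r j x k * r j y k)"
      by (intro sum.mono_neutral_cong_left) (auto simp: r_def)
    then show "B j x y = (\<Sum>k<D. r j x k * r j y k)" using q j xy by simp
  qed
qed

lemma gram_sum:
  assumes "finite J" "\<And>j. j \<in> J \<Longrightarrow> gram X (B j)"
  shows "gram X (\<lambda>x y. \<Sum>j\<in>J. B j x y)"
proof -
  obtain D :: nat and r where r: "\<And>j x y. j \<in> J \<Longrightarrow> x \<in> X \<Longrightarrow> y \<in> X \<Longrightarrow>
    B j x y = (\<Sum>k<D. r j x k * r j y k)"
    by (rule gram_uniform[OF assms]) (assumption, rule that)
  show ?thesis
    by (rule gramI[of "J \<times> {..<D}" _ _ "\<lambda>x p. r (fst p) x (snd p)"])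
      (use assms(1) in \<open>auto simp: r sum.cartesian_product split_def\<close>)
qed

lemma gram_add: "gram X B \<Longrightarrow> gram X C \<Longrightarrow> gram X (\<lambda>x y. B x y + C x y)"
  using gram_sum[of "UNIV :: bool set" X "\<lambda>b. if b then B else C"]
  by (simp add: UNIV_bool add.commute)

lemma gram_rank_one: "gram X (\<lambda>x y. c x * c y)"
  by (rule gramI[of "{()}" _ _ "\<lambda>x _. c x"]) auto

text \<open>By bilinearity, the vector of \<open>z\<close> is the sum of the vectors over the fibre
  \<open>A z\<close>. This is how kernels on inputs are averaged down to kernels on words.\<close>

lemma gram_push:
  assumes "gram X B" "\<And>z. z \<in> Z \<Longrightarrow> finite (A z) \<and> A z \<subseteq> X"
  shows "gram Z (\<lambda>z w. \<Sum>x\<in>A z. \<Sum>y\<in>A w. B x y)"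
proof -
  obtain D :: nat and r where r: "\<And>x y. x \<in> X \<Longrightarrow> y \<in> X \<Longrightarrow> B x y = (\<Sum>k<D. r x k * r y k)"
    by (rule gramE[OF assms(1)]) (rule that)
  show ?thesis
  proof (rule gramI[of "{..<D}" _ _ "\<lambda>z k. \<Sum>x\<in>A z. r x k"])
    fix z w assume zw: "z \<in> Z" "w \<in> Z"
    have "(\<Sum>x\<in>A z. \<Sum>y\<in>A w. B x y) = (\<Sum>x\<in>A z. \<Sum>y\<in>A w. \<Sum>k<D. r x k * r y k)"
      using assms(2)[OF zw(1)] assms(2)[OF zw(2)] by (intro sum.cong refl r) auto
    also have "\<dots> = (\<Sum>k<D. \<Sum>x\<in>A z. \<Sum>y\<in>A w. r x k * r y k)" by (rule sum_rotate[symmetric])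
    also have "\<dots> = (\<Sum>k<D. (\<Sum>x\<in>A z. r x k) * (\<Sum>x\<in>A w. r x k))"
      by (simp add: sum_product)
    finally show "(\<Sum>x\<in>A z. \<Sum>y\<in>A w. B x y) = (\<Sum>k<D. (\<Sum>x\<in>A z. r x k) * (\<Sum>x\<in>A w. r x k))" .
  qed auto
qed

text \<open>A vector of norm zero is zero. The condition that \<sigma> vanishes can therefore be
  stated on the diagonal of its Gram kernel alone.\<close>

lemma gram_zero_diag:
  assumes "gram X B" "x \<in> X" "y \<in> X" "B x x = 0"
  shows "B x y = 0"
proof -
  obtain D :: nat and r where r: "\<And>x y. x \<in> X \<Longrightarrow> y \<in> X \<Longrightarrow> B x y = (\<Sum>k<D. r x k * r y k)"
    by (rule gramE[OF assms(1)]) (rule that)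
  have "(\<Sum>k<D. r x k * r x k) = 0" using r[OF assms(2,2)] assms(4) by simp
  then have "r x k = 0" if "k < D" for k using that by (simp add: sum_nonneg_eq_0_iff)
  then show ?thesis using r[OF assms(2,3)] by simp
qed

section \<open>Kernels with a query cost\<close>

definition query_vectors where
  "query_vectors n E c D u v \<longleftrightarrow>
     (\<forall>x\<in>cube n. \<forall>y\<in>cube n. (\<Sum>i | i < n \<and> x ! i \<noteq> y ! i. \<Sum>k<(D::nat). u x i k * v y i k) = (E x y :: real)) \<and>
     (\<forall>x\<in>cube n. (\<Sum>i<n. \<Sum>k<D. (u x i k)\<^sup>2) \<le> c x) \<and>
     (\<forall>x\<in>cube n. (\<Sum>i<n. \<Sum>k<D. (v x i k)\<^sup>2) \<le> c x)"

text \<open>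
  \<open>query_cost n E c\<close> is feasibility of the dual adversary bound for the kernel \<open>E\<close>; letting the cost
  depend on the input makes these kernels a convex cone in the pair \<open>(E, c)\<close>.
\<close>

definition query_cost :: "nat \<Rightarrow> (bool list \<Rightarrow> bool list \<Rightarrow> real) \<Rightarrow> (bool list \<Rightarrow> real) \<Rightarrow> bool" where
  "query_cost n E c \<longleftrightarrow> (\<exists>D u v. query_vectors n E c D u v)"

lemma query_costI:
  assumes "finite R"
    and "\<And>x y. x \<in> cube n \<Longrightarrow> y \<in> cube n \<Longrightarrow>
      (\<Sum>i | i < n \<and> x ! i \<noteq> y ! i. \<Sum>k\<in>R. u x i k * v y i k) = E x y"
    and "\<And>x. x \<in> cube n \<Longrightarrow> (\<Sum>i<n. \<Sum>k\<in>R. (u x i k)\<^sup>2) \<le> c x"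
    and "\<And>x. x \<in> cube n \<Longrightarrow> (\<Sum>i<n. \<Sum>k\<in>R. (v x i k)\<^sup>2) \<le> c x"
  shows "query_cost n E c"
proof -
  obtain h where h: "bij_betw h {0..<card R} R"
    using ex_bij_betw_nat_finite[OF assms(1)] by blast
  have *: "(\<Sum>k<card R. F (h k)) = (\<Sum>k\<in>R. F k)" for F :: "_ \<Rightarrow> real"
    using sum.reindex_bij_betw[OF h, of F] by (simp add: lessThan_atLeast0)
  show ?thesis unfolding query_cost_def query_vectors_def
    apply (rule exI[of _ "card R"], rule exI[of _ "\<lambda>x i k. u x i (h k)"], rule exI[of _ "\<lambda>x i k. v x i (h k)"])
    using assms(2-4) by (simp add: *[of "\<lambda>k. u _ _ k * v _ _ k"] *[of "\<lambda>k. (u _ _ k)\<^sup>2"] *[of "\<lambda>k. (v _ _ k)\<^sup>2"])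
qed

lemma query_costE:
  assumes "query_cost n E c"
  obtains D :: nat and u v where
    "\<And>x y. x \<in> cube n \<Longrightarrow> y \<in> cube n \<Longrightarrow>
      (\<Sum>i | i < n \<and> x ! i \<noteq> y ! i. \<Sum>k<D. u x i k * v y i k) = E x y"
    "\<And>x. x \<in> cube n \<Longrightarrow> (\<Sum>i<n. \<Sum>k<D. (u x i k)\<^sup>2) \<le> c x"
    "\<And>x. x \<in> cube n \<Longrightarrow> (\<Sum>i<n. \<Sum>k<D. (v x i k)\<^sup>2) \<le> c x"
  using assms unfolding query_cost_def query_vectors_def by blast

lemma query_cost_mono:
  assumes "query_cost n E c" "\<And>x y. x \<in> cube n \<Longrightarrow> y \<in> cube n \<Longrightarrow> E x y = E' x y"
    "\<And>x. x \<in> cube n \<Longrightarrow> c x \<le> c' x"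
  shows "query_cost n E' c'"
proof -
  obtain D :: nat and u v where
    "\<And>x y. x \<in> cube n \<Longrightarrow> y \<in> cube n \<Longrightarrow>
      (\<Sum>i | i < n \<and> x ! i \<noteq> y ! i. \<Sum>k<D. u x i k * v y i k) = E x y"
    "\<And>x. x \<in> cube n \<Longrightarrow> (\<Sum>i<n. \<Sum>k<D. (u x i k)\<^sup>2) \<le> c x"
    "\<And>x. x \<in> cube n \<Longrightarrow> (\<Sum>i<n. \<Sum>k<D. (v x i k)\<^sup>2) \<le> c x"
    by (rule query_costE[OF assms(1)]) (rule that)
  note q = this
  show ?thesis
  proof (rule query_costI[of "{..<D}" n u v])
    fix x assume x: "x \<in> cube n"
    show "(\<Sum>i<n. \<Sum>k<D. (u x i k)\<^sup>2) \<le> c' x" "(\<Sum>i<n. \<Sum>k<D. (v x i k)\<^sup>2) \<le> c' x"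
      using q(2)[OF x] q(3)[OF x] assms(3)[OF x] by linarith+
  qed (use q(1) assms(2) in \<open>simp_all\<close>)
qed

text \<open>The direct sum over \<open>r\<close> of the vector families, with \<open>a\<close>
  scaling the left and \<open>b\<close> the right vectors. The two scalings are independent, so the
  weight \<open>a x r * b y r\<close> need not be symmetric.\<close>

lemma query_cost_sum:
  assumes "finite R" and E: "\<And>r. r \<in> R \<Longrightarrow> query_cost n (E r) (c r)"
    and ca: "\<And>x. x \<in> cube n \<Longrightarrow> (\<Sum>r\<in>R. (a x r)\<^sup>2 * c r x) \<le> C x"
    and cb: "\<And>x. x \<in> cube n \<Longrightarrow> (\<Sum>r\<in>R. (b x r)\<^sup>2 * c r x) \<le> C x"
  shows "query_cost n (\<lambda>x y. \<Sum>r\<in>R. a x r * b y r * E r x y) C"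
proof -
  have "\<forall>r. \<exists>D u v. r \<in> R \<longrightarrow> query_vectors n (E r) (c r) D u v"
    using E unfolding query_cost_def by blast
  then obtain D u v where q: "\<And>r. r \<in> R \<Longrightarrow> query_vectors n (E r) (c r) (D r) (u r) (v r)"
    by metis
  have id: "\<And>r x y. r \<in> R \<Longrightarrow> x \<in> cube n \<Longrightarrow> y \<in> cube n \<Longrightarrow>
       (\<Sum>i | i < n \<and> x ! i \<noteq> y ! i. \<Sum>k<D r. u r x i k * v r y i k) = E r x y"
    and cu: "\<And>r x. r \<in> R \<Longrightarrow> x \<in> cube n \<Longrightarrow> (\<Sum>i<n. \<Sum>k<D r. (u r x i k)\<^sup>2) \<le> c r x"
    and cv: "\<And>r x. r \<in> R \<Longrightarrow> x \<in> cube n \<Longrightarrow> (\<Sum>i<n. \<Sum>k<D r. (v r x i k)\<^sup>2) \<le> c r x"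
    using q unfolding query_vectors_def by blast+
  let ?R = "SIGMA r:R. {..<D r}"
  have Sig: "(\<Sum>i\<in>I. \<Sum>p\<in>?R. F i (fst p) (snd p)) = (\<Sum>r\<in>R. \<Sum>i\<in>I. \<Sum>k<D r. F i r k)"
    for I :: "nat set" and F :: "nat \<Rightarrow> 'a \<Rightarrow> nat \<Rightarrow> real"
  proof -
    have "(\<Sum>i\<in>I. \<Sum>p\<in>?R. F i (fst p) (snd p)) = (\<Sum>i\<in>I. \<Sum>r\<in>R. \<Sum>k<D r. F i r k)"
      using assms(1) by (simp add: sum.Sigma split_def)
    also have "\<dots> = (\<Sum>r\<in>R. \<Sum>i\<in>I. \<Sum>k<D r. F i r k)" by (rule sum.swap)
    finally show ?thesis .
  qed
  have cost: "(\<Sum>i<n. \<Sum>p\<in>?R. (a' (fst p) * u' (fst p) i (snd p))\<^sup>2) \<le> (\<Sum>r\<in>R. (a' r)\<^sup>2 * c' r)"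
    if "\<And>r. r \<in> R \<Longrightarrow> (\<Sum>i<n. \<Sum>k<D r. (u' r i k)\<^sup>2) \<le> c' r"
    for a' :: "'a \<Rightarrow> real" and u' :: "'a \<Rightarrow> nat \<Rightarrow> nat \<Rightarrow> real" and c' :: "'a \<Rightarrow> real"
    using that by (simp only: Sig[of "\<lambda>i r k. (a' r * u' r i k)\<^sup>2"])
      (auto simp: power_mult_distrib sum_distrib_left[symmetric] intro!: sum_mono mult_left_mono)
  show ?thesis
  proof (rule query_costI[of ?R n "\<lambda>x i p. a x (fst p) * u (fst p) x i (snd p)"
        "\<lambda>x i p. b x (fst p) * v (fst p) x i (snd p)"])
    fix x y assume xy: "x \<in> cube n" "y \<in> cube n"
    let ?I = "{i. i < n \<and> x ! i \<noteq> y ! i}"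
    have "(\<Sum>i\<in>?I. \<Sum>p\<in>?R. a x (fst p) * u (fst p) x i (snd p) * (b y (fst p) * v (fst p) y i (snd p)))
       = (\<Sum>r\<in>R. \<Sum>i\<in>?I. \<Sum>k<D r. a x r * u r x i k * (b y r * v r y i k))"
      by (rule Sig[of "\<lambda>i r k. a x r * u r x i k * (b y r * v r y i k)"])
    also have "\<dots> = (\<Sum>r\<in>R. a x r * b y r * (\<Sum>i\<in>?I. \<Sum>k<D r. u r x i k * v r y i k))"
      by (simp add: sum_distrib_left mult_ac)
    also have "\<dots> = (\<Sum>r\<in>R. a x r * b y r * E r x y)"
      using id xy by (intro sum.cong refl) simp
    finally show "(\<Sum>i\<in>?I. \<Sum>p\<in>?R. a x (fst p) * u (fst p) x i (snd p) * (b y (fst p) * v (fst p) y i (snd p)))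
       = (\<Sum>r\<in>R. a x r * b y r * E r x y)" .
  next
    fix x assume x: "x \<in> cube n"
    show "(\<Sum>i<n. \<Sum>p\<in>?R. (a x (fst p) * u (fst p) x i (snd p))\<^sup>2) \<le> C x"
      using cost[of "\<lambda>r. u r x" "\<lambda>r. c r x" "a x"] cu[OF _ x] ca[OF x] by fastforce
    show "(\<Sum>i<n. \<Sum>p\<in>?R. (b x (fst p) * v (fst p) x i (snd p))\<^sup>2) \<le> C x"
      using cost[of "\<lambda>r. v r x" "\<lambda>r. c r x" "b x"] cv[OF _ x] cb[OF x] by fastforce
  qed (use assms(1) in auto)
qed

lemma query_cost_add:
  assumes "query_cost n E c" "query_cost n E' c'"
  shows "query_cost n (\<lambda>x y. E x y + E' x y) (\<lambda>x. c x + c' x)"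
proof -
  have "query_cost n (\<lambda>x y. \<Sum>b\<in>(UNIV::bool set). 1 * 1 * (if b then E else E') x y) (\<lambda>x. c x + c' x)"
    by (rule query_cost_sum[where c="\<lambda>b. if b then c else c'"]) (use assms in \<open>auto simp: UNIV_bool\<close>)
  then show ?thesis by (rule query_cost_mono) (auto simp: UNIV_bool)
qed

text \<open>Both sides are scaled by the same Gram vectors, whose squares at \<open>x\<close> sum to
  \<open>B x x\<close>; so only the diagonal of \<open>B\<close> enters the cost.\<close>

lemma query_cost_mult_gram:
  assumes E: "query_cost n E c" and B: "gram (cube n) B"
  shows "query_cost n (\<lambda>x y. B x y * E x y) (\<lambda>x. B x x * c x)"
proof -
  obtain D :: nat and r where r: "\<And>x y. x \<in> cube n \<Longrightarrow> y \<in> cube n \<Longrightarrow> B x y = (\<Sum>k<D. r x k * r y k)"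
    by (rule gramE[OF B]) (rule that)
  have "query_cost n (\<lambda>x y. \<Sum>k<D. r x k * r y k * E x y) (\<lambda>x. B x x * c x)"
    by (rule query_cost_sum[where c="\<lambda>_. c"])
      (use E in \<open>auto simp: r power2_eq_square sum_distrib_right\<close>)
  then show ?thesis by (rule query_cost_mono) (auto simp: r sum_distrib_right)
qed

lemma query_cost_bit:
  assumes "i < n"
  shows "query_cost n (\<lambda>x y. if x ! i \<noteq> y ! i then 1 else 0) (\<lambda>_. 1)"
proof -
  have fin: "finite {j. j < n \<and> x ! j \<noteq> y ! j}" for x y :: "bool list" by auto
  have "(\<Sum>j | j < n \<and> x ! j \<noteq> y ! j. (if j = i then 1 else 0) * (if j = i then 1 else (0::real)))
      = (if x ! i \<noteq> y ! i then 1 else 0)" for x y :: "bool list"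
  proof -
    have "(\<Sum>j | j < n \<and> x ! j \<noteq> y ! j. (if j = i then 1 else 0) * (if j = i then 1 else (0::real)))
       = (\<Sum>j | j < n \<and> x ! j \<noteq> y ! j. if j = i then 1 else 0)" by (rule sum.cong) auto
    then show ?thesis using assms fin by (simp add: sum.delta)
  qed
  moreover have "(\<Sum>j<n. (if j = i then 1 else (0::real))\<^sup>2) = 1"
  proof -
    have "(\<Sum>j<n. (if j = i then 1 else (0::real))\<^sup>2) = (\<Sum>j<n. if j = i then 1 else 0)"
      by (rule sum.cong) auto
    then show ?thesis using assms by (simp add: sum.delta)
  qed
  ultimately show ?thesis
    by (intro query_costI[of "{()}" n "\<lambda>_ j _. if j = i then 1 else 0" "\<lambda>_ j _. if j = i then 1 else 0"]) auto
qed

lemma query_cost_zero: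
  assumes "\<And>x. x \<in> cube n \<Longrightarrow> 0 \<le> c x"
  shows "query_cost n (\<lambda>_ _. 0) c"
  by (rule query_costI[of "{}::nat set" n "\<lambda>_ _ _. 0" "\<lambda>_ _ _. 0"]) (use assms in auto)

text \<open>Two distinct inputs are told apart at some position, so each off-diagonal entry can be
  produced alone from a bit kernel with indicator weights, and an input is the first (or second)
  component of at most \<open>card (cube n)\<close> pairs. The bound is crude, but it suffices to
  repair arbitrarily small errors and to show that some finite solution exists.\<close>

lemma query_cost_zero_diagonal:
  assumes "\<And>x. x \<in> cube n \<Longrightarrow> E x x = 0"
    and "\<And>x y. x \<in> cube n \<Longrightarrow> y \<in> cube n \<Longrightarrow> \<bar>E x y\<bar> \<le> \<eta>"
  shows "query_cost n E (\<lambda>_. real (card (cube n)) * \<eta>)"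
proof -
  let ?X = "cube n"
  have \<eta>: "0 \<le> \<eta>" proof -
    obtain x where "x \<in> ?X" using cube_nonempty[of n] by blast
    then show ?thesis using assms(2)[of x x] by linarith
  qed
  let ?R = "{p \<in> ?X \<times> ?X. fst p \<noteq> snd p}"
  have ex: "\<exists>i<n. fst p ! i \<noteq> snd p ! i" if "p \<in> ?R" for p
    using that cube_differ[of "fst p" n "snd p"] by (auto simp: mem_Times_iff)
  define i where "i p = (SOME i. i < n \<and> fst p ! i \<noteq> snd p ! i)" for p :: "bool list \<times> bool list"
  have i: "i p < n \<and> fst p ! i p \<noteq> snd p ! i p" if "p \<in> ?R" for p
    unfolding i_def using ex[OF that] by (rule someI_ex)
  let ?e = "\<lambda>p. E (fst p) (snd p)"
  \<comment> \<open>The modulus of the entry is split evenly between the two sides; its sign goes to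
    the right.\<close>
  let ?a = "\<lambda>x p. if x = fst p then sqrt \<bar>?e p\<bar> else 0"
  let ?b = "\<lambda>y p. if y = snd p then sgn (?e p) * sqrt \<bar>?e p\<bar> else 0"
  have sgn: "(sgn t * sqrt \<bar>t\<bar>)\<^sup>2 = \<bar>t\<bar>" "sqrt \<bar>t\<bar> * (sgn t * sqrt \<bar>t\<bar>) = t" for t :: real
    by (cases t "0::real" rule: linorder_cases; simp add: power_mult_distrib)+
  have ab: "(\<Sum>p\<in>?R. (F p)\<^sup>2 * 1) \<le> real (card ?X) * \<eta>"
    if x: "x \<in> ?X" and F: "\<And>p. p \<in> ?R \<Longrightarrow> (F p)\<^sup>2 \<le> (if x = sel p then \<eta> else 0)"
      and sel: "inj_on f ?X" "\<And>p. p \<in> ?R \<Longrightarrow> sel p = x \<Longrightarrow> p \<in> f ` ?X" for F x sel f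
  proof -
    have "(\<Sum>p\<in>?R. (F p)\<^sup>2 * 1) \<le> (\<Sum>p\<in>?R. if x = sel p then \<eta> else 0)"
      using F by (intro sum_mono) auto
    also have "\<dots> = (\<Sum>p\<in>{p\<in>?R. x = sel p}. \<eta>)"
      by (subst sum.inter_filter[symmetric]) auto
    also have "\<dots> \<le> (\<Sum>p\<in>f ` ?X. \<eta>)"
      using sel(2) \<eta> by (intro sum_mono2) auto
    also have "\<dots> = real (card ?X) * \<eta>" using sel(1) by (simp add: card_image)
    finally show ?thesis .
  qed
  have "query_cost n (\<lambda>x y. \<Sum>p\<in>?R. ?a x p * ?b y p * (if x ! i p \<noteq> y ! i p then 1 else 0))
      (\<lambda>_. real (card ?X) * \<eta>)"
  proof (rule query_cost_sum[where c="\<lambda>_ _. 1"])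
    fix x assume x: "x \<in> ?X"
    show "(\<Sum>p\<in>?R. (?a x p)\<^sup>2 * 1) \<le> real (card ?X) * \<eta>"
      by (rule ab[OF x, where sel=fst and f="\<lambda>y. (x, y)"]) (use assms(2) in \<open>auto simp: inj_on_def\<close>)
    show "(\<Sum>p\<in>?R. (?b x p)\<^sup>2 * 1) \<le> real (card ?X) * \<eta>"
      by (rule ab[OF x, where sel=snd and f="\<lambda>y. (y, x)"])
        (use assms(2) \<eta> sgn in \<open>auto simp: inj_on_def\<close>)
  qed (use i query_cost_bit in auto)
  then show ?thesis
  proof (rule query_cost_mono)
    fix x y assume xy: "x \<in> ?X" "y \<in> ?X"
    have "(\<Sum>p\<in>?R. ?a x p * ?b y p * (if x ! i p \<noteq> y ! i p then 1 else 0))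
       = (\<Sum>p\<in>?R. if p = (x, y) then E x y else 0)"
      using i sgn(2) by (intro sum.cong refl) (auto simp: prod_eq_iff)
    also have "\<dots> = E x y" using xy assms(1) by (subst sum.delta) auto
    finally show "(\<Sum>p\<in>?R. ?a x p * ?b y p * (if x ! i p \<noteq> y ! i p then 1 else 0)) = E x y" .
  qed auto
qed

lemma query_cost_scale:
  assumes "query_cost n E c" "0 < t"
  shows "query_cost n (\<lambda>x y. t * E x y) (\<lambda>x. t * c x)"
  using query_cost_mult_gram[OF assms(1) gram_rank_one[of _ "\<lambda>_. sqrt t"]] assms(2) by simp

text \<open>If \<open>g x \<noteq> g y\<close>, exactly one \<open>r\<close> satisfies
  \<open>r = g x\<close> and \<open>r \<noteq> g y\<close>, and otherwise none does. These kernels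
  are the test elements that extract the constraint at position \<open>i\<close> from a separating
  functional.\<close>

lemma query_cost_distinguish:
  fixes g :: "bool list \<Rightarrow> bool"
  assumes "i < n"
  shows "query_cost n (\<lambda>x y. if g x \<noteq> g y then a x * b y * (if x ! i \<noteq> y ! i then 1 else 0) else 0)
    (\<lambda>x. (a x)\<^sup>2 + (b x)\<^sup>2)"
proof -
  have "query_cost n (\<lambda>x y. \<Sum>r\<in>(UNIV::bool set). (if r = g x then a x else 0) * (if r \<noteq> g y then b y else 0)
      * (if x ! i \<noteq> y ! i then 1 else 0)) (\<lambda>x. (a x)\<^sup>2 + (b x)\<^sup>2)"
    by (rule query_cost_sum[where c="\<lambda>_ _. 1"]) (use query_cost_bit[OF assms] in \<open>auto simp: UNIV_bool\<close>)
  then show ?thesis by (rule query_cost_mono) (auto simp: UNIV_bool)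
qed

subsection \<open>Spectral norms and the adversary bound\<close>

lemma L2_set_le_1_iff: "L2_set a S \<le> 1 \<longleftrightarrow> (\<Sum>x\<in>S. (a x)\<^sup>2) \<le> 1"
  by (simp add: L2_set_def)

lemma L2_set_mat_app_le:
  fixes A :: "'i \<Rightarrow> 'i \<Rightarrow> real"
  assumes "finite S" "L2_set v S \<le> 1"
  shows "L2_set (mat_app S A v) S \<le> (\<Sum>x\<in>S. \<Sum>y\<in>S. \<bar>A x y\<bar>)"
proof -
  have v: "\<bar>v y\<bar> \<le> 1" if "y \<in> S" for y
  proof -
    have "\<bar>v y\<bar> \<le> L2_set (\<lambda>i. \<bar>v i\<bar>) S" using assms(1) that by (rule member_le_L2_set)
    also have "\<dots> = L2_set v S" by (simp add: L2_set_def)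
    finally show ?thesis using assms(2) by linarith
  qed
  have "L2_set (mat_app S A v) S \<le> (\<Sum>x\<in>S. \<bar>mat_app S A v x\<bar>)" by (rule L2_set_le_sum_abs)
  also have "\<dots> \<le> (\<Sum>x\<in>S. \<Sum>y\<in>S. \<bar>A x y\<bar>)"
  proof (rule sum_mono)
    fix x assume "x \<in> S"
    have "\<bar>mat_app S A v x\<bar> \<le> (\<Sum>y\<in>S. \<bar>A x y * v y\<bar>)" unfolding mat_app_def by (rule sum_abs)
    also have "\<dots> \<le> (\<Sum>y\<in>S. \<bar>A x y\<bar>)"
      using v by (intro sum_mono) (simp add: abs_mult mult_left_le)
    finally show "\<bar>mat_app S A v x\<bar> \<le> (\<Sum>y\<in>S. \<bar>A x y\<bar>)" .
  qed
  finally show ?thesis .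
qed

lemma spectral_norm_ge:
  assumes "finite S" "L2_set v S \<le> 1"
  shows "L2_set (mat_app S A v) S \<le> spectral_norm S A"
  unfolding spectral_norm_def
proof (rule cSup_upper)
  show "bdd_above {L2_set (mat_app S A v) S |v. L2_set v S \<le> 1}"
    using L2_set_mat_app_le[OF assms(1), of _ A] by (intro bdd_aboveI) blast
qed (use assms in blast)

lemma spectral_norm_le:
  assumes "\<And>v. L2_set v S \<le> 1 \<Longrightarrow> L2_set (mat_app S A v) S \<le> c"
  shows "spectral_norm S A \<le> c"
  unfolding spectral_norm_def
proof (rule cSup_least)
  have "L2_set (\<lambda>_. 0) S \<le> 1" by (simp add: L2_set_def)
  then show "{L2_set (mat_app S A v) S |v. L2_set v S \<le> 1} \<noteq> {}" by blast
qed (use assms in blast)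

lemma bilinear_le_spectral_norm:
  assumes "finite S" "L2_set a S \<le> 1" "L2_set b S \<le> 1"
  shows "(\<Sum>x\<in>S. \<Sum>y\<in>S. a x * A x y * b y) \<le> spectral_norm S A"
proof -
  have "(\<Sum>x\<in>S. \<Sum>y\<in>S. a x * A x y * b y) = (\<Sum>x\<in>S. a x * mat_app S A b x)"
    by (simp add: mat_app_def sum_distrib_left mult.assoc)
  also have "\<dots> \<le> (\<Sum>x\<in>S. \<bar>a x\<bar> * \<bar>mat_app S A b x\<bar>)"
    by (intro sum_mono) (metis abs_ge_self abs_mult)
  also have "\<dots> \<le> L2_set a S * L2_set (mat_app S A b) S"
    by (rule L2_set_mult_ineq)
  also have "\<dots> \<le> 1 * spectral_norm S A"
    using assms spectral_norm_ge[OF assms(1,3)] by (intro mult_mono) auto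
  finally show ?thesis by simp
qed

lemma spectral_norm_le_bilinear:
  assumes "finite S" "0 \<le> c"
    and "\<And>a b. L2_set a S \<le> 1 \<Longrightarrow> L2_set b S \<le> 1 \<Longrightarrow> (\<Sum>x\<in>S. \<Sum>y\<in>S. a x * A x y * b y) \<le> c"
  shows "spectral_norm S A \<le> c"
proof (rule spectral_norm_le)
  fix v assume v: "L2_set v S \<le> 1"
  let ?w = "mat_app S A v" let ?s = "L2_set ?w S"
  show "?s \<le> c"
  proof (cases "?s = 0")
    case False
    then have s: "?s > 0" by (simp add: order_less_le)
    have sq: "(\<Sum>x\<in>S. (?w x)\<^sup>2) = ?s\<^sup>2" unfolding L2_set_def by (simp add: sum_nonneg)
    have "L2_set (\<lambda>x. (1 / ?s) * ?w x) S = 1"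
      using s by (subst L2_set_right_distrib[symmetric]) auto
    then have "(\<Sum>x\<in>S. \<Sum>y\<in>S. ((1 / ?s) * ?w x) * A x y * v y) \<le> c"
      using v by (intro assms(3)) auto
    moreover have "(\<Sum>x\<in>S. \<Sum>y\<in>S. ((1 / ?s) * ?w x) * A x y * v y) = (\<Sum>x\<in>S. (1 / ?s) * (?w x)\<^sup>2)"
    proof (intro sum.cong refl)
      fix x
      have w: "?w x = (\<Sum>y\<in>S. A x y * v y)" by (simp add: mat_app_def)
      have "(\<Sum>y\<in>S. q * A x y * v y) = q * ?w x" for q
        unfolding w sum_distrib_left by (simp add: mult.assoc)
      from this[of "(1 / ?s) * ?w x"]
      show "(\<Sum>y\<in>S. ((1 / ?s) * ?w x) * A x y * v y) = (1 / ?s) * (?w x)\<^sup>2"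
        by (simp only: power2_eq_square mult.assoc)
    qed
    moreover have "(\<Sum>x\<in>S. (1 / ?s) * (?w x)\<^sup>2) = (1 / ?s) * ?s\<^sup>2"
      by (simp only: sum_distrib_left[symmetric] sq)
    moreover have "(1 / ?s) * ?s\<^sup>2 = ?s" using s by (simp add: power2_eq_square)
    ultimately show ?thesis by simp
  qed (use assms(2) in simp)
qed

lemma mat_app_sq_le:
  assumes "finite S" "spectral_norm S A \<le> 1"
  shows "(\<Sum>x\<in>S. (mat_app S A v x)\<^sup>2) \<le> (\<Sum>x\<in>S. (v x)\<^sup>2)"
proof (cases "L2_set v S = 0")
  case True
  then have "v x = 0" if "x \<in> S" for x using assms(1) that by (simp add: L2_set_eq_0_iff)
  then show ?thesis by (simp add: mat_app_def)
next
  case False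
  let ?s = "L2_set v S"
  have s: "?s > 0" using False by (simp add: order_less_le)
  have "L2_set (\<lambda>x. (1 / ?s) * v x) S = 1"
    using s by (subst L2_set_right_distrib[symmetric]) auto
  then have "L2_set (mat_app S A (\<lambda>x. (1 / ?s) * v x)) S \<le> 1"
    using spectral_norm_ge[OF assms(1), of "\<lambda>x. (1 / ?s) * v x" A] assms(2) by linarith
  moreover have "mat_app S A (\<lambda>x. (1 / ?s) * v x) = (\<lambda>x. (1 / ?s) * mat_app S A v x)"
    by (rule ext) (simp add: mat_app_def sum_distrib_left mult_ac sum_divide_distrib)
  ultimately have "(1 / ?s) * L2_set (mat_app S A v) S \<le> 1"
    using s L2_set_right_distrib[of "1 / ?s" "mat_app S A v" S] by simp
  then have "L2_set (mat_app S A v) S \<le> ?s" using s by (simp add: field_simps)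
  then show ?thesis by (simp add: L2_set_def)
qed

text \<open>Distinct inputs differ at some \<open>i\<close>, where \<open>hadamard_D i\<close> keeps
  the entry, and an entry is at most the norm. This makes the set in the definition of
  \<open>ADV\<close> bounded.\<close>

lemma adv_feasible_entry_le:
  assumes "adv_feasible n g \<Gamma>" "x \<in> cube n" "y \<in> cube n"
  shows "\<bar>\<Gamma> x y\<bar> \<le> 1"
proof (cases "x = y")
  case True
  then show ?thesis using assms by (auto simp: adv_feasible_def)
next
  case False
  then obtain i where i: "i < n" "x ! i \<noteq> y ! i"
    by (rule cube_differ[OF assms(2,3)])
  let ?e = "\<lambda>z. if z = y then 1 else (0::real)"
  have "(\<Sum>z\<in>cube n. (?e z)\<^sup>2) = (\<Sum>z\<in>cube n. if z = y then 1 else 0)"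
    by (rule sum.cong) auto
  then have e: "L2_set ?e (cube n) \<le> 1" using assms(3) by (simp add: L2_set_def)
  have "mat_app (cube n) (hadamard_D i \<Gamma>) ?e x = (\<Sum>z\<in>cube n. if z = y then \<Gamma> x y else 0)"
    unfolding mat_app_def using i(2) by (intro sum.cong) (auto simp: hadamard_D_def)
  then have "\<bar>\<Gamma> x y\<bar> = \<bar>mat_app (cube n) (hadamard_D i \<Gamma>) ?e x\<bar>" using assms(3) by simp
  also have "\<dots> \<le> L2_set (\<lambda>z. \<bar>mat_app (cube n) (hadamard_D i \<Gamma>) ?e z\<bar>) (cube n)"
    by (rule member_le_L2_set[where f="\<lambda>z. \<bar>mat_app (cube n) (hadamard_D i \<Gamma>) ?e z\<bar>"]) (use assms(2) in auto)
  also have "\<dots> = L2_set (mat_app (cube n) (hadamard_D i \<Gamma>) ?e) (cube n)" by (simp add: L2_set_def)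
  also have "\<dots> \<le> spectral_norm (cube n) (hadamard_D i \<Gamma>)"
    using e by (intro spectral_norm_ge) auto
  also have "\<dots> \<le> 1" using assms(1) i(1) by (simp add: adv_feasible_def)
  finally show ?thesis .
qed

lemma spectral_norm_le_ADV:
  assumes "adv_feasible n g \<Gamma>"
  shows "spectral_norm (cube n) \<Gamma> \<le> ADV n g"
  unfolding ADV_def
proof (rule cSup_upper)
  show "bdd_above {spectral_norm (cube n) \<Gamma> | \<Gamma>. adv_feasible n g \<Gamma>}"
  proof (rule bdd_aboveI)
    fix s assume "s \<in> {spectral_norm (cube n) \<Gamma> | \<Gamma>. adv_feasible n g \<Gamma>}"
    then obtain \<Gamma>' where G: "adv_feasible n g \<Gamma>'" "s = spectral_norm (cube n) \<Gamma>'" by blast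
    show "s \<le> (\<Sum>x\<in>cube n. \<Sum>y\<in>cube n. 1)" unfolding G(2)
    proof (rule spectral_norm_le)
      fix v assume "L2_set v (cube n) \<le> 1"
      then have "L2_set (mat_app (cube n) \<Gamma>' v) (cube n) \<le> (\<Sum>x\<in>cube n. \<Sum>y\<in>cube n. \<bar>\<Gamma>' x y\<bar>)"
        by (intro L2_set_mat_app_le) auto
      also have "\<dots> \<le> (\<Sum>x\<in>cube n. \<Sum>y\<in>cube n. 1)"
        using adv_feasible_entry_le[OF G(1)] by (intro sum_mono) auto
      finally show "L2_set (mat_app (cube n) \<Gamma>' v) (cube n) \<le> (\<Sum>x\<in>cube n. \<Sum>y\<in>cube n. 1)" .
    qed
  qed
qed (use assms in blast)

lemma spectral_norm_zero [simp]: "spectral_norm S (\<lambda>_ _. 0) = 0"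
proof -
  have "{L2_set (mat_app S (\<lambda>_ _. 0) v) S | v. L2_set v S \<le> 1} = {0}"
    by (auto simp: mat_app_def L2_set_def intro!: exI[of _ "\<lambda>_. 0"])
  then show ?thesis by (simp add: spectral_norm_def)
qed

lemma adv_feasible_zero: "adv_feasible n g (\<lambda>_ _. 0)"
  by (simp add: adv_feasible_def hadamard_D_def)

lemma ADV_nonneg: "0 \<le> ADV n g"
  using spectral_norm_le_ADV[OF adv_feasible_zero] by simp

lemma ADV_witness:
  assumes "t < ADV n g"
  obtains \<Gamma> where "adv_feasible n g \<Gamma>" "t < spectral_norm (cube n) \<Gamma>"
proof -
  have "{spectral_norm (cube n) \<Gamma> | \<Gamma>. adv_feasible n g \<Gamma>} \<noteq> {}"
    using adv_feasible_zero by blast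
  from less_cSupD[OF this assms[unfolded ADV_def]] show ?thesis using that by blast
qed

lemma ADV_constant:
  assumes "\<And>x y. x \<in> cube n \<Longrightarrow> y \<in> cube n \<Longrightarrow> g x = g y"
  shows "ADV n g = 0"
proof (rule antisym)
  show "ADV n g \<le> 0"
  proof (rule ccontr)
    assume "\<not> ADV n g \<le> 0"
    then obtain \<Gamma> where G: "adv_feasible n g \<Gamma>" "0 < spectral_norm (cube n) \<Gamma>"
      using ADV_witness[of 0 n g] by auto
    have "\<Gamma> x y = 0" if "x \<in> cube n" "y \<in> cube n" for x y
      using G(1) assms[OF that] that unfolding adv_feasible_def by blast
    then have "spectral_norm (cube n) \<Gamma> \<le> 0"
      by (intro spectral_norm_le) (simp add: mat_app_def L2_set_def)
    with G(2) show False by simp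
  qed
qed (rule ADV_nonneg)

text \<open>Witnessed by a single symmetric pair of ones: each \<open>hadamard_D i\<close> leaves
  this matrix unchanged or annihilates it, and it exchanges two basis vectors, so its norm is
  one.\<close>

lemma ADV_ge_1:
  assumes "p \<in> cube n" "q \<in> cube n" "g p \<noteq> g q"
  shows "1 \<le> ADV n g"
proof -
  define \<Gamma> :: "bool list \<Rightarrow> bool list \<Rightarrow> real" where
    "\<Gamma> x y = (if (x, y) = (p, q) \<or> (x, y) = (q, p) then 1 else 0)" for x y
  have pq: "p \<noteq> q" using assms(3) by blast
  have app: "mat_app (cube n) \<Gamma> v = (\<lambda>x. if x = p then v q else if x = q then v p else 0)" for v
  proof
    fix x
    have "mat_app (cube n) \<Gamma> v x = (\<Sum>y\<in>cube n. (if y = q then if x = p then v q else 0 else 0)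
        + (if y = p then if x = q then v p else 0 else 0))"
      unfolding mat_app_def using pq by (intro sum.cong) (auto simp: \<Gamma>_def)
    then show "mat_app (cube n) \<Gamma> v x = (if x = p then v q else if x = q then v p else 0)"
      using assms pq by (simp add: sum.distrib)
  qed
  have norm: "(\<Sum>x\<in>cube n. (mat_app (cube n) \<Gamma> v x)\<^sup>2) = (v p)\<^sup>2 + (v q)\<^sup>2" for v
  proof -
    have "(\<Sum>x\<in>cube n. (mat_app (cube n) \<Gamma> v x)\<^sup>2)
      = (\<Sum>x\<in>cube n. (if x = p then (v q)\<^sup>2 else 0) + (if x = q then (v p)\<^sup>2 else 0))"
      unfolding app using pq by (intro sum.cong) auto
    then show ?thesis using assms by (simp add: sum.distrib)
  qed
  have le: "spectral_norm (cube n) \<Gamma> \<le> 1"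
  proof (rule spectral_norm_le)
    fix v assume v: "L2_set v (cube n) \<le> 1"
    have "(\<Sum>x\<in>{p, q}. (v x)\<^sup>2) \<le> (\<Sum>x\<in>cube n. (v x)\<^sup>2)"
      using assms by (intro sum_mono2) auto
    then have "L2_set (mat_app (cube n) \<Gamma> v) (cube n) \<le> L2_set v (cube n)"
      using pq by (simp add: L2_set_def norm)
    then show "L2_set (mat_app (cube n) \<Gamma> v) (cube n) \<le> 1" using v by linarith
  qed
  have "spectral_norm (cube n) (hadamard_D i \<Gamma>) \<le> 1" for i
  proof (cases "p ! i = q ! i")
    case True
    then have "hadamard_D i \<Gamma> = (\<lambda>_ _. 0)" by (auto simp: hadamard_D_def \<Gamma>_def fun_eq_iff)
    then show ?thesis by simp
  next
    case False
    then have "hadamard_D i \<Gamma> = \<Gamma>" by (auto simp: hadamard_D_def \<Gamma>_def fun_eq_iff)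
    then show ?thesis using le by simp
  qed
  moreover have "g x \<noteq> g y \<or> \<Gamma> x y = 0" for x y using assms(3) by (auto simp: \<Gamma>_def)
  moreover have "\<Gamma> x y = \<Gamma> y x" for x y by (auto simp: \<Gamma>_def)
  ultimately have "adv_feasible n g \<Gamma>" unfolding adv_feasible_def by blast
  then have "spectral_norm (cube n) \<Gamma> \<le> ADV n g" by (rule spectral_norm_le_ADV)
  moreover have "1 \<le> spectral_norm (cube n) \<Gamma>"
  proof -
    let ?e = "\<lambda>x. if x = p then 1 else (0::real)"
    have "(\<Sum>x\<in>cube n. (?e x)\<^sup>2) = (\<Sum>x\<in>cube n. if x = p then 1 else 0)" by (rule sum.cong) auto
    then have "L2_set ?e (cube n) \<le> 1" using assms(1) by (simp add: L2_set_def)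
    from spectral_norm_ge[OF finite_cube this, of \<Gamma>] show ?thesis
      using pq norm[of ?e] by (simp add: L2_set_def)
  qed
  ultimately show ?thesis by linarith
qed

section \<open>Compactness and separation of a point from a convex cone\<close>

lemma pointwise_convergent_subseq:
  fixes k :: "nat \<Rightarrow> 'z \<Rightarrow> real"
  assumes "finite Z" "\<And>n z. z \<in> Z \<Longrightarrow> \<bar>k n z\<bar> \<le> M"
  shows "\<exists>r l. strict_mono (r :: nat \<Rightarrow> nat) \<and> (\<forall>z\<in>Z. (\<lambda>n. k (r n) z) \<longlonglongrightarrow> l z)"
  using assms
proof (induction Z rule: finite_induct)
  case empty
  show ?case by (rule exI[of _ id]) (simp add: strict_mono_def)
next
  case (insert z Z)
  then obtain r l where r: "strict_mono (r :: nat \<Rightarrow> nat)" "\<forall>z\<in>Z. (\<lambda>n. k (r n) z) \<longlonglongrightarrow> l z"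
    by auto
  have "compact {-M..M}" by simp
  moreover have "\<forall>n. k (r n) z \<in> {-M..M}" using insert.prems[of z] by (auto simp: abs_le_iff minus_le_iff)
  ultimately obtain l' s where s: "strict_mono (s :: nat \<Rightarrow> nat)" "((\<lambda>n. k (r n) z) \<circ> s) \<longlonglongrightarrow> l'"
    unfolding compact_def by meson
  have "\<forall>z'\<in>insert z Z. (\<lambda>n. k (r (s n)) z') \<longlonglongrightarrow> (l(z := l')) z'"
  proof
    fix z' assume z': "z' \<in> insert z Z"
    show "(\<lambda>n. k (r (s n)) z') \<longlonglongrightarrow> (l(z := l')) z'"
    proof (cases "z' = z")
      case True then show ?thesis using s(2) by (simp add: o_def)
    next
      case False
      then have "(\<lambda>n. k (r n) z') \<longlonglongrightarrow> l z'" using r(2) z' by auto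
      from LIMSEQ_subseq_LIMSEQ[OF this s(1)] show ?thesis using False by (simp add: o_def)
    qed
  qed
  moreover have "strict_mono (r \<circ> s)" using r(1) s(1) by (rule strict_mono_o)
  ultimately have "strict_mono (r \<circ> s) \<and> (\<forall>z'\<in>insert z Z. (\<lambda>n. k ((r \<circ> s) n) z') \<longlonglongrightarrow> (l(z := l')) z')"
    by (simp only: o_apply simp_thms)
  then show ?case by blast
qed

text \<open>The first-order condition at a minimum: for small \<open>t\<close> the linear term
  dominates.\<close>

lemma nonneg_of_small_quadratic:
  fixes a b :: real
  assumes "\<And>t. 0 < t \<Longrightarrow> t < 1 \<Longrightarrow> 0 \<le> 2 * t * a + t\<^sup>2 * b"
  shows "0 \<le> a"
proof (rule ccontr)
  assume "\<not> 0 \<le> a"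
  then have a: "a < 0" by simp
  let ?t = "min (1/2) (- a / (\<bar>b\<bar> + 1))"
  have t: "0 < ?t" "?t < 1" using a by (auto simp: field_simps)
  have "2 * ?t * a + ?t\<^sup>2 * b = ?t * (2 * a + ?t * b)"
    by (simp only: power2_eq_square distrib_left mult_ac)
  then have "0 \<le> ?t * (2 * a + ?t * b)" using assms[OF t] by simp
  then have "0 \<le> 2 * a + ?t * b" using t(1) zero_le_mult_iff[of ?t "2 * a + ?t * b"] by linarith
  moreover have "?t * b \<le> - a"
  proof -
    have "?t * b \<le> ?t * (\<bar>b\<bar> + 1)" using t(1) by (intro mult_left_mono) auto
    also have "\<dots> \<le> (- a / (\<bar>b\<bar> + 1)) * (\<bar>b\<bar> + 1)" by (intro mult_right_mono) auto
    also have "\<dots> = - a" by simp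
    finally show ?thesis .
  qed
  ultimately show False using a by linarith
qed

text \<open>The functional is the difference \<open>r\<close> between \<open>p\<close> and a nearest
  point. The cone need not be closed, so nearest points exist only as limits of a minimizing
  sequence, and the squared distance of \<open>p\<close> from the cone is required to stay above a
  positive \<open>\<eta>\<close>.\<close>

lemma cone_separation:
  fixes C :: "('z \<Rightarrow> real) set"
  assumes Z: "finite Z" and "k0 \<in> C"
    and add: "\<And>k k'. k \<in> C \<Longrightarrow> k' \<in> C \<Longrightarrow> (\<lambda>z. k z + k' z) \<in> C"
    and scale: "\<And>k t. k \<in> C \<Longrightarrow> t > 0 \<Longrightarrow> (\<lambda>z. t * k z) \<in> C"
    and "0 < \<eta>" and far: "\<And>k. k \<in> C \<Longrightarrow> \<eta> \<le> (\<Sum>z\<in>Z. (p z - k z)\<^sup>2)"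
  obtains r where "\<And>k. k \<in> C \<Longrightarrow> (\<Sum>z\<in>Z. r z * k z) \<le> 0" "0 < (\<Sum>z\<in>Z. r z * p z)"
proof -
  define D where "D k = (\<Sum>z\<in>Z. (p z - k z)\<^sup>2)" for k
  define d where "d = Inf (D ` C)"
  have bdd: "bdd_below (D ` C)" by (rule bdd_belowI[of _ 0]) (auto simp: D_def sum_nonneg)
  have d_le: "d \<le> D k" if "k \<in> C" for k
    unfolding d_def using bdd that by (intro cInf_lower) auto
  have d_pos: "0 < d"
  proof -
    have "\<eta> \<le> d" unfolding d_def using assms(2) far by (intro cInf_greatest) (auto simp: D_def)
    then show ?thesis using \<open>0 < \<eta>\<close> by linarith
  qed
  have ex: "\<exists>k. k \<in> C \<and> D k < d + 1 / real (Suc n)" for n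
  proof -
    have "Inf (D ` C) < d + 1 / real (Suc n)" by (simp add: d_def)
    then show ?thesis using assms(2) bdd by (subst (asm) cInf_less_iff) blast+
  qed
  define K where "K n = (SOME k. k \<in> C \<and> D k < d + 1 / real (Suc n))" for n
  have K: "K n \<in> C" "D (K n) < d + 1 / real (Suc n)" for n
    using someI_ex[OF ex[of n]] by (simp_all add: K_def)
  have "\<bar>p z - K n z\<bar> \<le> d + 2" if "z \<in> Z" for n z
  proof -
    have "(p z - K n z)\<^sup>2 \<le> D (K n)" unfolding D_def
      using Z that by (intro member_le_sum) auto
    also have "\<dots> \<le> d + 1" using K(2)[of n] by (smt (verit) divide_le_eq_1 of_nat_0_le_iff of_nat_Suc)
    also have "\<dots> \<le> (d + 2)\<^sup>2" using d_pos by (simp add: power2_eq_square algebra_simps)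
    finally show ?thesis using d_pos by (simp add: abs_le_square_iff[symmetric])
  qed
  from pointwise_convergent_subseq[where k="\<lambda>n z. p z - K n z", OF Z this] obtain s r where
    s: "strict_mono (s :: nat \<Rightarrow> nat)" and r: "\<And>z. z \<in> Z \<Longrightarrow> (\<lambda>n. p z - K (s n) z) \<longlonglongrightarrow> r z"
    by blast
  let ?K = "\<lambda>n. K (s n)"
  \<comment> \<open>The limit of \<open>?K\<close> may leave \<open>C\<close>, but competitors built
    from each \<open>?K n\<close> lie in \<open>C\<close>, and their distance bound passes to the
    limit.\<close>
  have lim_ge: "d \<le> (\<Sum>z\<in>Z. (\<alpha> * r z + \<beta> z)\<^sup>2)"
    if step: "\<And>n. \<exists>k\<in>C. \<forall>z\<in>Z. p z - k z = \<alpha> * (p z - ?K n z) + \<beta> z" for \<alpha> \<beta>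
  proof (rule LIMSEQ_le_const)
    show "(\<lambda>n. \<Sum>z\<in>Z. (\<alpha> * (p z - ?K n z) + \<beta> z)\<^sup>2) \<longlonglongrightarrow> (\<Sum>z\<in>Z. (\<alpha> * r z + \<beta> z)\<^sup>2)"
      using r by (intro tendsto_intros) auto
    have "d \<le> (\<Sum>z\<in>Z. (\<alpha> * (p z - ?K n z) + \<beta> z)\<^sup>2)" for n
    proof -
      obtain k where k: "k \<in> C" "\<forall>z\<in>Z. p z - k z = \<alpha> * (p z - ?K n z) + \<beta> z" using step by blast
      then have "D k = (\<Sum>z\<in>Z. (\<alpha> * (p z - ?K n z) + \<beta> z)\<^sup>2)" by (simp add: D_def)
      then show ?thesis using d_le[OF k(1)] by simp
    qed
    then show "\<exists>N. \<forall>n\<ge>N. d \<le> (\<Sum>z\<in>Z. (\<alpha> * (p z - ?K n z) + \<beta> z)\<^sup>2)" by blast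
  qed
  have norm_r: "(\<Sum>z\<in>Z. (r z)\<^sup>2) = d"
  proof (rule antisym)
    show "d \<le> (\<Sum>z\<in>Z. (r z)\<^sup>2)" using lim_ge[of 1 "\<lambda>_. 0"] K(1) by auto
    show "(\<Sum>z\<in>Z. (r z)\<^sup>2) \<le> d"
    proof (rule LIMSEQ_le)
      show "(\<lambda>n. \<Sum>z\<in>Z. (p z - ?K n z)\<^sup>2) \<longlonglongrightarrow> (\<Sum>z\<in>Z. (r z)\<^sup>2)"
        using r by (intro tendsto_intros) auto
      have "(\<lambda>n. d + 1 / real (Suc n)) \<longlonglongrightarrow> d + 0"
        using LIMSEQ_inverse_real_of_nat by (intro tendsto_intros) (simp add: inverse_eq_divide)
      from LIMSEQ_subseq_LIMSEQ[OF this s] show "(\<lambda>n. d + 1 / real (Suc (s n))) \<longlonglongrightarrow> d"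
        by (simp add: o_def)
      show "\<exists>N. \<forall>n\<ge>N. (\<Sum>z\<in>Z. (p z - ?K n z)\<^sup>2) \<le> d + 1 / real (Suc (s n))"
        using K(2) less_imp_le unfolding D_def by blast
    qed
  qed
  have expand: "(\<Sum>z\<in>Z. (r z + t * q z)\<^sup>2) = d + 2 * t * (\<Sum>z\<in>Z. r z * q z) + t\<^sup>2 * (\<Sum>z\<in>Z. (q z)\<^sup>2)" for t q
    unfolding norm_r[symmetric] sum_distrib_left sum.distrib[symmetric]
    by (intro sum.cong refl) (simp add: power2_eq_square algebra_simps)
  show ?thesis
  proof (rule that)
    fix k assume k: "k \<in> C"
    \<comment> \<open>Moving the nearest point by \<open>t * k\<close> stays in the cone and cannot
      come closer to \<open>p\<close>.\<close>
    have "0 \<le> (\<Sum>z\<in>Z. r z * (- k z))"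
    proof (rule nonneg_of_small_quadratic)
      fix t :: real assume t: "0 < t" "t < 1"
      have "d \<le> (\<Sum>z\<in>Z. (1 * r z + t * (- k z))\<^sup>2)"
      proof (rule lim_ge)
        fix n
        show "\<exists>k'\<in>C. \<forall>z\<in>Z. p z - k' z = 1 * (p z - ?K n z) + t * (- k z)"
          using add[OF K(1)[of "s n"] scale[OF k t(1)]] by (intro bexI) auto
      qed
      then show "0 \<le> 2 * t * (\<Sum>z\<in>Z. r z * (- k z)) + t\<^sup>2 * (\<Sum>z\<in>Z. (- k z)\<^sup>2)"
        using expand[of t "\<lambda>z. - k z"] by simp
    qed
    then show "(\<Sum>z\<in>Z. r z * k z) \<le> 0" by (simp add: sum_negf)
  next
    \<comment> \<open>Shrinking the nearest point by \<open>1 - t\<close> also stays in the cone;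
      hence the functional at \<open>p\<close> is at least the squared norm \<open>d\<close> of
      \<open>r\<close>.\<close>
    have "0 \<le> (\<Sum>z\<in>Z. r z * (p z - r z))"
    proof (rule nonneg_of_small_quadratic)
      fix t :: real assume t: "0 < t" "t < 1"
      have "d \<le> (\<Sum>z\<in>Z. ((1 - t) * r z + t * p z)\<^sup>2)"
      proof (rule lim_ge)
        fix n
        show "\<exists>k'\<in>C. \<forall>z\<in>Z. p z - k' z = (1 - t) * (p z - ?K n z) + t * p z"
          using scale[OF K(1)[of "s n"], of "1 - t"] t(2) by (intro bexI) (auto simp: algebra_simps)
      qed
      also have "\<dots> = (\<Sum>z\<in>Z. (r z + t * (p z - r z))\<^sup>2)"
        by (simp add: algebra_simps)
      finally show "0 \<le> 2 * t * (\<Sum>z\<in>Z. r z * (p z - r z)) + t\<^sup>2 * (\<Sum>z\<in>Z. (p z - r z)\<^sup>2)"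
        using expand[of t "\<lambda>z. p z - r z"] by simp
    qed
    then have "(\<Sum>z\<in>Z. (r z)\<^sup>2) \<le> (\<Sum>z\<in>Z. r z * p z)"
      by (simp add: right_diff_distrib sum_subtractf power2_eq_square)
    then show "0 < (\<Sum>z\<in>Z. r z * p z)" using norm_r d_pos by linarith
  qed
qed

subsection \<open>Duality for the adversary bound\<close>

text \<open>
  Semidefinite duality, up to a factor of two and an arbitrarily small error.  A separating
  functional on pairs \<open>(x, y)\<close> with
  \<open>g x \<noteq> g y\<close> becomes, after rescaling by the weights it puts on the diagonal, an
  adversary matrix.
\<close>

lemma query_cost_ADV:
  assumes "0 < \<epsilon>"
  shows "query_cost n (\<lambda>x y. if g x \<noteq> g y then 1 else 0) (\<lambda>_. 2 * ADV n g + \<epsilon>)"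
proof -
  let ?X = "cube n"
  define lam where "lam = 2 * ADV n g + \<epsilon> / 2"
  have lam: "0 < lam" using ADV_nonneg[of n g] assms by (simp add: lam_def)
  define F where "F = {p \<in> ?X \<times> ?X. g (fst p) \<noteq> g (snd p)}"
  define dg where "dg = (\<lambda>x. (x, x)) ` ?X"
  define Z where "Z = F \<union> dg"
  have fin: "finite F" "finite dg" "F \<inter> dg = {}" by (auto simp: F_def dg_def)
  \<comment> \<open>Off-diagonal values of \<open>k\<close> describe the kernel and diagonal values
    its cost, so that a pair of kernel and cost becomes one vector. The target \<open>p\<close> is
    the kernel one at cost \<open>lam\<close>.\<close>
  define C where "C = {k. query_cost n (\<lambda>x y. if g x \<noteq> g y then k (x, y) else 0) (\<lambda>x. k (x, x))}"
  define p where "p = (\<lambda>(x, y). if g x \<noteq> g y then 1 else lam)"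
  \<comment> \<open>Chosen so that the diagonal error \<open>\<eta>\<close> and the repair cost
    \<open>card ?X * \<eta>\<close> together use up the half of \<open>\<epsilon>\<close> that
    \<open>lam\<close> leaves.\<close>
  define \<eta> where "\<eta> = \<epsilon> / (2 * (real (card ?X) + 1))"
  have \<eta>: "0 < \<eta>" using assms by (simp add: \<eta>_def)
  have C_add: "(\<lambda>z. k z + k' z) \<in> C" if k: "k \<in> C" "k' \<in> C" for k k'
    using query_cost_add[OF k[unfolded C_def mem_Collect_eq]] unfolding C_def mem_Collect_eq
    by (rule query_cost_mono) auto
  have C_scale: "(\<lambda>z. t * k z) \<in> C" if k: "k \<in> C" "t > 0" for k t
    using query_cost_scale[OF k(1)[unfolded C_def mem_Collect_eq] k(2)] unfolding C_def mem_Collect_eq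
    by (rule query_cost_mono) auto
  have C_diag: "(\<lambda>z. if z = (x, x) then 1 else 0) \<in> C" if "x \<in> ?X" for x
    unfolding C_def mem_Collect_eq
    by (rule query_cost_mono[OF query_cost_zero[of n "\<lambda>y. if y = x then 1 else 0"]]) auto
  have C_rank_one: "(\<lambda>(x, y). if g x \<noteq> g y then a x * b y * (if x ! i \<noteq> y ! i then 1 else 0)
      else if x = y then (a x)\<^sup>2 + (b x)\<^sup>2 else 0) \<in> C" if "i < n" for i a b
    unfolding C_def mem_Collect_eq
    by (rule query_cost_mono[OF query_cost_distinguish[OF that, of g a b]]) auto
  have pairing: "(\<Sum>z\<in>Z. r z * k z) =
      (\<Sum>x\<in>?X. \<Sum>y\<in>?X. (if g x \<noteq> g y then r (x, y) * k (x, y) else 0)) + (\<Sum>x\<in>?X. r (x, x) * k (x, x))"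
    for r k :: "bool list \<times> bool list \<Rightarrow> real"
  proof -
    have "(\<Sum>z\<in>dg. r z * k z) = (\<Sum>x\<in>?X. r (x, x) * k (x, x))"
      unfolding dg_def by (subst sum.reindex) (auto simp: inj_on_def)
    moreover have "(\<Sum>z\<in>F. r z * k z) = (\<Sum>x\<in>?X. \<Sum>y\<in>?X. (if g x \<noteq> g y then r (x, y) * k (x, y) else 0))"
      unfolding F_def sum.cartesian_product
      by (subst sum.inter_filter) (auto intro!: sum.cong)
    ultimately show ?thesis unfolding Z_def using fin by (simp add: sum.union_disjoint)
  qed
  have near: "\<exists>k\<in>C. (\<Sum>z\<in>Z. (p z - k z)\<^sup>2) < \<eta>\<^sup>2"
  proof (rule ccontr)
    let ?d = "\<lambda>i x y. if x ! i \<noteq> y ! i then 1 else (0::real)"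
    assume "\<not> ?thesis"
    then have far: "\<eta>\<^sup>2 \<le> (\<Sum>z\<in>Z. (p z - k z)\<^sup>2)" if "k \<in> C" for k using that by (simp add: not_less)
    have "(\<lambda>_. 0) \<in> C" by (simp add: C_def query_cost_zero)
    moreover have "finite Z" "0 < \<eta>\<^sup>2" using fin \<eta> by (auto simp: Z_def)
    ultimately obtain r where r: "\<And>k. k \<in> C \<Longrightarrow> (\<Sum>z\<in>Z. r z * k z) \<le> 0" "0 < (\<Sum>z\<in>Z. r z * p z)"
      using cone_separation[of Z "\<lambda>_. 0" C "\<eta>\<^sup>2" p, OF _ _ C_add C_scale _ far] by blast
    define R where "R x y = (if g x \<noteq> g y then r (x, y) else 0)" for x y
    \<comment> \<open>The functional is nonpositive on the cone, so its diagonal is negated to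
      obtain weights.\<close>
    define w where "w x = - r (x, x)" for x
    define tot where "tot = (\<Sum>x\<in>?X. \<Sum>y\<in>?X. R x y)"
    have tot: "lam * (\<Sum>x\<in>?X. w x) < tot"
    proof -
      have "(\<Sum>x\<in>?X. r (x, x) * p (x, x)) = - lam * (\<Sum>x\<in>?X. w x)"
        by (simp add: p_def w_def sum_negf sum_distrib_left mult.commute)
      moreover have "(\<Sum>x\<in>?X. \<Sum>y\<in>?X. (if g x \<noteq> g y then r (x, y) * p (x, y) else 0)) = tot"
        unfolding tot_def by (intro sum.cong refl) (simp add: R_def p_def)
      ultimately show ?thesis using r(2) unfolding pairing by simp
    qed
    have w: "0 \<le> w x" if x: "x \<in> ?X" for x
    proof -
      have "(\<Sum>z\<in>Z. r z * (if z = (x, x) then 1 else 0)) = (\<Sum>z\<in>Z. if z = (x, x) then r z else 0)"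
        by (rule sum.cong) auto
      also have "\<dots> = r (x, x)" using fin x by (subst sum.delta) (auto simp: Z_def dg_def)
      finally show ?thesis using r(1)[OF C_diag[OF x]] by (simp add: w_def)
    qed
    \<comment> \<open>On a rank-one kernel the functional says that \<open>R\<close>, restricted to
      pairs differing at \<open>i\<close>, is dominated by the weights \<open>w\<close>. This
      becomes the norm constraint.\<close>
    have bil: "(\<Sum>x\<in>?X. \<Sum>y\<in>?X. R x y * ?d i x y * a x * b y)
        \<le> (\<Sum>x\<in>?X. w x * ((a x)\<^sup>2 + (b x)\<^sup>2))" if i: "i < n" for i a b
    proof -
      let ?k = "\<lambda>(x, y). if g x \<noteq> g y then a x * b y * ?d i x y
        else if x = y then (a x)\<^sup>2 + (b x)\<^sup>2 else 0"
      have "(\<Sum>x\<in>?X. \<Sum>y\<in>?X. if g x \<noteq> g y then r (x, y) * ?k (x, y) else 0)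
         = (\<Sum>x\<in>?X. \<Sum>y\<in>?X. R x y * ?d i x y * a x * b y)"
        by (intro sum.cong refl) (simp add: R_def)
      moreover have "(\<Sum>x\<in>?X. r (x, x) * ?k (x, x)) = - (\<Sum>x\<in>?X. w x * ((a x)\<^sup>2 + (b x)\<^sup>2))"
        by (simp add: w_def sum_negf)
      ultimately have "(\<Sum>x\<in>?X. \<Sum>y\<in>?X. R x y * ?d i x y * a x * b y)
         - (\<Sum>x\<in>?X. w x * ((a x)\<^sup>2 + (b x)\<^sup>2)) \<le> 0"
        using r(1)[OF C_rank_one[OF i, of a b]] unfolding pairing by linarith
      then show ?thesis by simp
    qed
    \<comment> \<open>Half of the slack in \<open>tot\<close> is spread over all inputs: the weights
      become strictly positive, so that one can divide by them, and the strict inequality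
      survives.\<close>
    define \<kappa> where "\<kappa> = (tot - lam * (\<Sum>x\<in>?X. w x)) / (2 * lam * real (card ?X))"
    have card: "0 < card ?X" by (simp add: card_gt_0_iff)
    have \<kappa>: "0 < \<kappa>" using tot lam card by (simp add: \<kappa>_def)
    define w' where "w' x = w x + \<kappa>" for x
    define W where "W = (\<Sum>x\<in>?X. w' x)"
    have w': "0 < w' x" if "x \<in> ?X" for x using w[OF that] \<kappa> by (simp add: w'_def)
    have W: "0 < W" unfolding W_def using w' by (intro sum_pos) auto
    have WT: "lam * W < tot"
    proof -
      have "lam * W = lam * (\<Sum>x\<in>?X. w x) + lam * real (card ?X) * \<kappa>"
        by (simp add: W_def w'_def sum.distrib algebra_simps)
      also have "lam * real (card ?X) * \<kappa> = (tot - lam * (\<Sum>x\<in>?X. w x)) / 2"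
        using lam card by (simp add: \<kappa>_def)
      finally have "lam * W = lam * (\<Sum>x\<in>?X. w x) + (tot - lam * (\<Sum>x\<in>?X. w x)) / 2" .
      moreover have "s + (t - s) / 2 < t" if "s < t" for s t :: real using that by (simp add: field_simps)
      ultimately show ?thesis using tot by metis
    qed
    let ?r = "\<lambda>a x. a x / sqrt (w' x)"
    \<comment> \<open>Rescaling by \<open>1 / sqrt (w' x)\<close> turns domination by weights into a
      norm bound. Two unit vectors contribute 1 + 1 = 2 and symmetrization doubles this, hence the
      4. The value is doubled by symmetrization too, so the 1 + 1 is the factor two that is
      lost.\<close>
    define \<Gamma> where "\<Gamma> x y = (R x y + R y x) / (4 * (sqrt (w' x) * sqrt (w' y)))" for x y
    have bound: "(\<Sum>x\<in>?X. \<Sum>y\<in>?X. R x y * ?d i x y * ?r a x * ?r b y) \<le> 2"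
      if i: "i < n" and a: "L2_set a ?X \<le> 1" and b: "L2_set b ?X \<le> 1" for i a b
    proof -
      have "(\<Sum>x\<in>?X. \<Sum>y\<in>?X. R x y * ?d i x y * ?r a x * ?r b y)
        \<le> (\<Sum>x\<in>?X. w x * ((?r a x)\<^sup>2 + (?r b x)\<^sup>2))" by (rule bil[OF i])
      also have "\<dots> \<le> (\<Sum>x\<in>?X. (a x)\<^sup>2 + (b x)\<^sup>2)"
      proof (rule sum_mono)
        fix x assume x: "x \<in> ?X"
        have "w x * ((?r a x)\<^sup>2 + (?r b x)\<^sup>2) = (w x / w' x) * ((a x)\<^sup>2 + (b x)\<^sup>2)"
          using w'[OF x] by (simp add: power_divide field_simps)
        also have "\<dots> \<le> 1 * ((a x)\<^sup>2 + (b x)\<^sup>2)"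
          using w'[OF x] \<kappa> by (intro mult_right_mono) (auto simp: w'_def)
        finally show "w x * ((?r a x)\<^sup>2 + (?r b x)\<^sup>2) \<le> (a x)\<^sup>2 + (b x)\<^sup>2" by simp
      qed
      also have "\<dots> \<le> 2" using a b by (simp add: L2_set_le_1_iff sum.distrib)
      finally show ?thesis .
    qed
    have "spectral_norm ?X (hadamard_D i \<Gamma>) \<le> 1" if i: "i < n" for i
    proof (rule spectral_norm_le_bilinear)
      fix a b assume ab: "L2_set a ?X \<le> 1" "L2_set b ?X \<le> (1::real)"
      let ?S = "\<lambda>a b. \<Sum>x\<in>?X. \<Sum>y\<in>?X. R x y * ?d i x y * ?r a x * ?r b y"
      have "(\<Sum>x\<in>?X. \<Sum>y\<in>?X. a x * hadamard_D i \<Gamma> x y * b y)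
        = (\<Sum>x\<in>?X. \<Sum>y\<in>?X. (1/4) * (R x y * ?d i x y * ?r a x * ?r b y)
            + (1/4) * (R y x * ?d i y x * ?r b y * ?r a x))"
        by (intro sum.cong refl) (simp add: hadamard_D_def \<Gamma>_def add_divide_distrib algebra_simps)
      also have "\<dots> = (1/4) * ?S a b + (1/4) * (\<Sum>x\<in>?X. \<Sum>y\<in>?X. R y x * ?d i y x * ?r b y * ?r a x)"
        by (simp only: sum.distrib sum_distrib_left)
      also have "(\<Sum>x\<in>?X. \<Sum>y\<in>?X. R y x * ?d i y x * ?r b y * ?r a x) = ?S b a"
        by (rule sum.swap)
      finally show "(\<Sum>x\<in>?X. \<Sum>y\<in>?X. a x * hadamard_D i \<Gamma> x y * b y) \<le> 1"
        using bound[OF i ab] bound[OF i ab(2,1)] by linarith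
    qed auto
    moreover have "\<Gamma> x y = \<Gamma> y x" for x y by (simp add: \<Gamma>_def add.commute mult.commute)
    moreover have "g x = g y \<longrightarrow> \<Gamma> x y = 0" for x y by (simp add: \<Gamma>_def R_def)
    ultimately have feas: "adv_feasible n g \<Gamma>" unfolding adv_feasible_def by blast
    \<comment> \<open>The unit vector with squared entries proportional to \<open>w'\<close> undoes
      the rescaling and recovers \<open>tot\<close>.\<close>
    define \<delta> where "\<delta> x = sqrt (w' x) / sqrt W" for x
    have "(\<Sum>x\<in>?X. (\<delta> x)\<^sup>2) = (\<Sum>x\<in>?X. w' x / W)"
      using W w' by (intro sum.cong refl) (simp add: \<delta>_def power_divide less_imp_le)
    also have "\<dots> = 1" using W by (simp add: sum_divide_distrib[symmetric] W_def[symmetric])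
    finally have \<delta>: "L2_set \<delta> ?X \<le> 1" by (simp add: L2_set_le_1_iff)
    have "(\<Sum>x\<in>?X. \<Sum>y\<in>?X. \<delta> x * \<Gamma> x y * \<delta> y) = (\<Sum>x\<in>?X. \<Sum>y\<in>?X. (1 / (4 * W)) * R x y + (1 / (4 * W)) * R y x)"
    proof (intro sum.cong refl)
      fix x y assume xy: "x \<in> ?X" "y \<in> ?X"
      have s: "sqrt (w' x) > 0" "sqrt (w' y) > 0" "sqrt W * sqrt W = W" using w' xy W by auto
      have "\<delta> x * \<Gamma> x y * \<delta> y = (R x y + R y x) / (4 * (sqrt W * sqrt W))"
        using s(1,2) by (simp add: \<delta>_def \<Gamma>_def)
      then show "\<delta> x * \<Gamma> x y * \<delta> y = (1 / (4 * W)) * R x y + (1 / (4 * W)) * R y x"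
        unfolding s(3) by (simp add: add_divide_distrib)
    qed
    also have "\<dots> = (1 / (4 * W)) * tot + (1 / (4 * W)) * (\<Sum>x\<in>?X. \<Sum>y\<in>?X. R y x)"
      unfolding tot_def by (simp only: sum.distrib sum_distrib_left)
    also have "(\<Sum>x\<in>?X. \<Sum>y\<in>?X. R y x) = tot" unfolding tot_def by (rule sum.swap)
    also have "(1 / (4 * W)) * tot + (1 / (4 * W)) * tot = tot / (2 * W)" using W by (simp add: field_simps)
    finally have "tot / (2 * W) \<le> spectral_norm ?X \<Gamma>"
      using bilinear_le_spectral_norm[OF finite_cube \<delta> \<delta>, of \<Gamma>] by simp
    also have "\<dots> \<le> ADV n g" by (rule spectral_norm_le_ADV[OF feas])
    finally have "tot \<le> 2 * ADV n g * W" using W by (simp add: field_simps)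
    also have "\<dots> \<le> lam * W" using W assms by (intro mult_right_mono) (auto simp: lam_def)
    finally show False using WT by linarith
  qed
  then obtain k where k: "k \<in> C" "(\<Sum>z\<in>Z. (p z - k z)\<^sup>2) < \<eta>\<^sup>2" by blast
  have close: "\<bar>p z - k z\<bar> \<le> \<eta>" if "z \<in> Z" for z
  proof -
    have "(p z - k z)\<^sup>2 \<le> (\<Sum>z\<in>Z. (p z - k z)\<^sup>2)"
      using fin that by (intro member_le_sum) (auto simp: Z_def)
    with k(2) have "(p z - k z)\<^sup>2 \<le> \<eta>\<^sup>2" by linarith
    then show ?thesis using \<eta> by (simp add: abs_le_square_iff[symmetric])
  qed
  \<comment> \<open>\<open>k\<close> meets the target only approximately; what is missing has small
    entries and vanishes on the diagonal.\<close>
  let ?E = "\<lambda>x y. if g x \<noteq> g y then 1 - k (x, y) else 0"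
  have "query_cost n ?E (\<lambda>_. real (card ?X) * \<eta>)"
  proof (rule query_cost_zero_diagonal)
    fix x y assume xy: "x \<in> ?X" "y \<in> ?X"
    show "\<bar>?E x y\<bar> \<le> \<eta>"
      using close[of "(x, y)"] xy \<eta> by (auto simp: Z_def F_def p_def)
  qed simp
  from query_cost_add[OF k(1)[unfolded C_def mem_Collect_eq] this]
  show ?thesis
  proof (rule query_cost_mono)
    fix x assume x: "x \<in> ?X"
    have "k (x, x) \<le> lam + \<eta>" using close[of "(x, x)"] x by (auto simp: Z_def dg_def p_def)
    moreover have "\<eta> + real (card ?X) * \<eta> = \<epsilon> / 2"
    proof -
      have "\<eta> + real (card ?X) * \<eta> = (real (card ?X) + 1) * \<eta>" by (simp add: algebra_simps)
      also have "\<dots> = \<epsilon> / 2"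
      proof -
        have "t * (\<epsilon> / (2 * t)) = \<epsilon> / 2" if "0 < t" for t :: real using that by simp
        then show ?thesis unfolding \<eta>_def by (metis of_nat_0_le_iff add_nonneg_pos zero_less_one)
      qed
      finally show ?thesis .
    qed
    ultimately show "k (x, x) + real (card ?X) * \<eta> \<le> 2 * ADV n g + \<epsilon>" by (simp add: lam_def)
  qed simp
qed

subsection \<open>Relational solutions and composition\<close>

text \<open>The vectors \<open>\<sigma>\<close> of a relational solution are represented by their Gram kernels \<open>S a\<close>.\<close>

definition rel_value :: "nat \<Rightarrow> nat \<Rightarrow> (bool list \<times> nat) set \<Rightarrow> real \<Rightarrow> bool" where
  "rel_value n K f W \<longleftrightarrow> (\<exists>S. (\<forall>a\<in>{1..K}. gram (cube n) (S a)) \<and>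
     (\<forall>x\<in>cube n. \<forall>a\<in>{1..K}. (x, a) \<notin> f \<longrightarrow> S a x x = 0) \<and>
     query_cost n (\<lambda>x y. 1 - (\<Sum>a=1..K. S a x y)) (\<lambda>_. W))"

lemma rel_value_mono: "rel_value n K f W \<Longrightarrow> W \<le> W' \<Longrightarrow> rel_value n K f W'"
  unfolding rel_value_def using query_cost_mono by fast

lemma adv_rel_objective_le_iff:
  "adv_rel_objective n d u v \<le> W \<longleftrightarrow>
    (\<forall>x\<in>cube n. (\<Sum>i<n. \<Sum>k<d i. (u x i k)\<^sup>2) \<le> W) \<and> (\<forall>x\<in>cube n. (\<Sum>i<n. \<Sum>k<d i. (v x i k)\<^sup>2) \<le> W)"
  by (simp add: adv_rel_objective_def L2_set_def sum_nonneg Max_le_iff)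

lemma adv_rel_objective_nonneg: "0 \<le> adv_rel_objective n d u v"
proof -
  obtain x where "x \<in> cube n" using cube_nonempty by blast
  moreover have "0 \<le> (\<Sum>i<n. \<Sum>k<d i. (u x i k)\<^sup>2)" by (simp add: sum_nonneg)
  ultimately show ?thesis
    using adv_rel_objective_le_iff[of n d u v "adv_rel_objective n d u v"] by fastforce
qed

lemma rel_value_imp_feasible:
  assumes "rel_value n K f W"
  shows "\<exists>d e u v s. adv_rel_feasible n K f d e u v s \<and> adv_rel_objective n d u v \<le> W"
proof -
  obtain S where S: "\<And>a. a \<in> {1..K} \<Longrightarrow> gram (cube n) (S a)"
    "\<And>x a. x \<in> cube n \<Longrightarrow> a \<in> {1..K} \<Longrightarrow> (x, a) \<notin> f \<Longrightarrow> S a x x = 0"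
    and q: "query_cost n (\<lambda>x y. 1 - (\<Sum>a=1..K. S a x y)) (\<lambda>_. W)"
    using assms unfolding rel_value_def by blast
  obtain e :: nat and t where t: "\<And>a x y. a \<in> {1..K} \<Longrightarrow> x \<in> cube n \<Longrightarrow> y \<in> cube n \<Longrightarrow>
    S a x y = (\<Sum>k<e. t a x k * t a y k)"
    by (rule gram_uniform[OF finite_atLeastAtMost S(1)]) (assumption, rule that)
  define s where "s x a = t a x" for x a
  have s: "S a x y = (\<Sum>k<e. s x a k * s y a k)" if "a \<in> {1..K}" "x \<in> cube n" "y \<in> cube n" for a x y
    using t that by (simp add: s_def)
  obtain D :: nat and u v where
    uv: "\<And>x y. x \<in> cube n \<Longrightarrow> y \<in> cube n \<Longrightarrow>
      (\<Sum>i | i < n \<and> x ! i \<noteq> y ! i. \<Sum>k<D. u x i k * v y i k) = 1 - (\<Sum>a=1..K. S a x y)"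
    "\<And>x. x \<in> cube n \<Longrightarrow> (\<Sum>i<n. \<Sum>k<D. (u x i k)\<^sup>2) \<le> W"
    "\<And>x. x \<in> cube n \<Longrightarrow> (\<Sum>i<n. \<Sum>k<D. (v x i k)\<^sup>2) \<le> W"
    by (rule query_costE[OF q]) (rule that)
  have "adv_rel_feasible n K f (\<lambda>_. D) (\<lambda>_. e) u v s"
    unfolding adv_rel_feasible_def
  proof (intro conjI ballI impI allI)
    fix x y assume xy: "x \<in> cube n" "y \<in> cube n"
    show "(\<Sum>i | i < n \<and> x ! i \<noteq> y ! i. \<Sum>k<D. u x i k * v y i k)
        = 1 - (\<Sum>a=1..K. \<Sum>k<e. s x a k * s y a k)"
      unfolding uv(1)[OF xy] using s xy by simp
  next
    fix x a k assume x: "x \<in> cube n" "a \<in> {1..K}" "(x, a) \<notin> f" "k < e"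
    have "(\<Sum>k<e. (s x a k)\<^sup>2) = 0"
      using S(2)[OF x(1-3)] s[OF x(2,1,1)] by (simp add: power2_eq_square)
    then show "s x a k = 0" using x(4) by (simp add: sum_nonneg_eq_0_iff)
  qed
  moreover have "adv_rel_objective n (\<lambda>_. D) u v \<le> W"
    using uv(2,3) by (simp add: adv_rel_objective_le_iff)
  ultimately show ?thesis by blast
qed

lemma feasible_imp_rel_value:
  assumes "adv_rel_feasible n K f d e u v s"
  shows "rel_value n K f (adv_rel_objective n d u v)"
proof -
  let ?W = "adv_rel_objective n d u v"
  define S where "S a x y = (\<Sum>k<e a. s x a k * s y a k)" for a x y
  \<comment> \<open>The dimension \<open>d i\<close> may depend on the position; padding by zeros
    makes it uniform.\<close>
  define D where "D = (\<Sum>i<n. d i)"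
  have D: "d i \<le> D" if "i < n" for i unfolding D_def using that by (intro member_le_sum) auto
  have pad: "(\<Sum>k<D. if k < d i then F k else 0) = (\<Sum>k<d i. F k)" if "i < n" for i and F :: "nat \<Rightarrow> real"
    using D[OF that] by (intro sum.mono_neutral_cong_right) auto
  have "query_cost n (\<lambda>x y. 1 - (\<Sum>a=1..K. S a x y)) (\<lambda>_. ?W)"
  proof (rule query_costI[of "{..<D}" n "\<lambda>x i k. if k < d i then u x i k else 0" "\<lambda>x i k. if k < d i then v x i k else 0"])
    fix x y assume xy: "x \<in> cube n" "y \<in> cube n"
    have "(\<Sum>k<D. (if k < d i then u x i k else 0) * (if k < d i then v y i k else 0)) = (\<Sum>k<d i. u x i k * v y i k)"
      if "i < n" for i
      unfolding pad[OF that, symmetric] by (intro sum.cong) auto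
    then show "(\<Sum>i | i < n \<and> x ! i \<noteq> y ! i. \<Sum>k<D. (if k < d i then u x i k else 0) * (if k < d i then v y i k else 0))
        = 1 - (\<Sum>a=1..K. S a x y)"
      using assms xy by (simp add: adv_rel_feasible_def S_def)
  next
    fix x assume x: "x \<in> cube n"
    have sq: "(\<Sum>i<n. \<Sum>k<D. (if k < d i then w i k else 0)\<^sup>2) = (\<Sum>i<n. \<Sum>k<d i. (w i k)\<^sup>2)"
      for w :: "nat \<Rightarrow> nat \<Rightarrow> real"
    proof (rule sum.cong[OF refl])
      fix i assume "i \<in> {..<n}"
      then show "(\<Sum>k<D. (if k < d i then w i k else 0)\<^sup>2) = (\<Sum>k<d i. (w i k)\<^sup>2)"
        by (subst pad[symmetric]) (auto intro!: sum.cong)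
    qed
    show "(\<Sum>i<n. \<Sum>k<D. (if k < d i then u x i k else 0)\<^sup>2) \<le> ?W"
      "(\<Sum>i<n. \<Sum>k<D. (if k < d i then v x i k else 0)\<^sup>2) \<le> ?W"
      unfolding sq using adv_rel_objective_le_iff[of n d u v ?W] x by auto
  qed simp
  moreover have "gram (cube n) (S a)" for a
    by (rule gramI[of "{..<e a}" _ _ "\<lambda>x. s x a"]) (auto simp: S_def)
  moreover have "S a x x = 0" if "x \<in> cube n" "a \<in> {1..K}" "(x, a) \<notin> f" for x a
    using assms that by (simp add: S_def adv_rel_feasible_def)
  ultimately show ?thesis unfolding rel_value_def by blast
qed

lemma ADV_rel_le:
  assumes "rel_value n K f W"
  shows "ADV_rel n K f \<le> W"
proof -
  obtain d e u v s where *: "adv_rel_feasible n K f d e u v s" "adv_rel_objective n d u v \<le> W"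
    using rel_value_imp_feasible[OF assms] by blast
  have "ADV_rel n K f \<le> adv_rel_objective n d u v"
    unfolding ADV_rel_def
  proof (rule cInf_lower)
    show "bdd_below {adv_rel_objective n d u v | d e u v s. adv_rel_feasible n K f d e u v s}"
      by (rule bdd_belowI[of _ 0]) (auto simp: adv_rel_objective_nonneg)
  qed (use *(1) in blast)
  with *(2) show ?thesis by linarith
qed

text \<open>One correct answer per input, with mutually orthogonal \<sigma> for different inputs,
  leaves a kernel that is one off the diagonal, and this has some finite cost. Totality of the
  relation thus makes the infimum in \<open>ADV_rel\<close> range over a nonempty set.\<close>

lemma rel_value_total:
  assumes "\<And>x. x \<in> cube n \<Longrightarrow> \<exists>a\<in>{1..K}. (x, a) \<in> f"
  shows "\<exists>W. rel_value n K f W"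
proof -
  define ch where "ch x = (SOME a. a \<in> {1..K} \<and> (x, a) \<in> f)" for x
  have ch: "ch x \<in> {1..K}" "(x, ch x) \<in> f" if "x \<in> cube n" for x
  proof -
    have "\<exists>a. a \<in> {1..K} \<and> (x, a) \<in> f" using assms[OF that] by blast
    from someI_ex[OF this] show "ch x \<in> {1..K}" "(x, ch x) \<in> f" by (simp_all add: ch_def)
  qed
  define S where "S a x y = (if x = y \<and> a = ch x then 1 else (0::real))" for a and x y :: "bool list"
  have "gram (cube n) (S a)" for a
  proof (rule gramI[of "cube n" _ _ "\<lambda>x k. if k = x then if a = ch x then 1 else 0 else 0"])
    fix x y assume xy: "x \<in> cube n" "y \<in> cube n"
    have "(\<Sum>k\<in>cube n. (if k = x then if a = ch x then 1 else 0 else 0) * (if k = y then if a = ch y then 1 else 0 else 0))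
      = (\<Sum>k\<in>cube n. if k = x then S a x y else 0)" by (rule sum.cong) (auto simp: S_def)
    also have "\<dots> = S a x y" using xy by (subst sum.delta) auto
    finally show "S a x y = (\<Sum>k\<in>cube n. (if k = x then if a = ch x then 1 else 0 else 0) *
      (if k = y then if a = ch y then 1 else 0 else 0))" by simp
  qed simp
  moreover have "S a x x = 0" if "x \<in> cube n" "(x, a) \<notin> f" for x a
    using ch(2) that by (auto simp: S_def)
  moreover have "query_cost n (\<lambda>x y. 1 - (\<Sum>a=1..K. S a x y)) (\<lambda>_. real (card (cube n)) * 1)"
  proof (rule query_cost_zero_diagonal)
    have sum: "(\<Sum>a=1..K. S a x y) = (if x = y then 1 else 0)" if x: "x \<in> cube n" for x y
    proof (cases "x = y")
      case True
      have "(\<Sum>a=1..K. S a x y) = (\<Sum>a=1..K. if a = ch x then 1 else 0)"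
        by (rule sum.cong) (auto simp: S_def True)
      then show ?thesis using ch(1)[OF x] True by (simp add: sum.delta)
    qed (simp add: S_def)
    show "1 - (\<Sum>a=1..K. S a x x) = 0" if "x \<in> cube n" for x using sum[OF that] by simp
    show "\<bar>1 - (\<Sum>a=1..K. S a x y)\<bar> \<le> 1" if "x \<in> cube n" "y \<in> cube n" for x y
      using sum[OF that(1)] by simp
  qed
  ultimately show ?thesis unfolding rel_value_def by blast
qed

lemma adv_rel_feasible_total:
  assumes "\<And>x. x \<in> cube n \<Longrightarrow> \<exists>a\<in>{1..K}. (x, a) \<in> f"
  shows "{adv_rel_objective n d u v | d e u v s. adv_rel_feasible n K f d e u v s} \<noteq> {}"
proof -
  obtain W where "rel_value n K f W" using rel_value_total[OF assms] by blast
  from rel_value_imp_feasible[OF this] show ?thesis by blast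
qed

lemma rel_value_of_less:
  assumes "\<And>x. x \<in> cube n \<Longrightarrow> \<exists>a\<in>{1..K}. (x, a) \<in> f" "ADV_rel n K f < W"
  shows "rel_value n K f W"
proof -
  let ?A = "{adv_rel_objective n d u v | d e u v s. adv_rel_feasible n K f d e u v s}"
  have "?A \<noteq> {}" by (rule adv_rel_feasible_total[OF assms(1)])
  then obtain t where "t \<in> ?A" "t < W" using cInf_lessD[of ?A W] assms(2) unfolding ADV_rel_def by blast
  then obtain d e u v s where "adv_rel_feasible n K f d e u v s" "adv_rel_objective n d u v < W" by blast
  then show ?thesis using rel_value_mono[OF feasible_imp_rel_value] less_imp_le by blast
qed

lemma ADV_rel_nonneg:
  assumes "\<And>x. x \<in> cube n \<Longrightarrow> \<exists>a\<in>{1..K}. (x, a) \<in> f"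
  shows "0 \<le> ADV_rel n K f"
  unfolding ADV_rel_def
proof (rule cInf_greatest)
  show "{adv_rel_objective n d u v | d e u v s. adv_rel_feasible n K f d e u v s} \<noteq> {}"
    by (rule adv_rel_feasible_total[OF assms])
qed (use adv_rel_objective_nonneg in blast)

lemma ADV_rel_constant_answer:
  assumes "a0 \<in> {1..K}" "\<And>x. x \<in> cube n \<Longrightarrow> (x, a0) \<in> f"
  shows "ADV_rel n K f \<le> 0"
proof (rule ADV_rel_le)
  define S where "S a x y = (if a = a0 then 1 else (0::real))" for a and x y :: "bool list"
  have "gram (cube n) (S a)" for a
    by (rule gramI[of "{()}" _ _ "\<lambda>_ _. if a = a0 then 1 else 0"]) (auto simp: S_def)
  moreover have "S a x x = 0" if "x \<in> cube n" "(x, a) \<notin> f" for x a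
    using assms(2) that by (auto simp: S_def)
  moreover have "(\<Sum>a=1..K. S a x y) = 1" for x y using assms(1) by (simp add: S_def sum.delta)
  then have "query_cost n (\<lambda>x y. 1 - (\<Sum>a=1..K. S a x y)) (\<lambda>_. 0)" by (simp add: query_cost_zero)
  ultimately show "rel_value n K f 0" unfolding rel_value_def by blast
qed

section \<open>Blocks of the input and composition of solutions\<close>

definition block :: "nat \<Rightarrow> nat \<Rightarrow> bool list \<Rightarrow> bool list" where
  "block m j x = take m (drop (j * m) x)"

definition word :: "nat \<Rightarrow> nat \<Rightarrow> (bool list \<Rightarrow> bool) \<Rightarrow> bool list \<Rightarrow> bool list" where
  "word N m g x = map (\<lambda>j. g (block m j x)) [0..<N]"

lemma block_position: "j < N \<Longrightarrow> k < m \<Longrightarrow> j * m + k < N * (m::nat)"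
proof -
  assume "j < N" "k < m"
  then have "j * m + k < j * m + m" "(j + 1) * m \<le> N * m" by (simp, intro mult_le_mono1, simp)
  then show ?thesis by simp
qed

lemma block_cube:
  assumes "x \<in> cube (N * m)" "j < N"
  shows "block m j x \<in> cube m"
proof -
  have "(j + 1) * m \<le> N * m" using assms(2) by (intro mult_le_mono1) simp
  then show ?thesis using assms(1) by (simp add: cube_def block_def)
qed

lemma block_nth:
  assumes "x \<in> cube (N * m)" "j < N" "k < m"
  shows "block m j x ! k = x ! (j * m + k)"
  using assms block_position[OF assms(2,3)] by (simp add: cube_def block_def)

lemma word_cube [simp]: "word N m g x \<in> cube N"
  by (simp add: word_def cube_def)

lemma word_nth [simp]: "j < N \<Longrightarrow> word N m g x ! j = g (block m j x)"
  by (simp add: word_def)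

lemma rel_comp_iff: "(x, a) \<in> rel_comp N m f g \<longleftrightarrow> x \<in> cube (N * m) \<and> (word N m g x, a) \<in> f"
  by (simp add: rel_comp_def word_def block_def)

lemma sum_positions:
  fixes F :: "nat \<Rightarrow> real"
  shows "(\<Sum>i<N * m. F i) = (\<Sum>j<N. \<Sum>k<m. F (j * m + k))"
proof -
  have "(\<Sum>i<N * m. F i) = (\<Sum>j<N. sum F {j * m..<j * m + m})" by (rule sum.nat_group[symmetric])
  also have "\<dots> = (\<Sum>j<N. \<Sum>k<m. F (j * m + k))"
  proof (rule sum.cong[OF refl])
    fix j
    show "sum F {j * m..<j * m + m} = (\<Sum>k<m. F (j * m + k))"
      using sum.shift_bounds_nat_ivl[of F 0 "j * m" m] by (simp add: lessThan_atLeast0 add.commute)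
  qed
  finally show ?thesis .
qed

lemma sum_differing_positions:
  fixes F :: "nat \<Rightarrow> real"
  assumes "x \<in> cube (N * m)" "y \<in> cube (N * m)"
  shows "(\<Sum>i | i < N * m \<and> x ! i \<noteq> y ! i. F i) =
    (\<Sum>j<N. \<Sum>k | k < m \<and> block m j x ! k \<noteq> block m j y ! k. F (j * m + k))"
  unfolding sum_filter_less sum_positions using assms by (intro sum.cong refl) (simp add: block_nth)

text \<open>Position \<open>i\<close> is place \<open>i mod m\<close> of block
  \<open>i div m\<close>, and its vector is the tensor product of the outer vector of the block with
  the inner vector of the place. Summing over the differing places of a block leaves the indicator
  that \<open>g\<close> differs there, which restricts the outer sum to the differing letters of the
  words.\<close>

lemma query_cost_compose:
  assumes E: "query_cost N E (\<lambda>_. c)" and q: "query_cost m (\<lambda>x y. if g x \<noteq> g y then 1 else 0) (\<lambda>_. c')"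
    and "0 \<le> c'"
  shows "query_cost (N * m) (\<lambda>x y. E (word N m g x) (word N m g y)) (\<lambda>_. c * c')"
proof -
  obtain D :: nat and U V where
    UV: "\<And>x y. x \<in> cube N \<Longrightarrow> y \<in> cube N \<Longrightarrow>
      (\<Sum>i | i < N \<and> x ! i \<noteq> y ! i. \<Sum>k<D. U x i k * V y i k) = E x y"
    "\<And>x. x \<in> cube N \<Longrightarrow> (\<Sum>i<N. \<Sum>k<D. (U x i k)\<^sup>2) \<le> c"
    "\<And>x. x \<in> cube N \<Longrightarrow> (\<Sum>i<N. \<Sum>k<D. (V x i k)\<^sup>2) \<le> c"
    by (rule query_costE[OF E]) (rule that)
  obtain D' :: nat and u v where
    uv: "\<And>x y. x \<in> cube m \<Longrightarrow> y \<in> cube m \<Longrightarrow>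
      (\<Sum>i | i < m \<and> x ! i \<noteq> y ! i. \<Sum>k<D'. u x i k * v y i k) = (if g x \<noteq> g y then 1 else 0)"
    "\<And>x. x \<in> cube m \<Longrightarrow> (\<Sum>i<m. \<Sum>k<D'. (u x i k)\<^sup>2) \<le> c'"
    "\<And>x. x \<in> cube m \<Longrightarrow> (\<Sum>i<m. \<Sum>k<D'. (v x i k)\<^sup>2) \<le> c'"
    by (rule query_costE[OF q]) (rule that)
  let ?w = "word N m g"
  define tens where "tens A b x i p = A (?w x) (i div m) (fst p) * b (block m (i div m) x) (i mod m) (snd p)"
    for A b :: "bool list \<Rightarrow> nat \<Rightarrow> nat \<Rightarrow> real" and x i and p :: "nat \<times> nat"
  let ?R = "{..<D} \<times> {..<D'}"
  note prod = sum_times_fst_snd[of _ _ "{..<D}" "{..<D'}"]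
  have cost: "(\<Sum>i<N * m. \<Sum>p\<in>?R. (tens A b x i p)\<^sup>2) \<le> c * c'"
    if A: "\<And>x. x \<in> cube N \<Longrightarrow> (\<Sum>i<N. \<Sum>k<D. (A x i k)\<^sup>2) \<le> c"
      and b: "\<And>x. x \<in> cube m \<Longrightarrow> (\<Sum>i<m. \<Sum>k<D'. (b x i k)\<^sup>2) \<le> c'"
      and x: "x \<in> cube (N * m)" for A b x
  proof -
    have "(\<Sum>i<N * m. \<Sum>p\<in>?R. (tens A b x i p)\<^sup>2)
      = (\<Sum>j<N. \<Sum>k<m. (\<Sum>l<D. (A (?w x) j l)\<^sup>2) * (\<Sum>l<D'. (b (block m j x) k l)\<^sup>2))"
      unfolding sum_positions
    proof (intro sum.cong refl)
      fix j k assume "j \<in> {..<N}" "k \<in> {..<m}"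
      then show "(\<Sum>p\<in>?R. (tens A b x (j * m + k) p)\<^sup>2)
        = (\<Sum>l<D. (A (?w x) j l)\<^sup>2) * (\<Sum>l<D'. (b (block m j x) k l)\<^sup>2)"
        unfolding prod[symmetric] by (intro sum.cong refl) (simp add: tens_def power_mult_distrib)
    qed
    also have "\<dots> = (\<Sum>j<N. (\<Sum>l<D. (A (?w x) j l)\<^sup>2) * (\<Sum>k<m. \<Sum>l<D'. (b (block m j x) k l)\<^sup>2))"
      by (simp add: sum_distrib_left)
    also have "\<dots> \<le> (\<Sum>j<N. (\<Sum>l<D. (A (?w x) j l)\<^sup>2) * c')"
      using b block_cube[OF x] by (intro sum_mono mult_left_mono) (auto simp: sum_nonneg)
    also have "\<dots> = (\<Sum>j<N. \<Sum>l<D. (A (?w x) j l)\<^sup>2) * c'" by (simp add: sum_distrib_right)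
    also have "\<dots> \<le> c * c'" using A[of "?w x"] assms(3) by (intro mult_right_mono) auto
    finally show ?thesis .
  qed
  show ?thesis
  proof (rule query_costI[of ?R "N * m" "tens U u" "tens V v"])
    fix x y assume xy: "x \<in> cube (N * m)" "y \<in> cube (N * m)"
    have "(\<Sum>i | i < N * m \<and> x ! i \<noteq> y ! i. \<Sum>p\<in>?R. tens U u x i p * tens V v y i p)
      = (\<Sum>j<N. \<Sum>k | k < m \<and> block m j x ! k \<noteq> block m j y ! k.
          (\<Sum>l<D. U (?w x) j l * V (?w y) j l) * (\<Sum>l<D'. u (block m j x) k l * v (block m j y) k l))"
      unfolding sum_differing_positions[OF xy]
    proof (intro sum.cong refl)
      fix j k assume "j \<in> {..<N}" "k \<in> {k. k < m \<and> block m j x ! k \<noteq> block m j y ! k}"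
      then show "(\<Sum>p\<in>?R. tens U u x (j * m + k) p * tens V v y (j * m + k) p)
        = (\<Sum>l<D. U (?w x) j l * V (?w y) j l) * (\<Sum>l<D'. u (block m j x) k l * v (block m j y) k l)"
        unfolding prod[symmetric] by (intro sum.cong refl) (simp add: tens_def)
    qed
    also have "\<dots> = (\<Sum>j<N. (\<Sum>l<D. U (?w x) j l * V (?w y) j l)
        * (if g (block m j x) \<noteq> g (block m j y) then 1 else 0))"
      using uv(1) block_cube[OF xy(1)] block_cube[OF xy(2)] by (simp add: sum_distrib_left[symmetric])
    also have "\<dots> = (\<Sum>j | j < N \<and> ?w x ! j \<noteq> ?w y ! j. \<Sum>l<D. U (?w x) j l * V (?w y) j l)"
      unfolding sum_filter_less by (intro sum.cong refl) simp
    also have "\<dots> = E (?w x) (?w y)" by (rule UV(1)) auto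
    finally show "(\<Sum>i | i < N * m \<and> x ! i \<noteq> y ! i. \<Sum>p\<in>?R. tens U u x i p * tens V v y i p)
      = E (?w x) (?w y)" .
  qed (use cost UV uv in auto)
qed

lemma rel_value_compose:
  assumes "rel_value N K f c" "query_cost m (\<lambda>x y. if g x \<noteq> g y then 1 else 0) (\<lambda>_. c')" "0 \<le> c'"
  shows "rel_value (N * m) K (rel_comp N m f g) (c * c')"
proof -
  obtain S where S: "\<And>a. a \<in> {1..K} \<Longrightarrow> gram (cube N) (S a)"
    "\<And>x a. x \<in> cube N \<Longrightarrow> a \<in> {1..K} \<Longrightarrow> (x, a) \<notin> f \<Longrightarrow> S a x x = 0"
    and q: "query_cost N (\<lambda>x y. 1 - (\<Sum>a=1..K. S a x y)) (\<lambda>_. c)"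
    using assms(1) unfolding rel_value_def by blast
  show ?thesis unfolding rel_value_def
  proof (intro exI[of _ "\<lambda>a x y. S a (word N m g x) (word N m g y)"] conjI ballI impI)
    show "gram (cube (N * m)) (\<lambda>x y. S a (word N m g x) (word N m g y))" if "a \<in> {1..K}" for a
      by (rule gram_pullback[OF S(1)[OF that]]) simp
    show "S a (word N m g x) (word N m g x) = 0"
      if "x \<in> cube (N * m)" "a \<in> {1..K}" "(x, a) \<notin> rel_comp N m f g" for x a
      using that by (intro S(2)) (auto simp: rel_comp_iff)
    show "query_cost (N * m) (\<lambda>x y. 1 - (\<Sum>a=1..K. S a (word N m g x) (word N m g y))) (\<lambda>_. c * c')"
      by (rule query_cost_compose[OF q assms(2,3)])
  qed
qed

subsection \<open>Positive semidefinite kernels and averaging\<close>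

lemma gram_insert_zero:
  assumes "gram X K" "s \<notin> X" "\<And>y. y \<in> insert s X \<Longrightarrow> K s y = 0 \<and> K y s = 0"
  shows "gram (insert s X) K"
proof -
  obtain D :: nat and r where r: "\<And>x y. x \<in> X \<Longrightarrow> y \<in> X \<Longrightarrow> K x y = (\<Sum>k<D. r x k * r y k)"
    by (rule gramE[OF assms(1)]) (rule that)
  show ?thesis
  proof (rule gramI[of "{..<D}" _ _ "\<lambda>x k. if x = s then 0 else r x k"])
    fix x y assume xy: "x \<in> insert s X" "y \<in> insert s X"
    show "K x y = (\<Sum>k<D. (if x = s then 0 else r x k) * (if y = s then 0 else r y k))"
    proof (cases "x = s \<or> y = s")
      case True
      then show ?thesis using assms(3) xy by auto
    next
      case False
      then show ?thesis using r xy by simp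
    qed
  qed simp
qed

text \<open>A Cholesky factorization, eliminating one index at a time by a Schur complement.\<close>

lemma psd_imp_gram:
  fixes K :: "'x \<Rightarrow> 'x \<Rightarrow> real"
  assumes "finite X" "\<And>x y. x \<in> X \<Longrightarrow> y \<in> X \<Longrightarrow> K x y = K y x"
    "\<And>v. 0 \<le> (\<Sum>x\<in>X. \<Sum>y\<in>X. v x * K x y * v y)"
  shows "gram X K"
  using assms
proof (induction X arbitrary: K rule: finite_induct)
  case empty
  show ?case by (rule gramI[of "{}"]) auto
next
  case (insert s X)
  have split: "(\<Sum>x\<in>insert s X. \<Sum>y\<in>insert s X. v x * K x y * v y)
    = (v s)\<^sup>2 * K s s + 2 * v s * (\<Sum>y\<in>X. K s y * v y) + (\<Sum>x\<in>X. \<Sum>y\<in>X. v x * K x y * v y)" for v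
  proof -
    have "(\<Sum>x\<in>X. v x * K x s * v s) = v s * (\<Sum>y\<in>X. K s y * v y)"
      unfolding sum_distrib_left using insert.prems(1) by (intro sum.cong refl) (simp add: mult_ac)
    moreover have "(\<Sum>y\<in>X. v s * K s y * v y) = v s * (\<Sum>y\<in>X. K s y * v y)"
      unfolding sum_distrib_left by (intro sum.cong refl) (simp add: mult_ac)
    ultimately show ?thesis
      using insert.hyps by (simp add: sum.distrib power2_eq_square algebra_simps)
  qed
  have diag: "0 \<le> K s s"
    using insert.prems(2)[of "\<lambda>x. if x = s then 1 else 0"] insert.hyps
    unfolding split by (simp add: sum.delta if_distrib cong: if_cong)
  show ?case
  proof (cases "K s s = 0")
    case True
    have zero: "K s x = 0" if x: "x \<in> X" for x
    proof (rule ccontr)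
      assume nz: "K s x \<noteq> 0"
      \<comment> \<open>As \<open>K s s = 0\<close>, the form at \<open>t\<close> times
        \<open>s\<close> plus \<open>x\<close> is affine in \<open>t\<close>; at this
        \<open>t\<close> it would be -1.\<close>
      define t where "t = - (K x x + 1) / (2 * K s x)"
      let ?v = "\<lambda>y. if y = s then t else if y = x then 1 else 0"
      have xs: "x \<noteq> s" using x insert.hyps by blast
      have "(\<Sum>y\<in>X. K s y * ?v y) = (\<Sum>y\<in>X. if y = x then K s x else 0)"
        using insert.hyps by (intro sum.cong) auto
      moreover have "(\<Sum>x'\<in>X. \<Sum>y\<in>X. ?v x' * K x' y * ?v y) = (\<Sum>x'\<in>X. if x' = x then K x x else 0)"
      proof (intro sum.cong refl)
        fix x' assume x': "x' \<in> X"
        have "(\<Sum>y\<in>X. ?v x' * K x' y * ?v y) = (\<Sum>y\<in>X. if y = x then if x' = x then K x x else 0 else 0)"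
          using insert.hyps x' by (intro sum.cong) auto
        then show "(\<Sum>y\<in>X. ?v x' * K x' y * ?v y) = (if x' = x then K x x else 0)"
          using x insert.hyps by (simp add: sum.delta)
      qed
      ultimately have "0 \<le> 2 * t * K s x + K x x"
        using insert.prems(2)[of ?v] True x insert.hyps unfolding split by (simp add: sum.delta)
      moreover have "2 * t * K s x = - (K x x + 1)" using nz by (simp add: t_def)
      ultimately show False by linarith
    qed
    have "gram X K"
    proof (rule insert.IH)
      show "0 \<le> (\<Sum>x\<in>X. \<Sum>y\<in>X. v x * K x y * v y)" for v
      proof -
        have "(\<Sum>x\<in>X. \<Sum>y\<in>X. (v(s := 0)) x * K x y * (v(s := 0)) y) = (\<Sum>x\<in>X. \<Sum>y\<in>X. v x * K x y * v y)"
          using insert.hyps by (intro sum.cong refl) auto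
        then show ?thesis using insert.prems(2)[of "v(s := 0)"] unfolding split by simp
      qed
    qed (use insert.prems(1) in blast)
    then show ?thesis
      using insert.hyps insert.prems(1) True zero by (intro gram_insert_zero) auto
  next
    case False
    then have pos: "0 < K s s" using diag by simp
    define c where "c x = K s x / sqrt (K s s)" for x
    have cc: "c x * c y = K s x * K s y / K s s" for x y
    proof -
      have "sqrt (K s s) * sqrt (K s s) = K s s" using pos by simp
      then show ?thesis by (simp only: c_def times_divide_times_eq)
    qed
    define K' where "K' x y = K x y - c x * c y" for x y
    have "gram X K'"
    proof (rule insert.IH)
      show "K' x y = K' y x" if "x \<in> X" "y \<in> X" for x y
        using insert.prems(1)[of x y] that by (simp add: K'_def)
      show "0 \<le> (\<Sum>x\<in>X. \<Sum>y\<in>X. v x * K' x y * v y)" for v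
      proof -
        define L where "L = (\<Sum>y\<in>X. K s y * v y)"
        \<comment> \<open>Completing the square: this value at \<open>s\<close> minimizes the form
          of \<open>K\<close>, and the minimum is the form of the Schur complement
          \<open>K'\<close>.\<close>
        define v' where "v' = v(s := - L / K s s)"
        have on: "v' x = v x" if "x \<in> X" for x using that insert.hyps by (auto simp: v'_def)
        have "(\<Sum>x\<in>X. \<Sum>y\<in>X. v' x * K x y * v' y) = (\<Sum>x\<in>X. \<Sum>y\<in>X. v x * K x y * v y)"
          by (intro sum.cong refl) (simp add: on)
        moreover have "(\<Sum>y\<in>X. K s y * v' y) = L" unfolding L_def by (intro sum.cong refl) (simp add: on)
        moreover have "v' s = - L / K s s" by (simp add: v'_def)
        ultimately have "0 \<le> (- L / K s s)\<^sup>2 * K s s + 2 * (- L / K s s) * L + (\<Sum>x\<in>X. \<Sum>y\<in>X. v x * K x y * v y)"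
          using insert.prems(2)[of v'] unfolding split by simp
        moreover have "(- L / K s s)\<^sup>2 * K s s + 2 * (- L / K s s) * L = - (L * L / K s s)"
          using pos by (simp add: power2_eq_square)
        moreover have "(\<Sum>x\<in>X. \<Sum>y\<in>X. v x * (c x * c y) * v y) = L * L / K s s"
        proof -
          have "(\<Sum>x\<in>X. \<Sum>y\<in>X. v x * (c x * c y) * v y) = (\<Sum>x\<in>X. \<Sum>y\<in>X. (K s x * v x) * (K s y * v y) / K s s)"
            by (intro sum.cong refl) (simp add: cc mult_ac)
          also have "\<dots> = L * L / K s s"
            unfolding L_def by (simp only: sum_divide_distrib[symmetric] sum_product)
          finally show ?thesis .
        qed
        ultimately show ?thesis
          by (simp add: K'_def left_diff_distrib right_diff_distrib sum_subtractf)
      qed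
    qed
    have "K' s y = 0" "K' y s = 0" if "y \<in> insert s X" for y
      using insert.prems(1)[of y s] that pos by (auto simp: K'_def cc)
    with \<open>gram X K'\<close> insert.hyps have "gram (insert s X) K'" by (intro gram_insert_zero) auto
    from gram_add[OF this gram_rank_one[of _ c]] show ?thesis
      by (rule gram_cong) (simp add: K'_def)
  qed
qed

text \<open>An adversary matrix is bipartite between the two values of \<open>g\<close>, so negating
  a vector on one side negates its quadratic form. The maximum \<open>\<mu>\<close> of the form
  therefore bounds it from below as well, which makes the identity plus
  \<open>\<Gamma> / \<mu>\<close> positive semidefinite, and a maximizer can be normalized on each
  side separately without losing value.\<close>

lemma adversary_top_vector:
  assumes feas: "adv_feasible m g \<Gamma>" and pos: "0 < spectral_norm (cube m) \<Gamma>"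
  obtains \<mu> \<delta> where "spectral_norm (cube m) \<Gamma> \<le> \<mu>"
    "gram (cube m) (\<lambda>x y. (if x = y then 1 else 0) + \<Gamma> x y / \<mu>)"
    "\<And>b. (\<Sum>x\<in>{x\<in>cube m. g x = b}. (\<delta> x)\<^sup>2) = 1"
    "\<And>b. (\<Sum>x\<in>{x\<in>cube m. g x = b}. \<Sum>y\<in>{y\<in>cube m. g y \<noteq> b}. \<delta> x * \<Gamma> x y * \<delta> y) = \<mu>"
proof -
  let ?X = "cube m"
  have sym: "\<Gamma> x y = \<Gamma> y x" if "x \<in> ?X" "y \<in> ?X" for x y
    using feas that unfolding adv_feasible_def by blast
  have van: "\<Gamma> x y = 0" if "x \<in> ?X" "y \<in> ?X" "g x = g y" for x y
    using feas that unfolding adv_feasible_def by blast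
  define q where "q v = (\<Sum>x\<in>?X. \<Sum>y\<in>?X. v x * \<Gamma> x y * v y)" for v
  define sq where "sq v = (\<Sum>x\<in>?X. (v x)\<^sup>2)" for v :: "bool list \<Rightarrow> real"
  define vals where "vals = q ` {v. sq v = 1}"
  define \<mu> where "\<mu> = Sup vals"
  have bdd: "bdd_above vals"
    unfolding vals_def
  proof (rule bdd_aboveI2)
    fix v assume "v \<in> {v. sq v = 1}"
    then have "L2_set v ?X \<le> 1" by (simp add: sq_def L2_set_le_1_iff)
    then show "q v \<le> spectral_norm ?X \<Gamma>" unfolding q_def by (intro bilinear_le_spectral_norm) auto
  qed
  have q_scale: "q (\<lambda>x. t * v x) = t\<^sup>2 * q v" for t v
    unfolding q_def sum_distrib_left by (intro sum.cong refl) (simp add: power2_eq_square mult_ac)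
  have sq_scale: "sq (\<lambda>x. t * v x) = t\<^sup>2 * sq v" for t v
    unfolding sq_def sum_distrib_left by (intro sum.cong refl) (simp add: power_mult_distrib)
  have sq_nonneg: "0 \<le> sq v" for v by (simp add: sq_def sum_nonneg)
  have q_le: "q v \<le> \<mu> * sq v" for v
  proof (cases "sq v = 0")
    case True
    then have "v x = 0" if "x \<in> ?X" for x using that by (simp add: sq_def sum_nonneg_eq_0_iff)
    then show ?thesis using True by (simp add: q_def)
  next
    case False
    then have s: "0 < sq v" using sq_nonneg[of v] by simp
    have "sq (\<lambda>x. (1 / sqrt (sq v)) * v x) = 1" unfolding sq_scale using s by (simp add: power_divide)
    then have "q (\<lambda>x. (1 / sqrt (sq v)) * v x) \<in> vals" by (auto simp: vals_def)
    then have "q (\<lambda>x. (1 / sqrt (sq v)) * v x) \<le> \<mu>" unfolding \<mu>_def using bdd by (rule cSup_upper)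
    then have "q v / sq v \<le> \<mu>" unfolding q_scale using s by (simp add: power_divide)
    then show ?thesis using s by (simp add: field_simps)
  qed
  define flip where "flip v x = (if g x then v x else - v x)" for v :: "bool list \<Rightarrow> real" and x
  have q_flip: "q (flip v) = - q v" for v
    unfolding q_def sum_negf[symmetric]
    by (intro sum.cong refl) (auto simp: flip_def van)
  have sq_flip: "sq (flip v) = sq v" for v
    unfolding sq_def by (intro sum.cong refl) (simp add: flip_def)
  have q_ge: "- q v \<le> \<mu> * sq v" for v using q_le[of "flip v"] by (simp add: q_flip sq_flip)
  obtain x0 where x0: "x0 \<in> ?X" using cube_nonempty by blast
  let ?e = "\<lambda>x. if x = x0 then 1 else (0::real)"
  have "sq ?e = (\<Sum>x\<in>?X. if x = x0 then 1 else 0)" unfolding sq_def by (rule sum.cong) auto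
  then have e: "sq ?e = 1" using x0 by (simp add: sum.delta)
  have mu_nonneg: "0 \<le> \<mu>" using q_le[of ?e] q_ge[of ?e] e by simp
  \<comment> \<open>Polarization: the bilinear form comes from a difference of two quadratic forms,
    each bounded in absolute value by \<open>\<mu>\<close> times the squared norm.\<close>
  have norm_le: "spectral_norm ?X \<Gamma> \<le> \<mu>"
  proof (rule spectral_norm_le_bilinear)
    fix a b assume ab: "L2_set a ?X \<le> 1" "L2_set b ?X \<le> (1::real)"
    have "q (\<lambda>x. a x + b x) - q (\<lambda>x. a x - b x) = (\<Sum>x\<in>?X. \<Sum>y\<in>?X. 2 * (a x * \<Gamma> x y * b y) + 2 * (a y * \<Gamma> y x * b x))"
      unfolding q_def sum_subtractf[symmetric] using sym by (intro sum.cong refl) (simp add: algebra_simps)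
    also have "\<dots> = 2 * (\<Sum>x\<in>?X. \<Sum>y\<in>?X. a x * \<Gamma> x y * b y) + 2 * (\<Sum>x\<in>?X. \<Sum>y\<in>?X. a y * \<Gamma> y x * b x)"
      by (simp only: sum.distrib sum_distrib_left)
    also have "(\<Sum>x\<in>?X. \<Sum>y\<in>?X. a y * \<Gamma> y x * b x) = (\<Sum>x\<in>?X. \<Sum>y\<in>?X. a x * \<Gamma> x y * b y)" by (rule sum.swap)
    finally have "4 * (\<Sum>x\<in>?X. \<Sum>y\<in>?X. a x * \<Gamma> x y * b y) = q (\<lambda>x. a x + b x) - q (\<lambda>x. a x - b x)" by simp
    also have "\<dots> \<le> \<mu> * sq (\<lambda>x. a x + b x) + \<mu> * sq (\<lambda>x. a x - b x)"
      using q_le[of "\<lambda>x. a x + b x"] q_ge[of "\<lambda>x. a x - b x"] by linarith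
    also have "\<dots> = \<mu> * (2 * (sq a + sq b))"
    proof -
      have "sq (\<lambda>x. a x + b x) + sq (\<lambda>x. a x - b x) = 2 * (sq a + sq b)"
        unfolding sq_def sum.distrib[symmetric] sum_distrib_left
        by (intro sum.cong refl) (simp add: power2_eq_square algebra_simps)
      then show ?thesis by (simp only: distrib_left[symmetric])
    qed
    also have "\<dots> \<le> \<mu> * (2 * (1 + 1))"
      using ab mu_nonneg by (intro mult_left_mono add_mono) (auto simp: sq_def L2_set_le_1_iff)
    finally show "(\<Sum>x\<in>?X. \<Sum>y\<in>?X. a x * \<Gamma> x y * b y) \<le> \<mu>" by simp
  qed (use mu_nonneg in auto)
  have mu_pos: "0 < \<mu>" using norm_le pos by linarith
  have gram: "gram ?X (\<lambda>x y. (if x = y then 1 else 0) + \<Gamma> x y / \<mu>)"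
  proof (rule psd_imp_gram)
    fix v
    have "(\<Sum>x\<in>?X. \<Sum>y\<in>?X. v x * ((if x = y then 1 else 0) + \<Gamma> x y / \<mu>) * v y)
      = (\<Sum>x\<in>?X. \<Sum>y\<in>?X. (if x = y then (v x)\<^sup>2 else 0) + (1 / \<mu>) * (v x * \<Gamma> x y * v y))"
      by (intro sum.cong refl) (simp add: power2_eq_square algebra_simps)
    also have "\<dots> = (\<Sum>x\<in>?X. \<Sum>y\<in>?X. if x = y then (v x)\<^sup>2 else 0) + (1 / \<mu>) * q v"
      unfolding q_def by (simp only: sum.distrib sum_distrib_left)
    also have "(\<Sum>x\<in>?X. \<Sum>y\<in>?X. if x = y then (v x)\<^sup>2 else 0) = sq v" by (simp add: sq_def sum.delta')
    finally have eq: "(\<Sum>x\<in>?X. \<Sum>y\<in>?X. v x * ((if x = y then 1 else 0) + \<Gamma> x y / \<mu>) * v y) = sq v + (1 / \<mu>) * q v" .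
    have "- sq v \<le> q v / \<mu>" using q_ge[of v] mu_pos by (simp add: field_simps)
    then show "0 \<le> (\<Sum>x\<in>?X. \<Sum>y\<in>?X. v x * ((if x = y then 1 else 0) + \<Gamma> x y / \<mu>) * v y)"
      unfolding eq by simp
  qed (use sym in auto)
  obtain v where v: "sq v = 1" "q v = \<mu>"
  proof -
    have "\<exists>v. sq v = 1 \<and> \<mu> - 1 / real (Suc n) < q v" for n
    proof -
      have "vals \<noteq> {}" using e by (auto simp: vals_def)
      moreover have "\<mu> - 1 / real (Suc n) < Sup vals" by (simp add: \<mu>_def)
      ultimately obtain t where "t \<in> vals" "\<mu> - 1 / real (Suc n) < t" by (rule less_cSupD[THEN bexE]) blast
      then show ?thesis by (auto simp: vals_def)
    qed
    then have "\<forall>n. \<exists>v. sq v = 1 \<and> \<mu> - 1 / real (Suc n) < q v" by blast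
    from choice[OF this] obtain V where V: "\<And>n. sq (V n) = 1" "\<And>n. \<mu> - 1 / real (Suc n) < q (V n)" by blast
    have "\<bar>V n x\<bar> \<le> 1" if "x \<in> ?X" for n x
    proof -
      have "(V n x)\<^sup>2 \<le> sq (V n)" unfolding sq_def using that by (intro member_le_sum) auto
      then show ?thesis using V(1) by (simp add: abs_square_le_1)
    qed
    from pointwise_convergent_subseq[where k=V, OF finite_cube this] obtain s v where
      s: "strict_mono (s :: nat \<Rightarrow> nat)" and lim: "\<And>x. x \<in> ?X \<Longrightarrow> (\<lambda>n. V (s n) x) \<longlonglongrightarrow> v x" by blast
    have "(\<lambda>n. sq (V (s n))) \<longlonglongrightarrow> sq v" unfolding sq_def using lim by (intro tendsto_intros) auto
    then have sq1: "sq v = 1" using V(1) LIMSEQ_unique[OF _ tendsto_const] by simp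
    have "(\<lambda>n. q (V (s n))) \<longlonglongrightarrow> q v" unfolding q_def using lim by (intro tendsto_intros) auto
    moreover have "(\<lambda>n. \<mu> - 1 / real (Suc (s n))) \<longlonglongrightarrow> \<mu>"
    proof -
      have "(\<lambda>n. \<mu> - 1 / real (Suc n)) \<longlonglongrightarrow> \<mu> - 0"
        using LIMSEQ_inverse_real_of_nat by (intro tendsto_intros) (simp add: inverse_eq_divide)
      from LIMSEQ_subseq_LIMSEQ[OF this s] show ?thesis by (simp add: o_def)
    qed
    ultimately have "\<mu> \<le> q v" using V(2) less_imp_le by (intro LIMSEQ_le[where X="\<lambda>n. \<mu> - 1 / real (Suc (s n))"]) blast+
    moreover have "q v \<le> \<mu>" using q_le[of v] sq1 by simp
    ultimately show thesis using that sq1 by simp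
  qed
  define X where "X b = {x\<in>?X. g x = b}" for b
  have Xsplit: "(\<Sum>x\<in>?X. F x) = (\<Sum>x\<in>X True. F x) + (\<Sum>x\<in>X False. F x)" for F :: "bool list \<Rightarrow> real"
  proof -
    have "?X = X True \<union> X False" by (auto simp: X_def)
    moreover have "X True \<inter> X False = {}" by (auto simp: X_def)
    ultimately show ?thesis by (metis finite_Un finite_cube sum.union_disjoint)
  qed
  have Xin: "x \<in> ?X" "g x = b" if "x \<in> X b" for x b using that by (auto simp: X_def)
  define h where "h v b = (\<Sum>x\<in>X b. \<Sum>y\<in>X (\<not> b). v x * \<Gamma> x y * v y)" for v :: "bool list \<Rightarrow> real" and b
  have h_sym: "h v b = h v True" for v b
  proof (cases b)
    case False
    have "h v False = (\<Sum>x\<in>X True. \<Sum>y\<in>X False. v y * \<Gamma> y x * v x)"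
      unfolding h_def by (simp, rule sum.swap)
    also have "\<dots> = h v True" unfolding h_def using sym Xin by (intro sum.cong refl) (auto simp: mult_ac)
    finally show ?thesis using False by simp
  qed simp
  have qh: "q v = 2 * h v True" for v
  proof -
    have same: "(\<Sum>x\<in>X b. \<Sum>y\<in>X b. v x * \<Gamma> x y * v y) = 0" for b
      using van Xin by (intro sum.neutral ballI) (metis mult_zero_left mult_zero_right)
    have "q v = h v True + h v False"
      unfolding q_def Xsplit h_def sum.distrib using same by simp
    then show ?thesis using h_sym[of v False] by simp
  qed
  define nb where "nb b = (\<Sum>x\<in>X b. (v x)\<^sup>2)" for b
  have nb_sum: "nb True + nb False = 1" using v(1) unfolding sq_def nb_def Xsplit .
  have nb_pos: "0 < nb b" for b
  proof (rule ccontr)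
    assume "\<not> 0 < nb b"
    moreover have "0 \<le> nb b" by (simp add: nb_def sum_nonneg)
    ultimately have "nb b = 0" by linarith
    moreover have "finite (X b)" by (simp add: X_def)
    ultimately have "v x = 0" if "x \<in> X b" for x using that by (simp add: nb_def sum_nonneg_eq_0_iff)
    then have "h v b = 0" by (simp add: h_def)
    then show False using v(2) mu_pos h_sym[of v b] qh[of v] by simp
  qed
  define \<delta> where "\<delta> x = v x / sqrt (nb (g x))" for x
  have \<delta>1: "(\<Sum>x\<in>X b. (\<delta> x)\<^sup>2) = 1" for b
  proof -
    have "(\<Sum>x\<in>X b. (\<delta> x)\<^sup>2) = (\<Sum>x\<in>X b. (v x)\<^sup>2 / nb b)"
      using nb_pos[of b] Xin by (intro sum.cong refl) (simp add: \<delta>_def power_divide)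
    also have "\<dots> = nb b / nb b" by (simp only: nb_def sum_divide_distrib[symmetric])
    finally show ?thesis using nb_pos[of b] by simp
  qed
  \<comment> \<open>Normalizing both halves divides the cross form by \<open>P\<close>. Since
    \<open>2 * P \<le> 1\<close> by the inequality of means, the value does not drop below
    \<open>\<mu>\<close>; as the new vector has squared norm two, \<open>q_le\<close> keeps it from
    exceeding \<open>\<mu>\<close>.\<close>
  define P where "P = sqrt (nb True) * sqrt (nb False)"
  have P: "0 < P" using nb_pos by (simp add: P_def)
  have P_le: "2 * P \<le> 1"
  proof -
    have "0 \<le> (sqrt (nb True) - sqrt (nb False))\<^sup>2" by simp
    also have "\<dots> = nb True + nb False - 2 * P"
      using nb_pos[of True] nb_pos[of False] by (simp add: power2_diff P_def)
    finally show ?thesis using nb_sum by simp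
  qed
  have h\<delta>: "h \<delta> True = h v True / P"
    unfolding h_def sum_divide_distrib using Xin by (intro sum.cong refl) (simp add: \<delta>_def P_def)
  have "h \<delta> True = \<mu>"
  proof (rule antisym)
    have "sq \<delta> = 2" unfolding sq_def Xsplit using \<delta>1 by simp
    then show "h \<delta> True \<le> \<mu>" using q_le[of \<delta>] qh[of \<delta>] by simp
    have "\<mu> * (2 * P) \<le> \<mu> * 1" using P_le mu_pos by (intro mult_left_mono) auto
    then show "\<mu> \<le> h \<delta> True" unfolding h\<delta> using qh[of v] v(2) P by (simp add: field_simps)
  qed
  then have "h \<delta> b = \<mu>" for b using h_sym[of \<delta> b] by simp
  moreover have "{y\<in>?X. g y \<noteq> b} = X (\<not> b)" for b by (auto simp: X_def)
  ultimately show thesis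
    using \<delta>1 by (intro that[OF norm_le gram, of \<delta>]) (simp_all add: h_def X_def)
qed

section \<open>Sums over inputs that factor over the blocks\<close>

lemma cube_append: "bij_betw (\<lambda>(a, x). a @ x) (cube m \<times> cube n) (cube (m + n))"
proof (rule bij_betwI[where g="\<lambda>x. (take m x, drop m x)"])
qed (auto simp: cube_def)

lemma sum_cube_prod_blocks:
  fixes h :: "nat \<Rightarrow> bool list \<Rightarrow> real"
  shows "(\<Sum>x\<in>cube (N * m). \<Prod>j<N. h j (block m j x)) = (\<Prod>j<N. \<Sum>a\<in>cube m. h j a)"
proof (induction N arbitrary: h)
  case 0
  have "cube 0 = {[]}" by (auto simp: cube_def)
  then show ?case by simp
next
  case (Suc N)
  have bl: "block m 0 (a @ x) = a" "block m (Suc j) (a @ x) = block m j x" if "a \<in> cube m" for a x j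
    using that by (simp_all add: block_def cube_def)
  have "(\<Sum>x\<in>cube (Suc N * m). \<Prod>j<Suc N. h j (block m j x))
    = (\<Sum>p\<in>cube m \<times> cube (N * m). \<Prod>j<Suc N. h j (block m j (fst p @ snd p)))"
    using sum.reindex_bij_betw[OF cube_append[of m "N * m"], of "\<lambda>x. \<Prod>j<Suc N. h j (block m j x)"]
    by (simp add: split_def)
  also have "\<dots> = (\<Sum>a\<in>cube m. \<Sum>x\<in>cube (N * m). h 0 a * (\<Prod>j<N. h (Suc j) (block m j x)))"
    by (auto simp: sum.cartesian_product bl prod.lessThan_Suc_shift split_def simp del: prod.lessThan_Suc intro!: sum.cong)
  also have "\<dots> = (\<Sum>a\<in>cube m. h 0 a) * (\<Sum>x\<in>cube (N * m). \<Prod>j<N. h (Suc j) (block m j x))"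
    by (simp only: sum_product)
  also have "\<dots> = (\<Prod>j<Suc N. \<Sum>a\<in>cube m. h j a)"
    unfolding Suc.IH[of "\<lambda>j. h (Suc j)"] by (simp only: prod.lessThan_Suc_shift o_def)
  finally show ?case .
qed

lemma sum_cube_prod_blocks2:
  fixes H :: "nat \<Rightarrow> bool list \<Rightarrow> bool list \<Rightarrow> real"
  shows "(\<Sum>x\<in>cube (N * m). \<Sum>y\<in>cube (N * m). \<Prod>j<N. H j (block m j x) (block m j y))
    = (\<Prod>j<N. \<Sum>a\<in>cube m. \<Sum>b\<in>cube m. H j a b)"
proof -
  have "(\<Sum>y\<in>cube (N * m). \<Prod>j<N. H j (block m j x) (block m j y)) = (\<Prod>j<N. \<Sum>b\<in>cube m. H j (block m j x) b)" for x
    by (rule sum_cube_prod_blocks)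
  then show ?thesis using sum_cube_prod_blocks[where h="\<lambda>j a. \<Sum>b\<in>cube m. H j a b"] by simp
qed

lemma cube_eq_of_blocks:
  assumes "x \<in> cube (N * m)" "y \<in> cube (N * m)" "\<And>j. j < N \<Longrightarrow> block m j x = block m j y"
  shows "x = y"
proof (rule nth_equalityI)
  show "length x = length y" using assms by (simp add: cube_def)
  fix i assume "i < length x"
  then have i: "i < N * m" using assms(1) by (simp add: cube_def)
  then have m: "0 < m" by (cases m) auto
  have j: "i div m < N" using i m by (simp add: less_mult_imp_div_less)
  have "x ! (i div m * m + i mod m) = y ! (i div m * m + i mod m)"
    using block_nth[OF assms(1) j, of "i mod m"] block_nth[OF assms(2) j, of "i mod m"] assms(3)[OF j] m by simp
  then show "x ! i = y ! i" by simp
qed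

lemma sum_bucket:
  fixes \<alpha> :: "'x \<Rightarrow> real"
  assumes "finite X" "finite A" "\<And>x. x \<in> A \<Longrightarrow> s x \<in> X"
  shows "(\<Sum>t\<in>X. (\<Sum>x\<in>A. if s x = t then \<alpha> x else 0) * h' t) = (\<Sum>x\<in>A. \<alpha> x * h' (s x))"
proof -
  have "(\<Sum>t\<in>X. (\<Sum>x\<in>A. if s x = t then \<alpha> x else 0) * h' t)
    = (\<Sum>t\<in>X. \<Sum>x\<in>A. if s x = t then \<alpha> x * h' t else 0)"
    unfolding sum_distrib_right by (intro sum.cong refl) simp
  also have "\<dots> = (\<Sum>x\<in>A. \<Sum>t\<in>X. if s x = t then \<alpha> x * h' t else 0)" by (rule sum.swap)
  also have "\<dots> = (\<Sum>x\<in>A. \<alpha> x * h' (s x))"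
    using assms by (intro sum.cong refl) (simp add: sum.delta')
  finally show ?thesis .
qed

text \<open>Coordinates of the sum over \<open>x\<close> in \<open>A\<close> of the basis vector at
  \<open>s x\<close> tensored with \<open>\<alpha> x\<close>. A matrix on the values of
  \<open>s\<close> can then act on the first factor.\<close>

definition bucket :: "('x \<Rightarrow> 't) \<Rightarrow> 'x set \<Rightarrow> ('x \<Rightarrow> 'q \<Rightarrow> real) \<Rightarrow> 't \<Rightarrow> 'q \<Rightarrow> real" where
  "bucket s A \<alpha> t q = (\<Sum>x\<in>A. if s x = t then \<alpha> x q else 0)"

lemma bucket_bilinear:
  assumes "finite X" "finite A" "finite B" "\<And>x. x \<in> A \<Longrightarrow> s x \<in> X" "\<And>x. x \<in> B \<Longrightarrow> s x \<in> X"
  shows "(\<Sum>t\<in>X. \<Sum>q\<in>I. bucket s A \<alpha> t q * mat_app X G (\<lambda>t'. bucket s B \<beta> t' q) t)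
    = (\<Sum>x\<in>A. \<Sum>y\<in>B. G (s x) (s y) * (\<Sum>q\<in>I. \<alpha> x q * \<beta> y q))"
proof -
  have "(\<Sum>t\<in>X. \<Sum>q\<in>I. bucket s A \<alpha> t q * mat_app X G (\<lambda>t'. bucket s B \<beta> t' q) t)
    = (\<Sum>q\<in>I. \<Sum>t\<in>X. bucket s A \<alpha> t q * mat_app X G (\<lambda>t'. bucket s B \<beta> t' q) t)" by (rule sum.swap)
  also have "\<dots> = (\<Sum>q\<in>I. \<Sum>x\<in>A. \<Sum>y\<in>B. G (s x) (s y) * (\<alpha> x q * \<beta> y q))"
  proof (rule sum.cong[OF refl])
    fix q
    have app: "mat_app X G (\<lambda>t'. bucket s B \<beta> t' q) t = (\<Sum>y\<in>B. \<beta> y q * G t (s y))" for t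
      unfolding mat_app_def bucket_def
      using sum_bucket[OF assms(1,3,5), where \<alpha>="\<lambda>y. \<beta> y q" and h'="\<lambda>t'. G t t'"] by (simp add: mult.commute)
    have "(\<Sum>t\<in>X. bucket s A \<alpha> t q * mat_app X G (\<lambda>t'. bucket s B \<beta> t' q) t)
      = (\<Sum>x\<in>A. \<alpha> x q * mat_app X G (\<lambda>t'. bucket s B \<beta> t' q) (s x))"
      unfolding bucket_def[of s A] by (rule sum_bucket[OF assms(1,2,4)])
    also have "\<dots> = (\<Sum>x\<in>A. \<Sum>y\<in>B. G (s x) (s y) * (\<alpha> x q * \<beta> y q))"
      unfolding app sum_distrib_left by (simp add: mult_ac)
    finally show "(\<Sum>t\<in>X. bucket s A \<alpha> t q * mat_app X G (\<lambda>t'. bucket s B \<beta> t' q) t)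
      = (\<Sum>x\<in>A. \<Sum>y\<in>B. G (s x) (s y) * (\<alpha> x q * \<beta> y q))" .
  qed
  also have "\<dots> = (\<Sum>x\<in>A. \<Sum>y\<in>B. \<Sum>q\<in>I. G (s x) (s y) * (\<alpha> x q * \<beta> y q))" by (rule sum_rotate)
  finally show ?thesis by (simp add: sum_distrib_left)
qed

lemma bucket_norm:
  assumes "finite X" "finite A" "\<And>x. x \<in> A \<Longrightarrow> s x \<in> X"
  shows "(\<Sum>t\<in>X. \<Sum>q\<in>I. (bucket s A \<alpha> t q)\<^sup>2)
    = (\<Sum>x\<in>A. \<Sum>y\<in>A. if s x = s y then (\<Sum>q\<in>I. \<alpha> x q * \<alpha> y q) else 0)"
proof -
  let ?id = "\<lambda>t t'. if t = t' then 1 else (0::real)"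
  have app: "mat_app X ?id v t = v t" if "t \<in> X" for v t
  proof -
    show ?thesis unfolding mat_app_def by (rule sum_times_delta(2)[OF assms(1) that])
  qed
  have "(\<Sum>t\<in>X. \<Sum>q\<in>I. (bucket s A \<alpha> t q)\<^sup>2)
    = (\<Sum>t\<in>X. \<Sum>q\<in>I. bucket s A \<alpha> t q * mat_app X ?id (\<lambda>t'. bucket s A \<alpha> t' q) t)"
    by (intro sum.cong refl) (simp add: app power2_eq_square)
  also have "\<dots> = (\<Sum>x\<in>A. \<Sum>y\<in>A. ?id (s x) (s y) * (\<Sum>q\<in>I. \<alpha> x q * \<alpha> y q))"
    by (rule bucket_bilinear[OF assms(1,2,2,3,3)])
  also have "\<dots> = (\<Sum>x\<in>A. \<Sum>y\<in>A. if s x = s y then (\<Sum>q\<in>I. \<alpha> x q * \<alpha> y q) else 0)"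
    by (intro sum.cong refl) simp
  finally show ?thesis .
qed

text \<open>
  Averaging a solution for the composed relation over the inputs \<open>x\<close> with word \<open>z\<close>, with weights
  built from the top singular vectors of an adversary matrix of \<open>g\<close>, yields a solution for \<open>f\<close>.
  The total weight of each pair \<open>(z, w)\<close> is one, which preserves the constant in the constraint,
  and the condition on \<open>hadamard_D k \<Gamma>\<close> saves a factor of \<open>\<mu>\<close> in the cost.
\<close>

lemma rel_value_decompose:
  assumes feas: "adv_feasible m g \<Gamma>" and pos: "0 < spectral_norm (cube m) \<Gamma>"
    and val: "rel_value (N * m) K (rel_comp N m f g) W" and W: "0 \<le> W"
  shows "rel_value N K f (W / spectral_norm (cube m) \<Gamma>)"
proof -
  obtain \<mu> \<delta> where mu: "spectral_norm (cube m) \<Gamma> \<le> \<mu>"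
    and gram0: "gram (cube m) (\<lambda>x y. (if x = y then 1 else 0) + \<Gamma> x y / \<mu>)"
    and half: "\<And>b. (\<Sum>x\<in>{x\<in>cube m. g x = b}. (\<delta> x)\<^sup>2) = 1"
    and cross: "\<And>b. (\<Sum>x\<in>{x\<in>cube m. g x = b}. \<Sum>y\<in>{y\<in>cube m. g y \<noteq> b}. \<delta> x * \<Gamma> x y * \<delta> y) = \<mu>"
    by (rule adversary_top_vector[OF feas pos]) (rule that)
  have mu_pos: "0 < \<mu>" using mu pos by linarith
  have van: "\<Gamma> x y = 0" if "x \<in> cube m" "y \<in> cube m" "g x = g y" for x y
    using feas that unfolding adv_feasible_def by blast
  obtain S where S: "\<And>a. a \<in> {1..K} \<Longrightarrow> gram (cube (N * m)) (S a)"
    "\<And>x a. x \<in> cube (N * m) \<Longrightarrow> a \<in> {1..K} \<Longrightarrow> (x, a) \<notin> rel_comp N m f g \<Longrightarrow> S a x x = 0"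
    and q: "query_cost (N * m) (\<lambda>x y. 1 - (\<Sum>a=1..K. S a x y)) (\<lambda>_. W)"
    using val unfolding rel_value_def by blast
  obtain D :: nat and u v where
    uv: "\<And>x y. x \<in> cube (N * m) \<Longrightarrow> y \<in> cube (N * m) \<Longrightarrow>
      (\<Sum>i | i < N * m \<and> x ! i \<noteq> y ! i. \<Sum>k<D. u x i k * v y i k) = 1 - (\<Sum>a=1..K. S a x y)"
    "\<And>x. x \<in> cube (N * m) \<Longrightarrow> (\<Sum>i<N * m. \<Sum>k<D. (u x i k)\<^sup>2) \<le> W"
    "\<And>x. x \<in> cube (N * m) \<Longrightarrow> (\<Sum>i<N * m. \<Sum>k<D. (v x i k)\<^sup>2) \<le> W"
    by (rule query_costE[OF q]) (rule that)
  let ?C = "cube (N * m)"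
  \<comment> \<open>Between inputs with equal \<open>g\<close> this is the identity, between the
    others the rescaled adversary matrix; its products over blocks are positive
    semidefinite.\<close>
  define k0 where "k0 x y = (if x = y then 1 else 0) + \<Gamma> x y / \<mu>" for x y
  define bl where "bl j x = block m j x" for j x
  have bl: "bl j x \<in> cube m" if "x \<in> ?C" "j < N" for j x using that by (simp add: bl_def block_cube)
  \<comment> \<open>Block \<open>j\<close> is left out because there the adversary matrix acts as an
    operator, not as an entrywise factor.\<close>
  define rest where "rest j x y = (\<Prod>l\<in>{..<N} - {j}. k0 (bl l x) (bl l y))" for j x y
  define wt where "wt x = (\<Prod>j<N. \<delta> (bl j x))" for x
  define M where "M x y = wt x * wt y * (\<Prod>j<N. k0 (bl j x) (bl j y))" for x y
  define A where "A z = {x\<in>?C. word N m g x = z}" for z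
  have A: "finite (A z)" "x \<in> A z \<Longrightarrow> x \<in> ?C" for z x by (auto simp: A_def)
  have Aw: "g (bl j x) = z ! j" if "x \<in> A z" "j < N" for x z j
    using that by (auto simp: A_def bl_def)
  have A_iff: "x \<in> A z \<longleftrightarrow> (\<forall>j<N. g (bl j x) = z ! j)" if "x \<in> ?C" "z \<in> cube N" for x z
    using that by (auto simp: A_def bl_def cube_def word_def list_eq_iff_nth_eq)
  have k0_same: "k0 a b = (if a = b then 1 else 0)" if "a \<in> cube m" "b \<in> cube m" "g a = g b" for a b
    using van[OF that] by (simp add: k0_def)
  have prod_ind: "(\<Prod>j\<in>J. if P j then h j else 0) = (if \<forall>j\<in>J. P j then (\<Prod>j\<in>J. h j) else (0::real))"
    if "finite J" for J :: "nat set" and P h using that by (induction J rule: finite_induct) auto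
  have mass1: "(\<Sum>x\<in>A z. (wt x)\<^sup>2) = 1" if z: "z \<in> cube N" for z
  proof -
    have "(\<Sum>x\<in>A z. (wt x)\<^sup>2) = (\<Sum>x\<in>?C. if \<forall>j<N. g (bl j x) = z ! j then (wt x)\<^sup>2 else 0)"
      using A_iff[OF _ z] by (intro sum.mono_neutral_cong_left) (auto simp: A_def)
    also have "\<dots> = (\<Sum>x\<in>?C. \<Prod>j<N. (if g (bl j x) = z ! j then (\<delta> (bl j x))\<^sup>2 else 0))"
      by (intro sum.cong refl) (simp add: prod_ind wt_def prod_power_distrib)
    also have "\<dots> = (\<Prod>j<N. \<Sum>a\<in>cube m. if g a = z ! j then (\<delta> a)\<^sup>2 else 0)"
      unfolding bl_def by (rule sum_cube_prod_blocks)
    also have "\<dots> = 1" using half by (simp add: sum.inter_filter)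
    finally show ?thesis .
  qed
  \<comment> \<open>The sum factors over the blocks. Where the letters agree, \<open>k0\<close> is
    the identity and the factor is the squared norm of \<delta> on one side, which is 1; where they
    differ, it is \<open>\<mu> / \<mu>\<close>.\<close>
  have mass2: "(\<Sum>x\<in>A z. \<Sum>y\<in>A w. M x y) = 1" if zw: "z \<in> cube N" "w \<in> cube N" for z w
  proof -
    define H where "H j a b = (if g a = z ! j \<and> g b = w ! j then \<delta> a * \<delta> b * k0 a b else 0)" for j a b
    have H1: "(\<Sum>a\<in>cube m. \<Sum>b\<in>cube m. H j a b) = 1" if j: "j < N" for j
    proof -
      have eq: "(\<Sum>a\<in>cube m. \<Sum>b\<in>cube m. H j a b)
        = (\<Sum>a\<in>{a\<in>cube m. g a = z ! j}. \<Sum>b\<in>{b\<in>cube m. g b = w ! j}. \<delta> a * \<delta> b * k0 a b)"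
      proof -
        have "(\<Sum>b\<in>cube m. H j a b) = (if g a = z ! j then (\<Sum>b\<in>{b\<in>cube m. g b = w ! j}. \<delta> a * \<delta> b * k0 a b) else 0)" for a
          by (simp add: H_def sum.inter_filter)
        then show ?thesis by (simp only: sum.inter_filter[OF finite_cube, symmetric])
      qed
      show ?thesis
      proof (cases "z ! j = w ! j")
        case True
        have "(\<Sum>b\<in>{b\<in>cube m. g b = w ! j}. \<delta> a * \<delta> b * k0 a b) = (\<delta> a)\<^sup>2"
          if a: "a \<in> {a\<in>cube m. g a = z ! j}" for a
        proof -
          have "(\<Sum>b\<in>{b\<in>cube m. g b = w ! j}. \<delta> a * \<delta> b * k0 a b)
            = (\<Sum>b\<in>{b\<in>cube m. g b = w ! j}. if a = b then (\<delta> a)\<^sup>2 else 0)"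
            using a True by (intro sum.cong refl) (auto simp: k0_same power2_eq_square)
          then show ?thesis using a True by (simp add: sum.delta')
        qed
        then show ?thesis unfolding eq using half by simp
      next
        case False
        then have set: "{b\<in>cube m. g b = w ! j} = {b\<in>cube m. g b \<noteq> z ! j}" by auto
        have "(\<Sum>a\<in>{a\<in>cube m. g a = z ! j}. \<Sum>b\<in>{b\<in>cube m. g b = w ! j}. \<delta> a * \<delta> b * k0 a b)
          = (\<Sum>a\<in>{a\<in>cube m. g a = z ! j}. \<Sum>b\<in>{b\<in>cube m. g b \<noteq> z ! j}. \<delta> a * \<Gamma> a b * \<delta> b / \<mu>)"
          unfolding set by (intro sum.cong refl) (auto simp: k0_def)
        also have "\<dots> = \<mu> / \<mu>" by (simp only: sum_divide_distrib[symmetric] cross)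
        finally show ?thesis unfolding eq using mu_pos by simp
      qed
    qed
    have "(\<Sum>x\<in>A z. \<Sum>y\<in>A w. M x y) = (\<Sum>x\<in>?C. \<Sum>y\<in>?C. \<Prod>j<N. H j (bl j x) (bl j y))"
    proof (rule sum.mono_neutral_cong_left)
      have prodH: "(\<Prod>j<N. H j (bl j x) (bl j y)) = (if x \<in> A z \<and> y \<in> A w then M x y else 0)"
        if "x \<in> ?C" "y \<in> ?C" for x y
        using A_iff[OF that(1) zw(1)] A_iff[OF that(2) zw(2)]
        by (auto simp: H_def prod_ind M_def wt_def prod.distrib)
      show "(\<Sum>y\<in>A w. M x y) = (\<Sum>y\<in>?C. \<Prod>j<N. H j (bl j x) (bl j y))" if x: "x \<in> A z" for x
        using x A(2) prodH by (intro sum.mono_neutral_cong_left) auto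
      show "\<forall>x\<in>?C - A z. (\<Sum>y\<in>?C. \<Prod>j<N. H j (bl j x) (bl j y)) = 0"
        using prodH by simp
    qed (use A in auto)
    also have "\<dots> = (\<Prod>j<N. \<Sum>a\<in>cube m. \<Sum>b\<in>cube m. H j a b)"
      unfolding bl_def by (rule sum_cube_prod_blocks2)
    also have "\<dots> = 1" using H1 by simp
    finally show ?thesis .
  qed
  have gk0: "gram ?C (\<lambda>x y. k0 (bl j x) (bl j y))" if "j < N" for j
    using gram_pullback[OF gram0, of ?C "bl j"] bl[OF _ that] by (simp add: k0_def)
  define S' where "S' a z w = (\<Sum>x\<in>A z. \<Sum>y\<in>A w. M x y * S a x y)" for a z w
  have S'_gram: "gram (cube N) (S' a)" if a: "a \<in> {1..K}" for a
    unfolding S'_def[abs_def] M_def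
    by (rule gram_push[of ?C])
      (auto intro!: gram_mult gram_rank_one gram_prod gk0 S(1)[OF a] simp: A_def)
  have S'_zero: "S' a z z = 0" if z: "z \<in> cube N" "a \<in> {1..K}" "(z, a) \<notin> f" for a z
  proof -
    have "S a x y = 0" if "x \<in> A z" "y \<in> A z" for x y
    proof (rule gram_zero_diag[OF S(1)[OF z(2)]])
      show "S a x x = 0" using that z by (intro S(2)) (auto simp: A_def rel_comp_iff)
    qed (use that A in auto)
    then show ?thesis by (simp add: S'_def)
  qed
  have S'_sum: "1 - (\<Sum>a=1..K. S' a z w) = (\<Sum>x\<in>A z. \<Sum>y\<in>A w. M x y * (1 - (\<Sum>a=1..K. S a x y)))"
    if "z \<in> cube N" "w \<in> cube N" for z w
  proof -
    have "(\<Sum>a=1..K. S' a z w) = (\<Sum>x\<in>A z. \<Sum>y\<in>A w. \<Sum>a=1..K. M x y * S a x y)"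
      unfolding S'_def by (rule sum_rotate)
    then show ?thesis
      using mass2[OF that] by (simp add: right_diff_distrib sum_subtractf sum_distrib_left)
  qed
  have grest: "\<And>j. j \<in> {..<N} \<Longrightarrow> gram ?C (rest j)"
    unfolding rest_def[abs_def] by (rule gram_prod) (use gk0 in auto)
  obtain R :: nat and \<rho> where \<rho>: "\<And>j x y. j \<in> {..<N} \<Longrightarrow> x \<in> ?C \<Longrightarrow> y \<in> ?C \<Longrightarrow>
      rest j x y = (\<Sum>k<R. \<rho> j x k * \<rho> j y k)"
    by (rule gram_uniform[OF finite_lessThan grest]) (assumption, rule that)
  have rest_same: "rest j x y = (if \<forall>l<N. l \<noteq> j \<longrightarrow> bl l x = bl l y then 1 else 0)"
    if "x \<in> A z" "y \<in> A z" for j x y z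
  proof -
    have "rest j x y = (\<Prod>l\<in>{..<N} - {j}. if bl l x = bl l y then 1 else 0)"
      unfolding rest_def
    proof (rule prod.cong[OF refl])
      fix l assume l: "l \<in> {..<N} - {j}"
      show "k0 (bl l x) (bl l y) = (if bl l x = bl l y then 1 else 0)"
        by (rule k0_same) (use l that A bl Aw in auto)
    qed
    then show ?thesis by (auto simp: prod_ind)
  qed
  define vec where "vec w j k x p = wt x * \<rho> j x (fst p) * w x (j * m + k) (snd p)"
    for w :: "bool list \<Rightarrow> nat \<Rightarrow> nat \<Rightarrow> real" and j k x and p :: "nat \<times> nat"
  let ?Q = "{..<R} \<times> {..<D}"
  have vec_inner: "(\<Sum>p\<in>?Q. vec a j k x p * vec b j k y p)
    = wt x * wt y * rest j x y * (\<Sum>l<D. a x (j * m + k) l * b y (j * m + k) l)"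
    if "j < N" "x \<in> ?C" "y \<in> ?C" for a b j k x y
  proof -
    have "(\<Sum>p\<in>?Q. vec a j k x p * vec b j k y p) = (\<Sum>p\<in>?Q. wt x * wt y * ((\<rho> j x (fst p) * \<rho> j y (fst p)) * (a x (j * m + k) (snd p) * b y (j * m + k) (snd p))))"
      by (intro sum.cong refl) (simp add: vec_def mult_ac)
    also have "\<dots> = wt x * wt y * ((\<Sum>r<R. \<rho> j x r * \<rho> j y r) * (\<Sum>l<D. a x (j * m + k) l * b y (j * m + k) l))"
      unfolding sum_times_fst_snd[symmetric] by (rule sum_distrib_left[symmetric])
    finally show ?thesis using \<rho> that by (simp add: mult_ac)
  qed
  \<comment> \<open>Within one fibre, \<open>rest\<close> forces all blocks but \<open>j\<close> to
    agree and the bucket forces block \<open>j\<close> to agree. So only \<open>x = y\<close>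
    contributes, and by \<open>mass1\<close> the norms are averaged with weights of sum one.\<close>
  have norm: "(\<Sum>t\<in>cube m. \<Sum>p\<in>?Q. (bucket (bl j) (A z) (vec a j k) t p)\<^sup>2)
      = (\<Sum>x\<in>A z. (wt x)\<^sup>2 * (\<Sum>l<D. (a x (j * m + k) l)\<^sup>2))"
    if j: "j < N" for a j k z
  proof -
    have "(\<Sum>t\<in>cube m. \<Sum>p\<in>?Q. (bucket (bl j) (A z) (vec a j k) t p)\<^sup>2)
      = (\<Sum>x\<in>A z. \<Sum>y\<in>A z. if bl j x = bl j y then (\<Sum>p\<in>?Q. vec a j k x p * vec a j k y p) else 0)"
      by (rule bucket_norm) (use A bl j in auto)
    also have "\<dots> = (\<Sum>x\<in>A z. \<Sum>y\<in>A z. if x = y then (wt x)\<^sup>2 * (\<Sum>l<D. (a x (j * m + k) l)\<^sup>2) else 0)"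
    proof (intro sum.cong refl)
      fix x y assume xy: "x \<in> A z" "y \<in> A z"
      have "x = y" if "\<forall>l<N. l \<noteq> j \<longrightarrow> bl l x = bl l y" "bl j x = bl j y"
        using that xy A by (intro cube_eq_of_blocks[of x N m y]) (auto simp: bl_def)
      then show "(if bl j x = bl j y then (\<Sum>p\<in>?Q. vec a j k x p * vec a j k y p) else 0)
        = (if x = y then (wt x)\<^sup>2 * (\<Sum>l<D. (a x (j * m + k) l)\<^sup>2) else 0)"
        using xy A vec_inner[OF j, of x y a k a] rest_same[OF xy, of j] by (auto simp: power2_eq_square)
    qed
    also have "\<dots> = (\<Sum>x\<in>A z. (wt x)\<^sup>2 * (\<Sum>l<D. (a x (j * m + k) l)\<^sup>2))"
      using A by (intro sum.cong refl) (simp add: sum.delta')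
    finally show ?thesis .
  qed
  have total: "(\<Sum>j<N. \<Sum>k<m. \<Sum>x\<in>A z. (wt x)\<^sup>2 * (\<Sum>l<D. (a x (j * m + k) l)\<^sup>2)) \<le> W"
    if z: "z \<in> cube N" and a: "\<And>x. x \<in> ?C \<Longrightarrow> (\<Sum>i<N * m. \<Sum>k<D. (a x i k)\<^sup>2) \<le> W" for a z
  proof -
    have "(\<Sum>j<N. \<Sum>k<m. \<Sum>x\<in>A z. (wt x)\<^sup>2 * (\<Sum>l<D. (a x (j * m + k) l)\<^sup>2))
      = (\<Sum>i<N * m. \<Sum>x\<in>A z. (wt x)\<^sup>2 * (\<Sum>l<D. (a x i l)\<^sup>2))" by (simp add: sum_positions)
    also have "\<dots> = (\<Sum>x\<in>A z. \<Sum>i<N * m. (wt x)\<^sup>2 * (\<Sum>l<D. (a x i l)\<^sup>2))" by (rule sum.swap)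
    also have "\<dots> = (\<Sum>x\<in>A z. (wt x)\<^sup>2 * (\<Sum>i<N * m. \<Sum>l<D. (a x i l)\<^sup>2))" by (simp add: sum_distrib_left)
    also have "\<dots> \<le> (\<Sum>x\<in>A z. (wt x)\<^sup>2 * W)" using a A by (intro sum_mono mult_left_mono) auto
    also have "\<dots> = W" using mass1[OF z] by (simp add: sum_distrib_right[symmetric])
    finally show ?thesis .
  qed
  \<comment> \<open>The adversary matrix is applied on the right-hand side only, and
    \<open>1 / \<mu>\<close> is split evenly. As \<open>hadamard_D k \<Gamma>\<close> has norm at
    most one, both costs end up divided by \<open>\<mu>\<close>.\<close>
  define U where "U z j p = bucket (bl j) (A z) (vec u j (fst p)) (fst (snd p)) (snd (snd p)) / sqrt \<mu>"
    for z j and p :: "nat \<times> bool list \<times> nat \<times> nat"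
  define V where "V z j p = mat_app (cube m) (hadamard_D (fst p) \<Gamma>)
      (\<lambda>t. bucket (bl j) (A z) (vec v j (fst p)) t (snd (snd p))) (fst (snd p)) / sqrt \<mu>"
    for z j and p :: "nat \<times> bool list \<times> nat \<times> nat"
  let ?ip = "\<lambda>j k x y. \<Sum>l<D. u x (j * m + k) l * v y (j * m + k) l"
  let ?row = "\<lambda>j x y. \<Sum>k | k < m \<and> bl j x ! k \<noteq> bl j y ! k. ?ip j k x y"
  let ?G = "\<lambda>k. hadamard_D k \<Gamma>"
  let ?bu = "\<lambda>a z j k. bucket (bl j) (A z) (vec a j k)"
  let ?app = "\<lambda>z j k t p. mat_app (cube m) (?G k) (\<lambda>t. ?bu v z j k t p) t"
  let ?P = "{..<m} \<times> cube m \<times> ?Q"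
  have split3: "(\<Sum>p\<in>?P. F (fst p) (fst (snd p)) (snd (snd p))) = (\<Sum>k<m. \<Sum>t\<in>cube m. \<Sum>p\<in>?Q. F k t p)"
    for F :: "nat \<Rightarrow> bool list \<Rightarrow> nat \<times> nat \<Rightarrow> real"
    by (simp add: sum.cartesian_product split_def)
  have "query_cost N (\<lambda>z w. 1 - (\<Sum>a=1..K. S' a z w)) (\<lambda>_. W / \<mu>)"
  proof (rule query_costI[of ?P N U V])
    fix z w assume zw: "z \<in> cube N" "w \<in> cube N"
    have inner: "(\<Sum>p\<in>?P. U z j p * V w j p) = (\<Sum>k<m. \<Sum>x\<in>A z. \<Sum>y\<in>A w.
        ?G k (bl j x) (bl j y) / \<mu> * (wt x * wt y * rest j x y * ?ip j k x y))"
      if j: "j < N" for j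
    proof -
      have sm: "sqrt \<mu> * sqrt \<mu> = \<mu>" using mu_pos by simp
      have "(\<Sum>p\<in>?P. U z j p * V w j p) = (\<Sum>k<m. \<Sum>t\<in>cube m. \<Sum>p\<in>?Q.
         (?bu u z j k t p / sqrt \<mu>)
         * (?app w j k t p / sqrt \<mu>))"
        unfolding U_def V_def by (rule split3)
      also have "\<dots> = (\<Sum>k<m. (\<Sum>t\<in>cube m. \<Sum>p\<in>?Q. ?bu u z j k t p
         * ?app w j k t p) / \<mu>)"
        by (simp only: times_divide_times_eq sm sum_divide_distrib)
      also have "\<dots> = (\<Sum>k<m. (\<Sum>x\<in>A z. \<Sum>y\<in>A w. ?G k (bl j x) (bl j y)
          * (\<Sum>p\<in>?Q. vec u j k x p * vec v j k y p)) / \<mu>)"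
        using A bl[OF _ j] by (simp add: bucket_bilinear)
      also have "\<dots> = (\<Sum>k<m. \<Sum>x\<in>A z. \<Sum>y\<in>A w. ?G k (bl j x) (bl j y) / \<mu>
          * (\<Sum>p\<in>?Q. vec u j k x p * vec v j k y p))"
        by (simp add: sum_divide_distrib)
      also have "\<dots> = (\<Sum>k<m. \<Sum>x\<in>A z. \<Sum>y\<in>A w.
        ?G k (bl j x) (bl j y) / \<mu> * (wt x * wt y * rest j x y * ?ip j k x y))"
        using A j by (intro sum.cong refl) (simp add: vec_inner)
      finally show ?thesis .
    qed
    have step: "(if z ! j \<noteq> w ! j then (\<Sum>p\<in>?P. U z j p * V w j p) else 0)
      = (\<Sum>x\<in>A z. \<Sum>y\<in>A w. M x y * ?row j x y)"
      if j: "j < N" for j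
    proof -
      have Msplit: "M x y = wt x * wt y * rest j x y * k0 (bl j x) (bl j y)" for x y
        unfolding M_def rest_def using j by (subst prod.remove[of _ j]) auto
      show ?thesis
      proof (cases "z ! j = w ! j")
        \<comment> \<open>Agreeing letters are left out on the left-hand side. The right-hand side
          vanishes too: either the blocks coincide and no place differs, or \<open>k0\<close> is
          zero.\<close>
        case True
        have "M x y * ?row j x y = 0"
          if xy: "x \<in> A z" "y \<in> A w" for x y
        proof (cases "bl j x = bl j y")
          case False
          have "k0 (bl j x) (bl j y) = 0"
            using k0_same[OF bl[OF A(2)[OF xy(1)] j] bl[OF A(2)[OF xy(2)] j]] Aw[OF xy(1) j] Aw[OF xy(2) j] True False by simp
          then show ?thesis unfolding Msplit by simp
        qed simp
        then have "(\<Sum>x\<in>A z. \<Sum>y\<in>A w. M x y * ?row j x y) = 0"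
          by (intro sum.neutral ballI)
        then show ?thesis using True by (simp only: if_False simp_thms)
      next
        case False
        have "(\<Sum>p\<in>?P. U z j p * V w j p) = (\<Sum>k<m. \<Sum>x\<in>A z. \<Sum>y\<in>A w.
            M x y * (if bl j x ! k \<noteq> bl j y ! k then ?ip j k x y else 0))"
          unfolding inner[OF j]
        proof (intro sum.cong refl)
          fix k x y assume xy: "x \<in> A z" "y \<in> A w"
          have "bl j x \<noteq> bl j y" using Aw[OF xy(1) j] Aw[OF xy(2) j] False by auto
          then show "?G k (bl j x) (bl j y) / \<mu> * (wt x * wt y * rest j x y * ?ip j k x y)
            = M x y * (if bl j x ! k \<noteq> bl j y ! k then ?ip j k x y else 0)"
            unfolding Msplit by (simp add: hadamard_D_def k0_def)
        qed
        also have "\<dots> = (\<Sum>x\<in>A z. \<Sum>y\<in>A w. \<Sum>k<m. M x y * (if bl j x ! k \<noteq> bl j y ! k then ?ip j k x y else 0))"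
          by (rule sum_rotate)
        finally show ?thesis using False by (simp only: sum_filter_less sum_distrib_left if_True simp_thms)
      qed
    qed
    have "(\<Sum>j | j < N \<and> z ! j \<noteq> w ! j. \<Sum>p\<in>?P. U z j p * V w j p)
      = (\<Sum>j<N. if z ! j \<noteq> w ! j then (\<Sum>p\<in>?P. U z j p * V w j p) else 0)"
      by (rule sum_filter_less)
    also have "\<dots> = (\<Sum>j<N. \<Sum>x\<in>A z. \<Sum>y\<in>A w. M x y *
        ?row j x y)"
      by (intro sum.cong refl) (simp only: step lessThan_iff)
    also have "\<dots> = (\<Sum>x\<in>A z. \<Sum>y\<in>A w. \<Sum>j<N. M x y * ?row j x y)" by (rule sum_rotate)
    also have "\<dots> = (\<Sum>x\<in>A z. \<Sum>y\<in>A w. M x y * (1 - (\<Sum>a=1..K. S a x y)))"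
    proof (intro sum.cong refl)
      fix x y assume "x \<in> A z" "y \<in> A w"
      then have xy: "x \<in> ?C" "y \<in> ?C" using A by auto
      show "(\<Sum>j<N. M x y * ?row j x y)
        = M x y * (1 - (\<Sum>a=1..K. S a x y))"
        unfolding uv(1)[OF xy, symmetric] sum_differing_positions[OF xy] bl_def sum_distrib_left[symmetric] ..
    qed
    finally show "(\<Sum>j | j < N \<and> z ! j \<noteq> w ! j. \<Sum>p\<in>?P. U z j p * V w j p) = 1 - (\<Sum>a=1..K. S' a z w)"
      unfolding S'_sum[OF zw] .
  next
    fix z assume z: "z \<in> cube N"
    have "(\<Sum>j<N. \<Sum>p\<in>?P. (U z j p)\<^sup>2) = (\<Sum>j<N. \<Sum>k<m. \<Sum>t\<in>cube m. \<Sum>p\<in>?Q. (?bu u z j k t p)\<^sup>2) / \<mu>"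
    proof -
      have "(\<Sum>p\<in>?P. (U z j p)\<^sup>2) = (\<Sum>k<m. \<Sum>t\<in>cube m. \<Sum>p\<in>?Q. (?bu u z j k t p / sqrt \<mu>)\<^sup>2)" for j
        unfolding U_def by (rule split3)
      then show ?thesis using mu_pos by (simp add: power_divide sum_divide_distrib)
    qed
    also have "\<dots> = (\<Sum>j<N. \<Sum>k<m. \<Sum>x\<in>A z. (wt x)\<^sup>2 * (\<Sum>l<D. (u x (j * m + k) l)\<^sup>2)) / \<mu>"
      by (simp add: norm)
    also have "\<dots> \<le> W / \<mu>" using total[OF z uv(2)] mu_pos by (intro divide_right_mono) auto
    finally show "(\<Sum>j<N. \<Sum>p\<in>?P. (U z j p)\<^sup>2) \<le> W / \<mu>" .
    have "(\<Sum>j<N. \<Sum>p\<in>?P. (V z j p)\<^sup>2) = (\<Sum>j<N. \<Sum>k<m. \<Sum>t\<in>cube m. \<Sum>p\<in>?Q.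
        (?app z j k t p)\<^sup>2) / \<mu>"
    proof -
      have "(\<Sum>p\<in>?P. (V z j p)\<^sup>2) = (\<Sum>k<m. \<Sum>t\<in>cube m. \<Sum>p\<in>?Q.
        (?app z j k t p / sqrt \<mu>)\<^sup>2)" for j
        unfolding V_def by (rule split3)
      then show ?thesis using mu_pos by (simp add: power_divide sum_divide_distrib)
    qed
    also have "\<dots> \<le> (\<Sum>j<N. \<Sum>k<m. \<Sum>t\<in>cube m. \<Sum>p\<in>?Q. (?bu v z j k t p)\<^sup>2) / \<mu>"
    proof (rule divide_right_mono[OF sum_mono[OF sum_mono]])
      fix j k assume "k \<in> {..<m}"
      then have sn: "spectral_norm (cube m) (?G k) \<le> 1" using feas by (simp add: adv_feasible_def)
      have sw: "(\<Sum>t\<in>cube m. \<Sum>p\<in>?Q. F t p) = (\<Sum>p\<in>?Q. \<Sum>t\<in>cube m. F t p)"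
        for F :: "bool list \<Rightarrow> nat \<times> nat \<Rightarrow> real" by (rule sum.swap)
      show "(\<Sum>t\<in>cube m. \<Sum>p\<in>?Q. (?app z j k t p)\<^sup>2)
        \<le> (\<Sum>t\<in>cube m. \<Sum>p\<in>?Q. (?bu v z j k t p)\<^sup>2)"
        unfolding sw by (rule sum_mono, rule mat_app_sq_le[OF finite_cube sn])
    qed (use mu_pos in simp)
    also have "\<dots> = (\<Sum>j<N. \<Sum>k<m. \<Sum>x\<in>A z. (wt x)\<^sup>2 * (\<Sum>l<D. (v x (j * m + k) l)\<^sup>2)) / \<mu>"
      by (simp add: norm)
    also have "\<dots> \<le> W / \<mu>" using total[OF z uv(3)] mu_pos by (intro divide_right_mono) auto
    finally show "(\<Sum>j<N. \<Sum>p\<in>?P. (V z j p)\<^sup>2) \<le> W / \<mu>" .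
  qed auto
  then have "rel_value N K f (W / \<mu>)"
    using S'_gram S'_zero unfolding rel_value_def by blast
  then show ?thesis
    by (rule rel_value_mono) (use mu pos W in \<open>simp add: frac_le\<close>)
qed

subsection \<open>From algorithms to kernels\<close>

definition cip :: "'s set \<Rightarrow> ('s \<Rightarrow> complex) \<Rightarrow> ('s \<Rightarrow> complex) \<Rightarrow> complex" where
  "cip S \<phi> \<psi> = (\<Sum>z\<in>S. cnj (\<phi> z) * \<psi> z)"

lemma Re_cip_self: "Re (cip S \<phi> \<phi>) = (\<Sum>z\<in>S. (cmod (\<phi> z))\<^sup>2)"
proof -
  have "Re (cnj z * z) = (cmod z)\<^sup>2" for z
    unfolding cmod_power2 by (simp add: power2_eq_square)
  then show ?thesis by (simp add: cip_def del: complex_cnj_mult times_complex.sel)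
qed

lemma outcome_prob_eq: "outcome_prob S P \<psi> a = Re (cip S (mat_app S (P a) \<psi>) (mat_app S (P a) \<psi>))"
  by (simp add: outcome_prob_def L2_set_def Re_cip_self sum_nonneg)

lemma cip_mat_app:
  "cip S (mat_app S A \<phi>) (mat_app S A \<psi>) =
    (\<Sum>x\<in>S. \<Sum>y\<in>S. cnj (\<phi> x) * \<psi> y * (\<Sum>z\<in>S. cnj (A z x) * A z y))"
proof -
  have "cip S (mat_app S A \<phi>) (mat_app S A \<psi>)
    = (\<Sum>z\<in>S. \<Sum>x\<in>S. \<Sum>y\<in>S. cnj (\<phi> x) * \<psi> y * (cnj (A z x) * A z y))"
    unfolding cip_def mat_app_def cnj_sum sum_product complex_cnj_mult
    by (intro sum.cong refl) (simp add: mult_ac)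
  also have "\<dots> = (\<Sum>x\<in>S. \<Sum>y\<in>S. \<Sum>z\<in>S. cnj (\<phi> x) * \<psi> y * (cnj (A z x) * A z y))" by (rule sum_rotate)
  finally show ?thesis by (simp add: sum_distrib_left)
qed

lemma cip_delta:
  assumes "finite S"
  shows "(\<Sum>x\<in>S. \<Sum>y\<in>S. cnj (\<phi> x) * \<psi> y * (if x = y then 1 else 0)) = cip S \<phi> \<psi>"
  unfolding cip_def using assms by (intro sum.cong refl) (rule sum_times_delta)

lemma cip_unitary:
  assumes "finite S" "unitary_on S U"
  shows "cip S (mat_app S U \<phi>) (mat_app S U \<psi>) = cip S \<phi> \<psi>"
proof -
  have "cip S (mat_app S U \<phi>) (mat_app S U \<psi>) = (\<Sum>x\<in>S. \<Sum>y\<in>S. cnj (\<phi> x) * \<psi> y * (if x = y then 1 else 0))"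
    unfolding cip_mat_app using assms(2) by (intro sum.cong refl) (simp add: unitary_on_def)
  then show ?thesis using cip_delta[OF assms(1)] by simp
qed

text \<open>A Hermitian idempotent can be moved to one side of the inner product, where the
  projections sum to the identity.\<close>

lemma sum_cip_measurement:
  assumes "finite S" "projective_measurement_on S \<Omega> P"
  shows "(\<Sum>a\<in>\<Omega>. cip S (mat_app S (P a) \<phi>) (mat_app S (P a) \<psi>)) = cip S \<phi> \<psi>"
proof -
  have one: "cip S (mat_app S (P a) \<phi>) (mat_app S (P a) \<psi>) = (\<Sum>x\<in>S. \<Sum>y\<in>S. cnj (\<phi> x) * \<psi> y * P a x y)"
    if a: "a \<in> \<Omega>" for a
    unfolding cip_mat_app
  proof (intro sum.cong refl)
    fix x y assume xy: "x \<in> S" "y \<in> S"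
    have herm: "cnj (P a z x) = P a x z" if "z \<in> S" for z
    proof -
      have "P a z x = cnj (P a x z)"
        using assms(2) a xy(1) that unfolding projective_measurement_on_def by blast
      then show ?thesis by simp
    qed
    have "(\<Sum>z\<in>S. cnj (P a z x) * P a z y) = (\<Sum>z\<in>S. P a x z * P a z y)"
      by (intro sum.cong refl) (simp add: herm)
    also have "\<dots> = P a x y" using assms(2) a xy unfolding projective_measurement_on_def by blast
    finally show "cnj (\<phi> x) * \<psi> y * (\<Sum>z\<in>S. cnj (P a z x) * P a z y) = cnj (\<phi> x) * \<psi> y * P a x y" by simp
  qed
  have "(\<Sum>a\<in>\<Omega>. cip S (mat_app S (P a) \<phi>) (mat_app S (P a) \<psi>))
    = (\<Sum>a\<in>\<Omega>. \<Sum>x\<in>S. \<Sum>y\<in>S. cnj (\<phi> x) * \<psi> y * P a x y)" by (simp add: one)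
  also have "\<dots> = (\<Sum>x\<in>S. \<Sum>y\<in>S. \<Sum>a\<in>\<Omega>. cnj (\<phi> x) * \<psi> y * P a x y)" by (rule sum_rotate)
  also have "\<dots> = (\<Sum>x\<in>S. \<Sum>y\<in>S. cnj (\<phi> x) * \<psi> y * (if x = y then 1 else 0))"
  proof (intro sum.cong refl)
    fix x y assume "x \<in> S" "y \<in> S"
    then have "(\<Sum>a\<in>\<Omega>. P a x y) = (if x = y then 1 else 0)"
      using assms(2) unfolding projective_measurement_on_def by blast
    then show "(\<Sum>a\<in>\<Omega>. cnj (\<phi> x) * \<psi> y * P a x y) = cnj (\<phi> x) * \<psi> y * (if x = y then 1 else 0)"
      by (simp only: sum_distrib_left[symmetric])
  qed
  finally show ?thesis using cip_delta[OF assms(1)] by simp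
qed

lemma finite_qbasis [simp]: "finite (qbasis n d)"
  by (simp add: qbasis_def)

lemma sum_qbasis:
  "(\<Sum>z\<in>qbasis n d. F z) = (\<Sum>i<n. \<Sum>b\<in>UNIV. \<Sum>w<d. F (i, b, w))"
  by (simp add: qbasis_def sum.cartesian_product split_def)

lemma sum_bool_xor:
  fixes F :: "bool \<Rightarrow> 'a::comm_monoid_add"
  shows "(\<Sum>b\<in>UNIV. F (b \<noteq> (c::bool))) = (\<Sum>b\<in>UNIV. F b)"
  by (rule bool.exhaust[of c]) (simp_all add: UNIV_bool add.commute)

lemma cip_oracle: "cip (qbasis n d) (oracle_app x \<phi>) (oracle_app x \<psi>) = cip (qbasis n d) \<phi> \<psi>"
  unfolding cip_def sum_qbasis oracle_app_def case_prod_conv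
proof (rule sum.cong[OF refl])
  fix i
  show "(\<Sum>b\<in>UNIV. \<Sum>w<d. cnj (\<phi> (i, b \<noteq> x ! i, w)) * \<psi> (i, b \<noteq> x ! i, w)) =
      (\<Sum>b\<in>UNIV. \<Sum>w<d. cnj (\<phi> (i, b, w)) * \<psi> (i, b, w))"
    by (rule sum_bool_xor[where F="\<lambda>b. \<Sum>w<d. cnj (\<phi> (i, b, w)) * \<psi> (i, b, w)"])
qed

lemma gram_cip:
  assumes "finite S"
  shows "gram X (\<lambda>x y. Re (cip S (\<phi> x) (\<phi> y)))"
proof (rule gramI[of "S \<times> (UNIV :: bool set)" _ _ "\<lambda>x p. if snd p then Re (\<phi> x (fst p)) else Im (\<phi> x (fst p))"])
  show "Re (cip S (\<phi> x) (\<phi> y)) = (\<Sum>k\<in>S \<times> UNIV. (if snd k then Re (\<phi> x (fst k)) else Im (\<phi> x (fst k))) *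
      (if snd k then Re (\<phi> y (fst k)) else Im (\<phi> y (fst k))))" for x y
    by (simp add: cip_def sum.cartesian_product[symmetric, of "\<lambda>z b. (if b then Re (\<phi> x z) else Im (\<phi> x z)) *
      (if b then Re (\<phi> y z) else Im (\<phi> y z))", unfolded split_def] UNIV_bool add.commute)
qed (use assms in simp)

text \<open>The oracle acts within each query position, and identically for inputs that agree there,
  so these positions cancel between the two inner products. The vectors for the remaining ones list
  the state before and after the query, with a sign on one side; hence the cost 1 + 1.\<close>

lemma query_cost_oracle:
  assumes "\<And>x. x \<in> cube n \<Longrightarrow> Re (cip (qbasis n d) (\<phi> x) (\<phi> x)) = 1"
  shows "query_cost n (\<lambda>x y. Re (cip (qbasis n d) (\<phi> x) (\<phi> y))
      - Re (cip (qbasis n d) (oracle_app x (\<phi> x)) (oracle_app y (\<phi> y)))) (\<lambda>_. 2)"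
proof -
  define pt where "pt i \<phi> \<psi> = (\<Sum>b\<in>UNIV. \<Sum>w<d. Re (cnj (\<phi> (i, b, w)) * \<psi> (i, b, w)))"
    for i :: nat and \<phi> \<psi> :: qstate
  have total: "Re (cip (qbasis n d) \<phi> \<psi>) = (\<Sum>i<n. pt i \<phi> \<psi>)" for \<phi> \<psi>
    by (simp add: cip_def sum_qbasis pt_def)
  have same: "pt i (oracle_app x \<phi>) (oracle_app y \<psi>) = pt i \<phi> \<psi>" if "x ! i = y ! i" for i x y \<phi> \<psi>
    unfolding pt_def oracle_app_def case_prod_conv that
    by (rule sum_bool_xor[where F="\<lambda>b. \<Sum>w<d. Re (cnj (\<phi> (i, b, w)) * \<psi> (i, b, w))"])
  define st where "st x p = (if p then \<phi> x else oracle_app x (\<phi> x))" for x p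
  define co where "co c z = (if c then Re z else Im z)" for c z
  have co2: "(\<Sum>c\<in>UNIV. co c z * co c z') = Re (cnj z * z')" for z z'
    by (simp add: co_def UNIV_bool)
  let ?R = "(UNIV :: bool set) \<times> (UNIV :: bool set) \<times> {..<d} \<times> (UNIV :: bool set)"
  define u where "u x i q = (case q of (p, b, w, c) \<Rightarrow> co c (st x p (i, b, w)))" for x i q
  define v where "v x i q = (case q of (p, b, w, c) \<Rightarrow> (if p then 1 else -1) * co c (st x p (i, b, w)))" for x i q
  have expand: "(\<Sum>q\<in>?R. F (fst q) * (co (snd (snd (snd q))) (\<alpha> (fst q) (fst (snd q), fst (snd (snd q))))
        * co (snd (snd (snd q))) (\<beta> (fst q) (fst (snd q), fst (snd (snd q))))))
      = (\<Sum>p\<in>UNIV. F p * (\<Sum>b\<in>UNIV. \<Sum>w<d. Re (cnj (\<alpha> p (b, w)) * \<beta> p (b, w))))"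
    for F :: "bool \<Rightarrow> real" and \<alpha> \<beta> :: "bool \<Rightarrow> bool \<times> nat \<Rightarrow> complex"
  proof -
    have "(\<Sum>q\<in>?R. F (fst q) * (co (snd (snd (snd q))) (\<alpha> (fst q) (fst (snd q), fst (snd (snd q))))
        * co (snd (snd (snd q))) (\<beta> (fst q) (fst (snd q), fst (snd (snd q))))))
      = (\<Sum>p\<in>UNIV. \<Sum>b\<in>UNIV. \<Sum>w<d. \<Sum>c\<in>UNIV. F p * (co c (\<alpha> p (b, w)) * co c (\<beta> p (b, w))))"
      by (simp add: sum.cartesian_product split_def)
    also have "\<dots> = (\<Sum>p\<in>UNIV. F p * (\<Sum>b\<in>UNIV. \<Sum>w<d. \<Sum>c\<in>UNIV. co c (\<alpha> p (b, w)) * co c (\<beta> p (b, w))))"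
      by (simp only: sum_distrib_left)
    also have "\<dots> = (\<Sum>p\<in>UNIV. F p * (\<Sum>b\<in>UNIV. \<Sum>w<d. Re (cnj (\<alpha> p (b, w)) * \<beta> p (b, w))))"
      by (simp only: co2)
    finally show ?thesis .
  qed
  have inner: "(\<Sum>q\<in>?R. u x i q * v y i q)
      = pt i (\<phi> x) (\<phi> y) - pt i (oracle_app x (\<phi> x)) (oracle_app y (\<phi> y))" for x y i
  proof -
    have "(\<Sum>q\<in>?R. u x i q * v y i q) = (\<Sum>p\<in>UNIV. (if p then 1 else -1) * pt i (st x p) (st y p))"
      unfolding pt_def using expand[of "\<lambda>p. if p then 1 else -1" "\<lambda>p bw. st x p (i, bw)" "\<lambda>p bw. st y p (i, bw)"]
      by (simp add: u_def v_def split_def mult_ac)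
    then show ?thesis by (simp add: st_def UNIV_bool)
  qed
  have norm: "(\<Sum>q\<in>?R. (u x i q)\<^sup>2) = pt i (\<phi> x) (\<phi> x) + pt i (oracle_app x (\<phi> x)) (oracle_app x (\<phi> x))" for x i
  proof -
    have "(\<Sum>q\<in>?R. (u x i q)\<^sup>2) = (\<Sum>p\<in>UNIV. 1 * pt i (st x p) (st x p))"
      unfolding pt_def using expand[of "\<lambda>p. 1" "\<lambda>p bw. st x p (i, bw)" "\<lambda>p bw. st x p (i, bw)"]
      by (simp add: u_def split_def power2_eq_square)
    then show ?thesis by (simp add: st_def UNIV_bool)
  qed
  have vu: "(v x i q)\<^sup>2 = (u x i q)\<^sup>2" for x i q by (simp add: u_def v_def split_def)
  show ?thesis
  proof (rule query_costI[of ?R n u v])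
    fix x y assume "x \<in> cube n" "y \<in> cube n"
    have "(\<Sum>i | i < n \<and> x ! i \<noteq> y ! i. \<Sum>q\<in>?R. u x i q * v y i q)
      = (\<Sum>i<n. pt i (\<phi> x) (\<phi> y) - pt i (oracle_app x (\<phi> x)) (oracle_app y (\<phi> y)))"
      unfolding inner by (rule sum.mono_neutral_left) (auto simp: same)
    then show "(\<Sum>i | i < n \<and> x ! i \<noteq> y ! i. \<Sum>q\<in>?R. u x i q * v y i q)
      = Re (cip (qbasis n d) (\<phi> x) (\<phi> y)) - Re (cip (qbasis n d) (oracle_app x (\<phi> x)) (oracle_app y (\<phi> y)))"
      by (simp add: total sum_subtractf)
  next
    fix x assume x: "x \<in> cube n"
    show u2: "(\<Sum>i<n. \<Sum>q\<in>?R. (u x i q)\<^sup>2) \<le> 2"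
      unfolding norm sum.distrib total[symmetric] cip_oracle using assms[OF x] by simp
    then show "(\<Sum>i<n. \<Sum>q\<in>?R. (v x i q)\<^sup>2) \<le> 2" unfolding vu .
  qed auto
qed

lemma cip_qrun:
  assumes "Re (cip (qbasis n d) \<psi> \<psi>) = 1" "\<forall>t\<le>T. unitary_on (qbasis n d) (U t)" "t \<le> T"
  shows "Re (cip (qbasis n d) (qrun (qbasis n d) U \<psi> x t) (qrun (qbasis n d) U \<psi> x t)) = 1"
  using assms(3)
proof (induction t)
  case 0
  then show ?case using assms by (simp add: cip_unitary)
next
  case (Suc t)
  then show ?case using assms(2) by (simp add: cip_unitary cip_oracle)
qed

text \<open>Unitaries preserve Gram matrices, so the change telescopes over the queries, at cost 2
  each.\<close>

lemma query_cost_qrun: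
  assumes "Re (cip (qbasis n d) \<psi> \<psi>) = 1" "\<forall>t\<le>T. unitary_on (qbasis n d) (U t)" "t \<le> T"
  shows "query_cost n (\<lambda>x y. 1 - Re (cip (qbasis n d) (qrun (qbasis n d) U \<psi> x t) (qrun (qbasis n d) U \<psi> y t)))
    (\<lambda>_. 2 * real t)"
  using assms(3)
proof (induction t)
  case 0
  then show ?case using assms by (simp add: cip_unitary query_cost_zero)
next
  case (Suc t)
  then have t: "t \<le> T" by simp
  from query_cost_add[OF Suc.IH[OF t] query_cost_oracle[where \<phi>="\<lambda>x. qrun (qbasis n d) U \<psi> x t", OF cip_qrun[OF assms(1,2) t]]]
  show ?case
    by (rule query_cost_mono) (use Suc.prems assms(2) in \<open>simp_all add: cip_unitary\<close>)
qed

text \<open>\<open>B a\<close> is the Gram kernel of the unnormalized states after outcome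
  \<open>a\<close>, so its diagonal holds the outcome probabilities.\<close>

lemma computable_imp_query_cost:
  assumes "computable_with_queries n h T"
  obtains \<Omega> :: "nat set" and B where "finite \<Omega>" "\<And>a. gram (cube n) (B a)"
    "\<And>x. x \<in> cube n \<Longrightarrow> (\<Sum>a\<in>\<Omega>. B a x x) = 1"
    "\<And>x. x \<in> cube n \<Longrightarrow> 2 / 3 \<le> (\<Sum>a | a \<in> \<Omega> \<and> (x, a) \<in> h. B a x x)"
    "query_cost n (\<lambda>x y. 1 - (\<Sum>a\<in>\<Omega>. B a x y)) (\<lambda>_. 2 * real T)"
proof -
  obtain d \<psi> U \<Omega> P where psi: "L2_set (\<lambda>z. cmod (\<psi> z)) (qbasis n d) = 1"
    and U: "\<forall>t\<le>T. unitary_on (qbasis n d) (U t)"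
    and P: "projective_measurement_on (qbasis n d) \<Omega> P"
    and succ: "\<And>x. x \<in> cube n \<Longrightarrow> (\<Sum>a | a \<in> \<Omega> \<and> (x, a) \<in> h.
              outcome_prob (qbasis n d) P (qrun (qbasis n d) U \<psi> x T) a) \<ge> 2 / 3"
    using assms unfolding computable_with_queries_def by blast
  let ?S = "qbasis n d"
  let ?f = "\<lambda>x. qrun ?S U \<psi> x T"
  define B where "B a x y = Re (cip ?S (mat_app ?S (P a) (?f x)) (mat_app ?S (P a) (?f y)))" for a x y
  have psi1: "Re (cip ?S \<psi> \<psi>) = 1" using psi by (simp add: Re_cip_self L2_set_def)
  have sumB: "(\<Sum>a\<in>\<Omega>. B a x y) = Re (cip ?S (?f x) (?f y))" for x y
    unfolding B_def Re_sum[symmetric] using sum_cip_measurement[OF _ P] by simp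
  show thesis
  proof (rule that)
    show "finite \<Omega>" using P unfolding projective_measurement_on_def by blast
    show "gram (cube n) (B a)" for a unfolding B_def[abs_def] by (rule gram_cip) simp
    show "(\<Sum>a\<in>\<Omega>. B a x x) = 1" for x
      unfolding sumB by (rule cip_qrun[OF psi1 U order_refl])
    show "2 / 3 \<le> (\<Sum>a | a \<in> \<Omega> \<and> (x, a) \<in> h. B a x x)" if "x \<in> cube n" for x
      using succ[OF that] by (simp add: outcome_prob_eq B_def)
    show "query_cost n (\<lambda>x y. 1 - (\<Sum>a\<in>\<Omega>. B a x y)) (\<lambda>_. 2 * real T)"
      unfolding sumB by (rule query_cost_qrun[OF psi1 U order_refl])
  qed
qed

text \<open>
  The solution for \<open>h\<close> read off from an algorithm keeps its verified correct answers and replaces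
  the incorrect ones, of weight at most one third, by an independent solution of cost \<open>W\<close>.
\<close>

lemma rel_value_of_algorithm:
  assumes alg: "computable_with_queries n h T"
    and ver: "\<And>a. query_cost n (\<lambda>x y. if ((x, a) \<in> h) \<noteq> ((y, a) \<in> h) then 1 else 0) (\<lambda>_. V)"
    and val: "rel_value n K h W" and W: "0 \<le> W"
    and range: "\<And>x a. (x, a) \<in> h \<Longrightarrow> a \<in> {1..K}"
  shows "rel_value n K h (2 * real T + V + W / 3)"
proof -
  obtain \<Omega> :: "nat set" and B where fin: "finite \<Omega>" and B: "\<And>a. gram (cube n) (B a)"
    and one: "\<And>x. x \<in> cube n \<Longrightarrow> (\<Sum>a\<in>\<Omega>. B a x x) = 1"
    and succ: "\<And>x. x \<in> cube n \<Longrightarrow> 2 / 3 \<le> (\<Sum>a | a \<in> \<Omega> \<and> (x, a) \<in> h. B a x x)"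
    and q: "query_cost n (\<lambda>x y. 1 - (\<Sum>a\<in>\<Omega>. B a x y)) (\<lambda>_. 2 * real T)"
    by (rule computable_imp_query_cost[OF alg]) (rule that)
  obtain S where S: "\<And>a. a \<in> {1..K} \<Longrightarrow> gram (cube n) (S a)"
    "\<And>x a. x \<in> cube n \<Longrightarrow> a \<in> {1..K} \<Longrightarrow> (x, a) \<notin> h \<Longrightarrow> S a x x = 0"
    and qS: "query_cost n (\<lambda>x y. 1 - (\<Sum>a=1..K. S a x y)) (\<lambda>_. W)"
    using val unfolding rel_value_def by blast
  \<comment> \<open>The masks \<open>I True\<close> and \<open>I False\<close> select the inputs for
    which \<open>a\<close> is correct and incorrect. As rank-one factors they preserve positive
    semidefiniteness.\<close>
  define I where "I c a x = (if ((x, a) \<in> h) = c then 1 else (0::real))" for c a x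
  define part where "part c a x y = I c a x * I c a y * B a x y" for c a x y
  define bad where "bad x y = (\<Sum>a\<in>\<Omega>. part False a x y)" for x y
  define S' where "S' a x y = (if a \<in> \<Omega> then part True a x y else 0) + bad x y * S a x y" for a x y
  have gpart: "gram (cube n) (part c a)" for c a
    unfolding part_def[abs_def] by (intro gram_mult gram_rank_one B)
  have gbad: "gram (cube n) bad"
    unfolding bad_def[abs_def] by (intro gram_sum fin gpart)
  have gif: "gram (cube n) (\<lambda>x y. if a \<in> \<Omega> then part True a x y else 0)" for a
  proof (cases "a \<in> \<Omega>")
    case False
    then show ?thesis using gram_rank_one[of "cube n" "\<lambda>_. 0"] by simp
  qed (simp add: gpart)
  \<comment> \<open>An outcome is correct for one, both or none of the two inputs; the mixed terms
    are those that verification has to account for.\<close>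
  have "(\<Sum>a\<in>\<Omega>. if ((x, a) \<in> h) \<noteq> ((y, a) \<in> h) then B a x y else 0) + (\<Sum>a\<in>\<Omega>. part True a x y) + bad x y
      = (\<Sum>a\<in>\<Omega>. B a x y)" for x y
    unfolding bad_def sum.distrib[symmetric] by (intro sum.cong refl) (auto simp: part_def I_def)
  note split = this
  have restrict: "(\<Sum>a=1..K. if a \<in> \<Omega> then part True a x y else 0) = (\<Sum>a\<in>\<Omega>. part True a x y)" for x y
  proof -
    have "(\<Sum>a=1..K. if a \<in> \<Omega> then part True a x y else 0) = (\<Sum>a\<in>{1..K} \<inter> \<Omega>. part True a x y)"
      by (rule sum.inter_restrict[symmetric]) simp
    also have "\<dots> = (\<Sum>a\<in>\<Omega>. part True a x y)"
      using fin range by (intro sum.mono_neutral_left) (auto simp: part_def I_def)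
    finally show ?thesis .
  qed
  have bad_le: "bad x x \<le> 1 / 3" if x: "x \<in> cube n" for x
  proof -
    have "(\<Sum>a | a \<in> \<Omega> \<and> (x, a) \<in> h. B a x x) = (\<Sum>a\<in>\<Omega>. if (x, a) \<in> h then B a x x else 0)"
      using fin by (subst sum.inter_filter[symmetric]) (auto intro!: sum.cong)
    also have "\<dots> = (\<Sum>a\<in>\<Omega>. part True a x x)" by (intro sum.cong refl) (simp add: part_def I_def)
    finally show ?thesis using split[of x x] one[OF x] succ[OF x] by simp
  qed
  \<comment> \<open>Verifying all outcomes costs \<open>V\<close> in total, not \<open>V\<close> per
    outcome, because each kernel is weighted by the probability of its outcome.\<close>
  have "query_cost n (\<lambda>x y. \<Sum>a\<in>\<Omega>. 1 * 1 * (B a x y * (if ((x, a) \<in> h) \<noteq> ((y, a) \<in> h) then 1 else 0))) (\<lambda>_. V)"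
  proof (rule query_cost_sum[OF fin query_cost_mult_gram[OF ver B]])
    fix x assume "x \<in> cube n"
    then have "(\<Sum>a\<in>\<Omega>. 1\<^sup>2 * (B a x x * V)) = V" using one by (simp add: sum_distrib_right[symmetric])
    then show "(\<Sum>a\<in>\<Omega>. 1\<^sup>2 * (B a x x * V)) \<le> V" "(\<Sum>a\<in>\<Omega>. 1\<^sup>2 * (B a x x * V)) \<le> V" by simp_all
  qed
  \<comment> \<open>Substituting a solution for the bad part changes the kernel by
    \<open>bad\<close> times the kernel of that solution, which costs only
    \<open>bad x x * W\<close>.\<close>
  from query_cost_add[OF query_cost_add[OF q this] query_cost_mult_gram[OF qS gbad]]
  have "query_cost n (\<lambda>x y. 1 - (\<Sum>a=1..K. S' a x y)) (\<lambda>_. 2 * real T + V + W / 3)"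
  proof (rule query_cost_mono)
    fix x y
    have "(\<Sum>a\<in>\<Omega>. 1 * 1 * (B a x y * (if ((x, a) \<in> h) \<noteq> ((y, a) \<in> h) then 1 else 0)))
      = (\<Sum>a\<in>\<Omega>. if ((x, a) \<in> h) \<noteq> ((y, a) \<in> h) then B a x y else 0)" by (intro sum.cong refl) simp
    then show "1 - (\<Sum>a\<in>\<Omega>. B a x y) + (\<Sum>a\<in>\<Omega>. 1 * 1 * (B a x y * (if ((x, a) \<in> h) \<noteq> ((y, a) \<in> h) then 1 else 0)))
        + bad x y * (1 - (\<Sum>a=1..K. S a x y)) = 1 - (\<Sum>a=1..K. S' a x y)"
      using split[of x y] restrict[of x y]
      by (simp add: S'_def sum.distrib right_diff_distrib sum_distrib_left)
  next
    fix x assume "x \<in> cube n"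
    then show "2 * real T + V + bad x x * W \<le> 2 * real T + V + W / 3"
      using mult_right_mono[OF bad_le W] by simp
  qed
  moreover have "gram (cube n) (S' a)" if "a \<in> {1..K}" for a
    unfolding S'_def[abs_def] by (intro gram_add gif gram_mult gbad S(1)[OF that])
  moreover have "S' a x x = 0" if "x \<in> cube n" "a \<in> {1..K}" "(x, a) \<notin> h" for x a
    using S(2)[OF that] that(3) by (simp add: S'_def part_def I_def)
  ultimately show ?thesis unfolding rel_value_def by blast
qed

subsection \<open>From kernels to algorithms\<close>

definition orthogonal_on :: "'s set \<Rightarrow> ('s \<Rightarrow> 's \<Rightarrow> real) \<Rightarrow> bool" where
  "orthogonal_on S U \<longleftrightarrow> (\<forall>x\<in>S. \<forall>y\<in>S. (\<Sum>z\<in>S. U z x * U z y) = (if x = y then 1 else 0))"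

lemma orthogonal_on_identity:
  assumes "finite S"
  shows "orthogonal_on S (\<lambda>z y. if z = y then 1 else 0)"
  unfolding orthogonal_on_def
proof (intro ballI)
  fix x y assume "x \<in> S"
  from sum_times_delta(3)[OF assms this, of "\<lambda>z. if z = y then 1 else 0"]
  show "(\<Sum>z\<in>S. (if z = x then 1 else 0) * (if z = y then 1 else 0)) = (if x = y then 1 else (0::real))" .
qed

lemma orthogonal_on_inner:
  assumes "finite S" "orthogonal_on S U"
  shows "(\<Sum>z\<in>S. mat_app S U \<phi> z * mat_app S U \<psi> z) = (\<Sum>z\<in>S. \<phi> z * \<psi> z)"
proof -
  have "(\<Sum>z\<in>S. mat_app S U \<phi> z * mat_app S U \<psi> z)
    = (\<Sum>z\<in>S. \<Sum>x\<in>S. \<Sum>y\<in>S. \<phi> x * \<psi> y * (U z x * U z y))"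
    unfolding mat_app_def sum_product by (intro sum.cong refl) (simp add: mult_ac)
  also have "\<dots> = (\<Sum>x\<in>S. \<Sum>y\<in>S. \<Sum>z\<in>S. \<phi> x * \<psi> y * (U z x * U z y))" by (rule sum_rotate)
  also have "\<dots> = (\<Sum>x\<in>S. \<Sum>y\<in>S. \<phi> x * \<psi> y * (if x = y then 1 else 0))"
    using assms(2) unfolding sum_distrib_left[symmetric]
    by (intro sum.cong refl arg_cong[where f="\<lambda>t. _ * t"]) (simp add: orthogonal_on_def)
  also have "\<dots> = (\<Sum>x\<in>S. \<phi> x * \<psi> x)"
    using assms(1) by (intro sum.cong refl) (rule sum_times_delta)
  finally show ?thesis .
qed

lemma orthogonal_on_compose:
  assumes "finite S" "orthogonal_on S V" "orthogonal_on S U"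
  shows "orthogonal_on S (\<lambda>z x. mat_app S V (\<lambda>t. U t x) z)"
  unfolding orthogonal_on_def
  using orthogonal_on_inner[OF assms(1,2)] assms(3) by (simp add: orthogonal_on_def)

lemma mat_app_compose:
  "mat_app S (\<lambda>z x. mat_app S V (\<lambda>t. U t x) z) \<phi> = mat_app S V (mat_app S U (\<phi> :: 's \<Rightarrow> real))"
proof
  fix z
  have "mat_app S (\<lambda>z x. mat_app S V (\<lambda>t. U t x) z) \<phi> z = (\<Sum>x\<in>S. \<Sum>t\<in>S. V z t * U t x * \<phi> x)"
    by (simp add: mat_app_def sum_distrib_right)
  also have "\<dots> = (\<Sum>t\<in>S. \<Sum>x\<in>S. V z t * U t x * \<phi> x)" by (rule sum.swap)
  also have "\<dots> = mat_app S V (mat_app S U \<phi>) z"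
    by (simp add: mat_app_def sum_distrib_left mult.assoc)
  finally show "mat_app S (\<lambda>z x. mat_app S V (\<lambda>t. U t x) z) \<phi> z = mat_app S V (mat_app S U \<phi>) z" .
qed

definition reflection :: "'s set \<Rightarrow> ('s \<Rightarrow> real) \<Rightarrow> 's \<Rightarrow> 's \<Rightarrow> real" where
  "reflection S w z y = (if z = y then 1 else 0) - 2 * w z * w y / (\<Sum>t\<in>S. (w t)\<^sup>2)"

lemma mat_app_reflection:
  assumes "finite S" "z \<in> S"
  shows "mat_app S (reflection S w) \<phi> z = \<phi> z - 2 * w z * (\<Sum>y\<in>S. w y * \<phi> y) / (\<Sum>t\<in>S. (w t)\<^sup>2)"
proof -
  let ?s = "\<Sum>t\<in>S. (w t)\<^sup>2"
  have "mat_app S (reflection S w) \<phi> z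
    = (\<Sum>y\<in>S. (if z = y then 1 else 0) * \<phi> y) - (\<Sum>y\<in>S. 2 * w z * (w y * \<phi> y) / ?s)"
    unfolding mat_app_def sum_subtractf[symmetric]
    by (intro sum.cong refl) (simp add: reflection_def algebra_simps)
  also have "(\<Sum>y\<in>S. 2 * w z * (w y * \<phi> y) / ?s) = 2 * w z * (\<Sum>y\<in>S. w y * \<phi> y) / ?s"
    by (simp only: sum_divide_distrib[symmetric] sum_distrib_left[symmetric])
  finally show ?thesis using sum_times_delta(2)[OF assms, of \<phi>] by simp
qed

lemma orthogonal_on_reflection:
  assumes "finite S" "(\<Sum>t\<in>S. (w t)\<^sup>2) \<noteq> 0"
  shows "orthogonal_on S (reflection S w)"
  unfolding orthogonal_on_def
proof (intro ballI)
  let ?s = "\<Sum>t\<in>S. (w t)\<^sup>2"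
  fix x y assume xy: "x \<in> S" "y \<in> S"
  have r: "(\<Sum>z\<in>S. w z * reflection S w z y) = - w y"
  proof -
    have "(\<Sum>z\<in>S. w z * reflection S w z y) = (\<Sum>z\<in>S. w z * (if y = z then 1 else 0)) - (\<Sum>z\<in>S. (w z)\<^sup>2 * (2 * w y / ?s))"
      unfolding sum_subtractf[symmetric]
      by (intro sum.cong refl) (simp add: reflection_def right_diff_distrib power2_eq_square)
    also have "\<dots> = w y - ?s * (2 * w y / ?s)"
      using sum_times_delta(1)[OF assms(1) xy(2), of w] by (simp only: sum_distrib_right)
    finally show ?thesis using assms(2) by simp
  qed
  have "(\<Sum>z\<in>S. reflection S w z x * reflection S w z y)
    = (\<Sum>z\<in>S. (if z = x then 1 else 0) * reflection S w z y) - (\<Sum>z\<in>S. (2 * w x / ?s) * (w z * reflection S w z y))"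
    unfolding sum_subtractf[symmetric]
    by (intro sum.cong refl) (simp add: reflection_def[of S w _ x] left_diff_distrib)
  also have "\<dots> = reflection S w x y - (2 * w x / ?s) * (- w y)"
    unfolding sum_times_delta(3)[OF assms(1) xy(1)] sum_distrib_left[symmetric] r ..
  also have "\<dots> = (if x = y then 1 else 0)" by (simp add: reflection_def)
  finally show "(\<Sum>z\<in>S. reflection S w z x * reflection S w z y) = (if x = y then 1 else 0)" .
qed

text \<open>
  Vectors are mapped to their targets one at a time, by a reflection exchanging the current image
  with the target; equality of the Gram matrices makes it fix the targets reached before.
\<close>

lemma orthogonal_extension:
  fixes a b :: "'x \<Rightarrow> 's \<Rightarrow> real"
  assumes S: "finite S" and "finite X"
    and "\<And>x y. x \<in> X \<Longrightarrow> y \<in> X \<Longrightarrow> (\<Sum>z\<in>S. a x z * a y z) = (\<Sum>z\<in>S. b x z * b y z)"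
  shows "\<exists>U. orthogonal_on S U \<and> (\<forall>x\<in>X. \<forall>z\<in>S. mat_app S U (a x) z = b x z)"
  using assms(2,3)
proof (induction X rule: finite_induct)
  case empty
  show ?case using orthogonal_on_identity[OF S] by blast
next
  case (insert x X)
  then obtain U where U: "orthogonal_on S U" "\<And>y z. y \<in> X \<Longrightarrow> z \<in> S \<Longrightarrow> mat_app S U (a y) z = b y z"
    by auto
  define a' where "a' = mat_app S U (a x)"
  define w where "w z = a' z - b x z" for z
  let ?s = "\<Sum>z\<in>S. (w z)\<^sup>2"
  show ?case
  proof (cases "?s = 0")
    case True
    then have "mat_app S U (a x) z = b x z" if "z \<in> S" for z
      using that S by (simp add: sum_nonneg_eq_0_iff w_def a'_def)
    then show ?thesis using U by blast
  next
    case False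
    have orth: "(\<Sum>z\<in>S. w z * b y z) = 0" if y: "y \<in> X" for y
    proof -
      have "(\<Sum>z\<in>S. a' z * b y z) = (\<Sum>z\<in>S. mat_app S U (a x) z * mat_app S U (a y) z)"
        using U(2)[OF y] by (simp add: a'_def)
      also have "\<dots> = (\<Sum>z\<in>S. b x z * b y z)"
        unfolding orthogonal_on_inner[OF S U(1)] using insert.prems y by simp
      finally show ?thesis by (simp add: w_def left_diff_distrib sum_subtractf)
    qed
    have aa: "(\<Sum>z\<in>S. a' z * a' z) = (\<Sum>z\<in>S. b x z * b x z)"
      unfolding a'_def orthogonal_on_inner[OF S U(1)] using insert.prems by simp
    have "?s = (\<Sum>z\<in>S. a' z * a' z) + (\<Sum>z\<in>S. b x z * b x z) - 2 * (\<Sum>z\<in>S. b x z * a' z)"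
      unfolding w_def sum_distrib_left sum.distrib[symmetric] sum_subtractf[symmetric]
      by (intro sum.cong refl) (simp add: power2_eq_square algebra_simps)
    \<comment> \<open>As \<open>a'\<close> and the target have equal norm, the inner product of
      their difference \<open>w\<close> with \<open>a'\<close> is half the squared norm of
      \<open>w\<close>; the reflection thus sends \<open>a'\<close> to \<open>a' - w\<close>, the
      target.\<close>
    then have s: "2 * (\<Sum>z\<in>S. w z * a' z) = ?s"
      using aa by (simp add: w_def left_diff_distrib sum_subtractf)
    let ?V = "\<lambda>z t. mat_app S (reflection S w) (\<lambda>r. U r t) z"
    have "orthogonal_on S ?V"
      by (rule orthogonal_on_compose[OF S orthogonal_on_reflection[OF S False] U(1)])
    moreover have "mat_app S ?V (a y) z = b y z" if y: "y \<in> insert x X" and z: "z \<in> S" for y z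
    proof (cases "y \<in> X")
      case True
      have "(\<Sum>t\<in>S. w t * mat_app S U (a y) t) = 0" using orth[OF True] U(2)[OF True] by simp
      then show ?thesis
        unfolding mat_app_compose mat_app_reflection[OF S z] using U(2)[OF True z] by simp
    next
      case False
      then have "y = x" using y by simp
      have "2 * w z * (\<Sum>t\<in>S. w t * a' t) / ?s = w z"
        using s \<open>?s \<noteq> 0\<close> by (metis mult.left_commute nonzero_mult_div_cancel_right mult.assoc)
      then show ?thesis
        unfolding mat_app_compose mat_app_reflection[OF S z] \<open>y = x\<close> a'_def[symmetric] by (simp add: w_def)
    qed
    ultimately show ?thesis by blast
  qed
qed

lemma mat_app_of_real:
  "mat_app S (\<lambda>z y. complex_of_real (U z y)) (\<lambda>z. complex_of_real (\<phi> z)) = (\<lambda>z. complex_of_real (mat_app S U \<phi> z))"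
  by (rule ext) (simp add: mat_app_def)

lemma unitary_on_of_real: "orthogonal_on S U \<Longrightarrow> unitary_on S (\<lambda>z y. complex_of_real (U z y))"
  unfolding unitary_on_def orthogonal_on_def complex_cnj_complex_of_real of_real_mult[symmetric] of_real_sum[symmetric]
  by (metis of_real_0 of_real_1)

lemma mat_app_identity:
  assumes "finite S" "z \<in> S"
  shows "mat_app S (\<lambda>z y. if z = y then 1 else (0::complex)) \<phi> z = \<phi> z"
  unfolding mat_app_def by (rule sum_times_delta(2)[OF assms])

lemma unitary_on_identity: "finite S \<Longrightarrow> unitary_on S (\<lambda>z y. if z = y then 1 else 0)"
  using unitary_on_of_real[OF orthogonal_on_identity] by (simp add: if_distrib[of complex_of_real] cong: if_cong)

lemma mat_app_diff: "mat_app S U \<phi> z - mat_app S U \<psi> z = mat_app S U (\<lambda>z. \<phi> z - \<psi> z) (z :: 's)"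
  for U :: "'s \<Rightarrow> 's \<Rightarrow> complex"
  by (simp add: mat_app_def right_diff_distrib sum_subtractf)

lemma mat_app_cong: "(\<And>z. z \<in> S \<Longrightarrow> \<phi> z = \<psi> z) \<Longrightarrow> mat_app S U \<phi> = mat_app S U \<psi>"
  unfolding mat_app_def by (intro ext sum.cong) auto

lemma norm_sq_unitary:
  assumes "finite S" "unitary_on S U"
  shows "(\<Sum>z\<in>S. (cmod (mat_app S U \<phi> z))\<^sup>2) = (\<Sum>z\<in>S. (cmod (\<phi> z))\<^sup>2)"
  unfolding Re_cip_self[symmetric] cip_unitary[OF assms] ..

lemma norm_sq_oracle:
  "(\<Sum>z\<in>qbasis n d. (cmod (oracle_app x \<phi> z))\<^sup>2) = (\<Sum>z\<in>qbasis n d. (cmod (\<phi> z))\<^sup>2)"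
  unfolding Re_cip_self[symmetric] cip_oracle ..

section \<open>Measurements in the computational basis and ideal runs\<close>

definition label_projector :: "(qidx \<Rightarrow> nat) \<Rightarrow> nat \<Rightarrow> qmat" where
  "label_projector l a = (\<lambda>z y. if z = y \<and> l z = a then 1 else 0)"

lemma mat_app_label_projector:
  assumes "finite S" "z \<in> S"
  shows "mat_app S (label_projector l a) \<phi> z = (if l z = a then \<phi> z else 0)"
proof -
  have "mat_app S (label_projector l a) \<phi> z = (\<Sum>y\<in>S. if z = y then if l z = a then \<phi> y else 0 else 0)"
    unfolding mat_app_def label_projector_def by (rule sum.cong) auto
  then show ?thesis using assms by (simp add: sum.delta')
qed

lemma label_measurement:
  assumes "finite S" "finite \<Omega>" "\<And>z. z \<in> S \<Longrightarrow> l z \<in> \<Omega>"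
  shows "projective_measurement_on S \<Omega> (label_projector l)"
  unfolding projective_measurement_on_def
proof (intro conjI ballI)
  show "label_projector l a y x = cnj (label_projector l a x y)" for a x y
    by (auto simp: label_projector_def)
  show "(\<Sum>z\<in>S. label_projector l a x z * label_projector l a z y) = label_projector l a x y"
    if "x \<in> S" for a x y
    using mat_app_label_projector[OF assms(1) that, of l a "\<lambda>z. label_projector l a z y"]
    unfolding mat_app_def by (cases "x = y") (simp_all add: label_projector_def)
  show "(\<Sum>a\<in>\<Omega>. label_projector l a x y) = (if x = y then 1 else 0)" if "x \<in> S" for x y
  proof -
    have "(\<Sum>a\<in>\<Omega>. label_projector l a x y) = (\<Sum>a\<in>\<Omega>. if l x = a then if x = y then 1 else 0 else 0)"
      by (rule sum.cong) (auto simp: label_projector_def)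
    then show ?thesis using assms(2) assms(3)[OF that] by (simp add: sum.delta')
  qed
qed (fact assms(2))

lemma outcome_prob_label:
  assumes "finite S"
  shows "outcome_prob S (label_projector l) \<phi> a = (\<Sum>z\<in>S. if l z = a then (cmod (\<phi> z))\<^sup>2 else 0)"
proof -
  have "outcome_prob S (label_projector l) \<phi> a = (\<Sum>z\<in>S. (cmod (mat_app S (label_projector l a) \<phi> z))\<^sup>2)"
    by (simp add: outcome_prob_def L2_set_def sum_nonneg)
  also have "\<dots> = (\<Sum>z\<in>S. if l z = a then (cmod (\<phi> z))\<^sup>2 else 0)"
    by (intro sum.cong refl) (simp add: mat_app_label_projector[OF assms])
  finally show ?thesis .
qed

lemma sum_outcome_prob_label:
  assumes "finite S" "finite \<Omega>" "\<And>z. z \<in> S \<Longrightarrow> l z \<in> \<Omega>"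
  shows "(\<Sum>a | a \<in> \<Omega> \<and> G a. outcome_prob S (label_projector l) \<phi> a) = (\<Sum>z\<in>S. if G (l z) then (cmod (\<phi> z))\<^sup>2 else 0)"
proof -
  have "(\<Sum>a | a \<in> \<Omega> \<and> G a. outcome_prob S (label_projector l) \<phi> a)
    = (\<Sum>z\<in>S. \<Sum>a | a \<in> \<Omega> \<and> G a. if l z = a then (cmod (\<phi> z))\<^sup>2 else 0)"
    unfolding outcome_prob_label[OF assms(1)] by (rule sum.swap)
  also have "\<dots> = (\<Sum>z\<in>S. if G (l z) then (cmod (\<phi> z))\<^sup>2 else 0)"
    using assms by (intro sum.cong refl) (simp add: sum.delta')
  finally show ?thesis .
qed

text \<open>
  The vectors \<open>queried x t\<close> are the ideal vectors after the oracle was applied.  As unitaries and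
  oracles preserve distances, the run stays as close to the ideal vectors as it starts.
\<close>

lemma computable_by_ideal_run:
  fixes ideal :: "bool list \<Rightarrow> nat \<Rightarrow> qidx \<Rightarrow> real"
  assumes start: "(\<Sum>z\<in>qbasis n d. (\<psi> z)\<^sup>2) = 1"
    and gram_eq: "\<And>x y t. x \<in> cube n \<Longrightarrow> y \<in> cube n \<Longrightarrow> t < T \<Longrightarrow>
      (\<Sum>z\<in>qbasis n d. queried x t z * queried y t z) = (\<Sum>z\<in>qbasis n d. ideal x (Suc t) z * ideal y (Suc t) z)"
    and query: "\<And>x t z. x \<in> cube n \<Longrightarrow> z \<in> qbasis n d \<Longrightarrow>
      oracle_app x (\<lambda>z. complex_of_real (ideal x t z)) z = complex_of_real (queried x t z)"
    and close: "\<And>x. x \<in> cube n \<Longrightarrow> (\<Sum>z\<in>qbasis n d. (\<psi> z - ideal x 0 z)\<^sup>2) \<le> 1 / 12"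
    and wrong: "\<And>x. x \<in> cube n \<Longrightarrow> (\<Sum>z\<in>qbasis n d. if (x, l z) \<in> h then 0 else (ideal x T z)\<^sup>2) \<le> 1 / 12"
    and l: "finite \<Omega>" "\<And>z. z \<in> qbasis n d \<Longrightarrow> l z \<in> \<Omega>"
  shows "computable_with_queries n h T"
proof -
  let ?S = "qbasis n d"
  have "\<exists>U. orthogonal_on ?S U \<and> (\<forall>x\<in>cube n. \<forall>z\<in>?S. mat_app ?S U (queried x t) z = ideal x (Suc t) z)"
    if "t < T" for t
    using gram_eq[OF _ _ that] by (intro orthogonal_extension) auto
  then have "\<forall>t. \<exists>U. t < T \<longrightarrow> orthogonal_on ?S U \<and> (\<forall>x\<in>cube n. \<forall>z\<in>?S. mat_app ?S U (queried x t) z = ideal x (Suc t) z)"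
    by blast
  from choice[OF this] obtain V where V: "\<And>t. t < T \<Longrightarrow> orthogonal_on ?S (V t)"
    "\<And>t x z. t < T \<Longrightarrow> x \<in> cube n \<Longrightarrow> z \<in> ?S \<Longrightarrow> mat_app ?S (V t) (queried x t) z = ideal x (Suc t) z"
    by blast
  \<comment> \<open>The start vector is already close to the ideal one, so the unitary before the
    first query is the identity; each later one maps the queried vectors to the next ideal
    ones.\<close>
  define U :: "nat \<Rightarrow> qmat" where
    "U t = (case t of 0 \<Rightarrow> \<lambda>z y. if z = y then 1 else 0 | Suc t \<Rightarrow> \<lambda>z y. complex_of_real (V t z y))" for t
  have U: "unitary_on ?S (U t)" if "t \<le> T" for t
  proof (cases t)
    case 0
    then show ?thesis by (simp add: U_def unitary_on_identity)
  next
    case (Suc s)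
    then show ?thesis using V(1)[of s] that by (simp add: U_def unitary_on_of_real)
  qed
  define \<psi>' where "\<psi>' z = complex_of_real (\<psi> z)" for z
  let ?run = "\<lambda>x t. qrun ?S U \<psi>' x t"
  define err where "err x t z = ?run x t z - complex_of_real (ideal x t z)" for x t z
  have err: "(\<Sum>z\<in>?S. (cmod (err x t z))\<^sup>2) \<le> 1 / 12" if x: "x \<in> cube n" and "t \<le> T" for x t
    using that(2)
  proof (induction t)
    case 0
    have "cmod (err x 0 z) = \<bar>\<psi> z - ideal x 0 z\<bar>" if "z \<in> ?S" for z
      using mat_app_identity[OF finite_qbasis that, of \<psi>']
      by (simp add: err_def U_def \<psi>'_def flip: of_real_diff)
    then show ?case using close[OF x] by simp
  next
    case (Suc t)
    have t: "t < T" "t \<le> T" using Suc.prems by auto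
    have "err x (Suc t) z = mat_app ?S (U (Suc t)) (oracle_app x (err x t)) z" if z: "z \<in> ?S" for z
    proof -
      have "complex_of_real (ideal x (Suc t) z) = mat_app ?S (U (Suc t)) (\<lambda>z. complex_of_real (queried x t z)) z"
        using V(2)[OF t(1) x z] by (simp add: U_def mat_app_of_real)
      also have "\<dots> = mat_app ?S (U (Suc t)) (oracle_app x (\<lambda>z. complex_of_real (ideal x t z))) z"
        using query[OF x] by (intro fun_cong[OF mat_app_cong]) simp
      finally have "err x (Suc t) z = mat_app ?S (U (Suc t)) (\<lambda>z. oracle_app x (?run x t) z
          - oracle_app x (\<lambda>z. complex_of_real (ideal x t z)) z) z"
        by (simp add: err_def mat_app_diff)
      also have "(\<lambda>z. oracle_app x (?run x t) z - oracle_app x (\<lambda>z. complex_of_real (ideal x t z)) z)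
          = oracle_app x (err x t)"
        by (auto simp: oracle_app_def err_def fun_eq_iff)
      finally show ?thesis .
    qed
    then have "(\<Sum>z\<in>?S. (cmod (err x (Suc t) z))\<^sup>2)
      = (\<Sum>z\<in>?S. (cmod (mat_app ?S (U (Suc t)) (oracle_app x (err x t)) z))\<^sup>2)" by simp
    also have "\<dots> = (\<Sum>z\<in>?S. (cmod (err x t z))\<^sup>2)"
      using norm_sq_unitary[OF finite_qbasis U[OF Suc.prems]] by (simp only: norm_sq_oracle)
    finally show ?case using Suc.IH[OF t(2)] by simp
  qed
  have start': "(\<Sum>z\<in>?S. (cmod (\<psi>' z))\<^sup>2) = 1" using start by (simp add: \<psi>'_def)
  then have "Re (cip ?S \<psi>' \<psi>') = 1" by (simp add: Re_cip_self)
  from cip_qrun[OF this _ order_refl] U have unit: "(\<Sum>z\<in>?S. (cmod (?run x T z))\<^sup>2) = 1" for x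
    unfolding Re_cip_self by blast
  have "2 / 3 \<le> (\<Sum>a | a \<in> \<Omega> \<and> (x, a) \<in> h. outcome_prob ?S (label_projector l) (?run x T) a)"
    if x: "x \<in> cube n" for x
  proof -
    let ?G = "\<lambda>z. (x, l z) \<in> h"
    \<comment> \<open>The run is the ideal vector plus an error. Since (a + b)^2 \<le> 2 a^2 + 2
      b^2, the two budgets of 1/12 add up to a failure probability of 1/3.\<close>
    have "(\<Sum>z\<in>?S. if ?G z then 0 else (cmod (?run x T z))\<^sup>2)
      \<le> (\<Sum>z\<in>?S. 2 * (cmod (err x T z))\<^sup>2 + 2 * (if ?G z then 0 else (ideal x T z)\<^sup>2))"
    proof (rule sum_mono)
      fix z
      have "cmod (?run x T z) \<le> cmod (err x T z) + \<bar>ideal x T z\<bar>"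
        using norm_triangle_ineq[of "err x T z" "complex_of_real (ideal x T z)"] by (simp add: err_def)
      then have "(cmod (?run x T z))\<^sup>2 \<le> (cmod (err x T z) + \<bar>ideal x T z\<bar>)\<^sup>2" by (intro power_mono) auto
      also have "\<dots> \<le> 2 * (cmod (err x T z))\<^sup>2 + 2 * (ideal x T z)\<^sup>2"
        using sum_squares_bound[of "cmod (err x T z)" "\<bar>ideal x T z\<bar>"] by (simp add: power2_sum)
      finally show "(if ?G z then 0 else (cmod (?run x T z))\<^sup>2)
        \<le> 2 * (cmod (err x T z))\<^sup>2 + 2 * (if ?G z then 0 else (ideal x T z)\<^sup>2)" by auto
    qed
    also have "\<dots> = 2 * (\<Sum>z\<in>?S. (cmod (err x T z))\<^sup>2) + 2 * (\<Sum>z\<in>?S. if ?G z then 0 else (ideal x T z)\<^sup>2)"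
      by (simp only: sum.distrib sum_distrib_left)
    also have "\<dots> \<le> 1 / 3" using err[OF x order_refl] wrong[OF x] by simp
    finally have "(\<Sum>z\<in>?S. if ?G z then 0 else (cmod (?run x T z))\<^sup>2) \<le> 1 / 3" .
    moreover have "(\<Sum>z\<in>?S. if ?G z then (cmod (?run x T z))\<^sup>2 else 0)
      + (\<Sum>z\<in>?S. if ?G z then 0 else (cmod (?run x T z))\<^sup>2) = (\<Sum>z\<in>?S. (cmod (?run x T z))\<^sup>2)"
      unfolding sum.distrib[symmetric] by (intro sum.cong refl) simp
    ultimately show ?thesis
      using unit[of x] by (simp add: sum_outcome_prob_label[OF finite_qbasis l])
  qed
  moreover have "L2_set (\<lambda>z. cmod (\<psi>' z)) ?S = 1" using start' by (simp add: L2_set_def)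
  moreover have "projective_measurement_on ?S \<Omega> (label_projector l)" by (rule label_measurement[OF finite_qbasis l])
  ultimately show ?thesis unfolding computable_with_queries_def using U by blast
qed

text \<open>Every basis state is labelled \<open>a\<close>, so any start vector will do. This serves
  the degenerate cases, where the product of the two bounds is zero.\<close>

lemma computable_constant_answer:
  assumes "0 < n" "\<And>x. x \<in> cube n \<Longrightarrow> (x, a) \<in> h"
  shows "computable_with_queries n h 0"
proof (rule computable_by_ideal_run[where d=1 and \<Omega>="{a}" and l="\<lambda>_. a"
      and \<psi>="\<lambda>z. if z = (0, False, 0) then 1 else 0" and ideal="\<lambda>_ _ z. if z = (0, False, 0) then 1 else 0"
      and queried="\<lambda>x _ z. if (fst z, fst (snd z) \<noteq> x ! fst z, snd (snd z)) = (0, False, 0) then 1 else 0"])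
  let ?\<psi> = "\<lambda>z. if z = (0, False, 0) then 1 else (0::real)"
  have "(\<Sum>z\<in>qbasis n 1. (?\<psi> z)\<^sup>2) = (\<Sum>z\<in>qbasis n 1. if z = (0, False, 0) then 1 else 0)" by (rule sum.cong) auto
  then show "(\<Sum>z\<in>qbasis n 1. (?\<psi> z)\<^sup>2) = 1" using assms(1) by (simp add: sum.delta qbasis_def)
  show "(\<Sum>z\<in>qbasis n 1. (?\<psi> z - ?\<psi> z)\<^sup>2) \<le> 1 / 12" by simp
  show "oracle_app x (\<lambda>z. complex_of_real (?\<psi> z)) z = complex_of_real
      (if (fst z, fst (snd z) \<noteq> x ! fst z, snd (snd z)) = (0, False, 0) then 1 else 0)" for x z
    by (simp add: oracle_app_def split_def)
  show "(\<Sum>z\<in>qbasis n 1. if (x, a) \<in> h then 0 else (?\<psi> z)\<^sup>2) \<le> 1 / 12" if "x \<in> cube n" for x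
    using assms(2)[OF that] by simp
qed auto

text \<open>
  The ideal state before query \<open>t\<close> has three mutually orthogonal parts: a start vector of weight
  \<open>1 - t / T\<close>, the vectors \<open>\<sigma>\<^bsub>x,a\<^esub>\<close> of weight \<open>t / T\<close>, and a catalyst of weight \<open>1 / T\<close> built from
  \<open>(u + v) / 2\<close> and \<open>(u - v) / 2\<close>.  The first two are kept where the oracle acts trivially, in the
  uniform superposition of the answer register.  A query exchanges the roles of the two catalyst
  parts, which changes the Gram matrix by exactly what one step of the conversion requires.
\<close>

lemma computable_of_rel_value:
  assumes val: "rel_value n K h W" and n: "0 < n" and T: "0 < T" "12 * W \<le> real T"
  shows "computable_with_queries n h T"
proof -
  obtain S where S: "\<And>a. a \<in> {1..K} \<Longrightarrow> gram (cube n) (S a)"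
    "\<And>x a. x \<in> cube n \<Longrightarrow> a \<in> {1..K} \<Longrightarrow> (x, a) \<notin> h \<Longrightarrow> S a x x = 0"
    and qc: "query_cost n (\<lambda>x y. 1 - (\<Sum>a=1..K. S a x y)) (\<lambda>_. W)"
    using val unfolding rel_value_def by blast
  obtain e :: nat and s where s: "\<And>a x y. a \<in> {1..K} \<Longrightarrow> x \<in> cube n \<Longrightarrow> y \<in> cube n \<Longrightarrow>
    S a x y = (\<Sum>k<e. s a x k * s a y k)"
    by (rule gram_uniform[OF finite_atLeastAtMost S(1)]) (assumption, rule that)
  obtain D :: nat and u v where
    uv: "\<And>x y. x \<in> cube n \<Longrightarrow> y \<in> cube n \<Longrightarrow>
      (\<Sum>i | i < n \<and> x ! i \<noteq> y ! i. \<Sum>k<D. u x i k * v y i k) = 1 - (\<Sum>a=1..K. S a x y)"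
    "\<And>x. x \<in> cube n \<Longrightarrow> (\<Sum>i<n. \<Sum>k<D. (u x i k)\<^sup>2) \<le> W"
    "\<And>x. x \<in> cube n \<Longrightarrow> (\<Sum>i<n. \<Sum>k<D. (v x i k)\<^sup>2) \<le> W"
    by (rule query_costE[OF qc]) (rule that)
  \<comment> \<open>Polarization: the Gram kernel of the half sums minus that of the half
    differences is the symmetrized product of \<open>u\<close> and \<open>v\<close>. States only
    realize positive semidefinite kernels, so the product has to appear as such a
    difference.\<close>
  define r where "r c x i k = (if c then u x i k + v x i k else u x i k - v x i k) / 2"
    for c :: bool and x i k
  let ?WS = "{()} <+> ({1..K} \<times> {..<e}) <+> ((UNIV :: bool set) \<times> {..<D})"
  define d where "d = card ?WS"
  have "finite ?WS" by simp
  then obtain code where "bij_betw code {0..<card ?WS} ?WS" using ex_bij_betw_nat_finite by blast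
  then have code: "bij_betw code {..<d} ?WS" by (simp add: d_def lessThan_atLeast0)
  let ?S = "qbasis n d"
  have sum_WS: "(\<Sum>\<omega>\<in>?WS. F \<omega>) = F (Inl ()) + (\<Sum>a=1..K. \<Sum>k<e. F (Inr (Inl (a, k))))
      + (\<Sum>c\<in>UNIV. \<Sum>k<D. F (Inr (Inr (c, k))))" for F :: "_ \<Rightarrow> real"
    by (simp add: sum.Plus o_def sum.cartesian_product split_def add.assoc)
  \<comment> \<open>Catalyst part \<open>c = p\<close> carries the answer bit \<open>False\<close>,
    the other part the bit \<open>x ! i\<close>. A query adds \<open>x ! i\<close> and so exchanges
    the two, which flips \<open>p\<close>.\<close>
  define amp where "amp \<alpha> \<beta> \<gamma> p x i b \<omega> = (case \<omega> of Inl _ \<Rightarrow> if i = 0 then \<alpha> / sqrt 2 else 0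
      | Inr (Inl (a, k)) \<Rightarrow> if i = 0 then \<beta> * s a x k / sqrt 2 else 0
      | Inr (Inr (c, k)) \<Rightarrow> if (if c = p then \<not> b else b = x ! i) then \<gamma> * r c x i k else 0)"
    for \<alpha> \<beta> \<gamma> :: real and p x and i :: nat and b and \<omega> :: "unit + (nat \<times> nat) + (bool \<times> nat)"
  define st where "st \<alpha> \<beta> \<gamma> p x z = amp \<alpha> \<beta> \<gamma> p x (fst z) (fst (snd z)) (code (snd (snd z)))"
    for \<alpha> \<beta> \<gamma> p x and z :: qidx
  \<comment> \<open>The part carrying the bit \<open>x ! i\<close> contributes only at positions
    where the inputs agree, the part carrying \<open>False\<close> everywhere.\<close>
  define C where "C p x y = (\<Sum>i<n. \<Sum>c\<in>UNIV. if c = p \<or> x ! i = y ! i then \<Sum>k<D. r c x i k * r c y i k else 0)"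
    for p x y
  have gram: "(\<Sum>z\<in>?S. st \<alpha> \<beta> \<gamma> p x z * st \<alpha> \<beta> \<gamma> p y z)
      = \<alpha>\<^sup>2 + \<beta>\<^sup>2 * (\<Sum>a=1..K. S a x y) + \<gamma>\<^sup>2 * C p x y"
    if xy: "x \<in> cube n" "y \<in> cube n" for \<alpha> \<beta> \<gamma> p x y
  proof -
    let ?m = "\<lambda>i b \<omega>. amp \<alpha> \<beta> \<gamma> p x i b \<omega> * amp \<alpha> \<beta> \<gamma> p y i b \<omega>"
    have half: "t / sqrt 2 * (t' / sqrt 2) = t * t' / 2" for t t' :: real by simp
    have one: "(\<Sum>b\<in>UNIV. \<Sum>\<omega>\<in>?WS. ?m i b \<omega>) = (if i = 0 then \<alpha>\<^sup>2 + \<beta>\<^sup>2 * (\<Sum>a=1..K. S a x y) else 0)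
      + \<gamma>\<^sup>2 * (\<Sum>c\<in>UNIV. if c = p \<or> x ! i = y ! i then \<Sum>k<D. r c x i k * r c y i k else 0)" for i
    proof -
      have m1: "?m i b (Inl ()) = (if i = 0 then \<alpha>\<^sup>2 / 2 else 0)" for b
        by (simp add: amp_def half power2_eq_square)
      have m2: "(\<Sum>a=1..K. \<Sum>k<e. ?m i b (Inr (Inl (a, k)))) = (if i = 0 then \<beta>\<^sup>2 * (\<Sum>a=1..K. S a x y) / 2 else 0)" for b
      proof -
        have "(\<Sum>a=1..K. \<Sum>k<e. ?m 0 b (Inr (Inl (a, k)))) = (\<Sum>a=1..K. \<Sum>k<e. \<beta>\<^sup>2 / 2 * (s a x k * s a y k))"
          by (intro sum.cong refl) (simp add: amp_def half power2_eq_square)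
        also have "\<dots> = \<beta>\<^sup>2 / 2 * (\<Sum>a=1..K. S a x y)"
          unfolding sum_distrib_left[symmetric] using s[OF _ xy] by simp
        finally show ?thesis by (auto simp: amp_def)
      qed
      have m3: "(\<Sum>b\<in>UNIV. \<Sum>c\<in>UNIV. \<Sum>k<D. ?m i b (Inr (Inr (c, k))))
        = \<gamma>\<^sup>2 * (\<Sum>c\<in>UNIV. if c = p \<or> x ! i = y ! i then \<Sum>k<D. r c x i k * r c y i k else 0)"
      proof -
        have "(\<Sum>b\<in>UNIV. \<Sum>c\<in>UNIV. \<Sum>k<D. ?m i b (Inr (Inr (c, k))))
          = (\<Sum>c\<in>UNIV. \<Sum>b\<in>UNIV. \<Sum>k<D. ?m i b (Inr (Inr (c, k))))" by (rule sum.swap)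
        also have "\<dots> = (\<Sum>c\<in>UNIV. \<gamma>\<^sup>2 * (if c = p \<or> x ! i = y ! i then \<Sum>k<D. r c x i k * r c y i k else 0))"
        proof (rule sum.cong[OF refl])
          fix c
          have m: "(\<Sum>k<D. ?m i b (Inr (Inr (c, k)))) = (if (if c = p then \<not> b else b = x ! i \<and> b = y ! i)
              then \<gamma>\<^sup>2 * (\<Sum>k<D. r c x i k * r c y i k) else 0)" for b
            unfolding sum_distrib_left by (auto simp: amp_def power2_eq_square mult_ac)
          show "(\<Sum>b\<in>UNIV. \<Sum>k<D. ?m i b (Inr (Inr (c, k))))
            = \<gamma>\<^sup>2 * (if c = p \<or> x ! i = y ! i then \<Sum>k<D. r c x i k * r c y i k else 0)"
            unfolding m by (auto simp: UNIV_bool)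
        qed
        finally show ?thesis by (simp only: sum_distrib_left)
      qed
      show ?thesis
        unfolding sum_WS sum.distrib m1 m2 m3 by (simp add: UNIV_bool)
    qed
    have "(\<Sum>z\<in>?S. st \<alpha> \<beta> \<gamma> p x z * st \<alpha> \<beta> \<gamma> p y z) = (\<Sum>i<n. \<Sum>b\<in>UNIV. \<Sum>w<d. ?m i b (code w))"
      by (simp add: sum_qbasis st_def)
    also have "\<dots> = (\<Sum>i<n. \<Sum>b\<in>UNIV. \<Sum>\<omega>\<in>?WS. ?m i b \<omega>)"
      by (intro sum.cong refl) (rule sum.reindex_bij_betw[OF code])
    also have "\<dots> = (\<Sum>i<n. if i = 0 then \<alpha>\<^sup>2 + \<beta>\<^sup>2 * (\<Sum>a=1..K. S a x y) else 0) + \<gamma>\<^sup>2 * C p x y"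
      unfolding one sum.distrib C_def sum_distrib_left ..
    also have "(\<Sum>i<n. if i = 0 then \<alpha>\<^sup>2 + \<beta>\<^sup>2 * (\<Sum>a=1..K. S a x y) else 0) = \<alpha>\<^sup>2 + \<beta>\<^sup>2 * (\<Sum>a=1..K. S a x y)"
      using n by (subst sum.delta) auto
    finally show ?thesis .
  qed
  have C_diff: "C True x y = C False x y + (1 - (\<Sum>a=1..K. S a x y))" if xy: "x \<in> cube n" "y \<in> cube n" for x y
  proof -
    have sym: "S a y x = S a x y" if "a \<in> {1..K}" for a
      using s[OF that xy] s[OF that xy(2,1)] by (simp add: mult.commute)
    have "C True x y - C False x y = (\<Sum>i<n. if x ! i \<noteq> y ! i then
        (\<Sum>k<D. r True x i k * r True y i k) - (\<Sum>k<D. r False x i k * r False y i k) else 0)"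
      unfolding C_def sum_subtractf[where A="{..<n}", symmetric] by (intro sum.cong refl) (simp add: UNIV_bool)
    also have "\<dots> = (\<Sum>i<n. if x ! i \<noteq> y ! i then \<Sum>k<D. (1/2) * (u x i k * v y i k) + (1/2) * (u y i k * v x i k) else 0)"
    proof (rule sum.cong[OF refl])
      fix i
      have "(\<Sum>k<D. r True x i k * r True y i k) - (\<Sum>k<D. r False x i k * r False y i k)
        = (\<Sum>k<D. (1/2) * (u x i k * v y i k) + (1/2) * (u y i k * v x i k))"
        unfolding sum_subtractf[symmetric] by (intro sum.cong refl) (simp add: r_def field_simps)
      then show "(if x ! i \<noteq> y ! i then (\<Sum>k<D. r True x i k * r True y i k) - (\<Sum>k<D. r False x i k * r False y i k) else 0)
        = (if x ! i \<noteq> y ! i then \<Sum>k<D. (1/2) * (u x i k * v y i k) + (1/2) * (u y i k * v x i k) else 0)" by simp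
    qed
    also have "\<dots> = (\<Sum>i | i < n \<and> x ! i \<noteq> y ! i. \<Sum>k<D. (1/2) * (u x i k * v y i k) + (1/2) * (u y i k * v x i k))"
      by (rule sum_filter_less[symmetric])
    also have "(\<Sum>i | i < n \<and> x ! i \<noteq> y ! i. \<Sum>k<D. (1/2) * (u x i k * v y i k) + (1/2) * (u y i k * v x i k))
      = (1/2) * (\<Sum>i | i < n \<and> x ! i \<noteq> y ! i. \<Sum>k<D. u x i k * v y i k)
        + (1/2) * (\<Sum>i | i < n \<and> x ! i \<noteq> y ! i. \<Sum>k<D. u y i k * v x i k)"
      by (simp only: sum.distrib sum_distrib_left)
    also have "{i. i < n \<and> x ! i \<noteq> y ! i} = {i. i < n \<and> y ! i \<noteq> x ! i}" by auto
    finally have "C True x y - C False x y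
      = (1/2) * (\<Sum>i | i < n \<and> y ! i \<noteq> x ! i. \<Sum>k<D. u x i k * v y i k)
        + (1/2) * (1 - (\<Sum>a=1..K. S a y x))" unfolding uv(1)[OF xy(2,1)] .
    moreover have "{i. i < n \<and> y ! i \<noteq> x ! i} = {i. i < n \<and> x ! i \<noteq> y ! i}" by auto
    ultimately show ?thesis using uv(1)[OF xy] sym by simp
  qed
  have C_le: "C True x x \<le> W" if x: "x \<in> cube n" for x
  proof -
    have "C True x x = (\<Sum>i<n. \<Sum>k<D. (1/2) * (u x i k)\<^sup>2 + (1/2) * (v x i k)\<^sup>2)"
      unfolding C_def
    proof (rule sum.cong[OF refl])
      fix i
      have "(\<Sum>c\<in>UNIV. \<Sum>k<D. r c x i k * r c x i k) = (\<Sum>k<D. r True x i k * r True x i k + r False x i k * r False x i k)"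
        by (simp add: UNIV_bool sum.distrib)
      also have "\<dots> = (\<Sum>k<D. (1/2) * (u x i k)\<^sup>2 + (1/2) * (v x i k)\<^sup>2)"
        by (intro sum.cong refl) (simp add: r_def power2_eq_square field_simps)
      finally show "(\<Sum>c\<in>UNIV. if c = True \<or> x ! i = x ! i then \<Sum>k<D. r c x i k * r c x i k else 0)
        = (\<Sum>k<D. (1/2) * (u x i k)\<^sup>2 + (1/2) * (v x i k)\<^sup>2)" by simp
    qed
    also have "\<dots> = (1/2) * (\<Sum>i<n. \<Sum>k<D. (u x i k)\<^sup>2) + (1/2) * (\<Sum>i<n. \<Sum>k<D. (v x i k)\<^sup>2)"
      by (simp only: sum.distrib sum_distrib_left)
    finally show ?thesis using uv(2,3)[OF x] by simp
  qed
  \<comment> \<open>A step moves weight \<open>1 / T\<close> from the start vector to the \<sigma>,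
    and exchanging the catalyst parts changes the Gram matrix by \<gamma>^2 times the kernel of the
    solution; equating the two fixes \<gamma>.\<close>
  define \<gamma> where "\<gamma> = 1 / sqrt (real T)"
  have \<gamma>: "\<gamma>\<^sup>2 = 1 / real T" using T(1) by (simp add: \<gamma>_def power_divide)
  have cat: "(\<Sum>z\<in>?S. (st 0 0 \<gamma> True x z)\<^sup>2) \<le> 1 / 12" if x: "x \<in> cube n" for x
  proof -
    have "(\<Sum>z\<in>?S. (st 0 0 \<gamma> True x z)\<^sup>2) = C True x x / real T"
      using gram[OF x x, of 0 0 \<gamma> True] \<gamma> by (simp add: power2_eq_square)
    also have "\<dots> \<le> W / real T" using C_le[OF x] T(1) by (intro divide_right_mono) auto
    also have "\<dots> \<le> 1 / 12" using T by (simp add: field_simps)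
    finally show ?thesis .
  qed
  define A B where "A t = sqrt (1 - real t / real T)" and "B t = sqrt (real t / real T)" for t
  have AB: "(A t)\<^sup>2 = 1 - real t / real T" "(B t)\<^sup>2 = real t / real T" if "t \<le> T" for t
    using that T(1) by (simp_all add: A_def B_def)
  \<comment> \<open>Basis states that carry no answer get the label 0, outside the range from 1 to
    \<open>K\<close>.\<close>
  define lab where "lab z = (case code (snd (snd z)) of Inr (Inl (a, k)) \<Rightarrow> a | _ \<Rightarrow> 0)" for z :: qidx
  have code_in: "code (snd (snd z)) \<in> ?WS" if "z \<in> ?S" for z
    using that bij_betwE[OF code] by (auto simp: qbasis_def)
  obtain x0 where x0: "x0 \<in> cube n" using cube_nonempty by blast
  show ?thesis
  proof (rule computable_by_ideal_run[where d=d and \<psi>="st 1 0 0 True x0" and \<Omega>="{0..K}" and l=lab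
        and ideal="\<lambda>x t. st (A t) (B t) \<gamma> True x" and queried="\<lambda>x t. st (A t) (B t) \<gamma> False x"])
    show "(\<Sum>z\<in>?S. (st 1 0 0 True x0 z)\<^sup>2) = 1"
      using gram[OF x0 x0, of 1 0 0 True] by (simp add: power2_eq_square)
  next
    fix x y t assume xy: "x \<in> cube n" "y \<in> cube n" and t: "t < T"
    have "1 / real T = \<gamma>\<^sup>2" by (simp add: \<gamma>)
    have AB': "(A (Suc t))\<^sup>2 = (A t)\<^sup>2 - \<gamma>\<^sup>2" "(B (Suc t))\<^sup>2 = (B t)\<^sup>2 + \<gamma>\<^sup>2"
      using AB[of t] AB[of "Suc t"] t by (simp_all add: \<gamma> add_divide_distrib)
    show "(\<Sum>z\<in>?S. st (A t) (B t) \<gamma> False x z * st (A t) (B t) \<gamma> False y z)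
      = (\<Sum>z\<in>?S. st (A (Suc t)) (B (Suc t)) \<gamma> True x z * st (A (Suc t)) (B (Suc t)) \<gamma> True y z)"
      unfolding gram[OF xy] AB' C_diff[OF xy] by (simp add: algebra_simps)
  next
    show "oracle_app x (\<lambda>z. complex_of_real (st (A t) (B t) \<gamma> True x z)) z = complex_of_real (st (A t) (B t) \<gamma> False x z)"
      for x t z
      by (auto simp: oracle_app_def st_def amp_def split_def split: sum.split)
  next
    fix x assume x: "x \<in> cube n"
    have "st 1 0 0 True x0 z - st (A 0) (B 0) \<gamma> True x z = - st 0 0 \<gamma> True x z" for z
      by (simp add: st_def amp_def A_def B_def split_def split: sum.split)
    then show "(\<Sum>z\<in>?S. (st 1 0 0 True x0 z - st (A 0) (B 0) \<gamma> True x z)\<^sup>2) \<le> 1 / 12"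
      using cat[OF x] by simp
    have s0: "s a x k = 0" if "a \<in> {1..K}" "(x, a) \<notin> h" "k < e" for a k
    proof -
      have "(\<Sum>k<e. s a x k * s a x k) = 0" using S(2)[OF x that(1,2)] s[OF that(1) x x] by simp
      then show ?thesis using that(3) by (simp add: sum_nonneg_eq_0_iff)
    qed
    \<comment> \<open>At time \<open>T\<close> the start vector has amplitude zero, and \<sigma>
      vanishes on wrong answers; so only the catalyst can be labelled wrongly.\<close>
    have "(\<Sum>z\<in>?S. if (x, lab z) \<in> h then 0 else (st (A T) (B T) \<gamma> True x z)\<^sup>2) \<le> (\<Sum>z\<in>?S. (st 0 0 \<gamma> True x z)\<^sup>2)"
    proof (rule sum_mono)
      fix z assume "z \<in> ?S"
      then have w: "code (snd (snd z)) \<in> ?WS" by (rule code_in)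
      have AT: "A T = 0" using T(1) by (simp add: A_def)
      show "(if (x, lab z) \<in> h then 0 else (st (A T) (B T) \<gamma> True x z)\<^sup>2) \<le> (st 0 0 \<gamma> True x z)\<^sup>2"
        using w s0 by (auto simp: st_def amp_def lab_def AT)
    qed
    then show "(\<Sum>z\<in>?S. if (x, lab z) \<in> h then 0 else (st (A T) (B T) \<gamma> True x z)\<^sup>2) \<le> 1 / 12"
      using cat[OF x] by linarith
  next
    show "lab z \<in> {0..K}" if "z \<in> ?S" for z
      using code_in[OF that] by (auto simp: lab_def)
  qed simp
qed

subsection \<open>The composition theorem\<close>

lemma Q_le: "computable_with_queries n h T \<Longrightarrow> Q n h \<le> T"
  unfolding Q_def by (rule Least_le)

lemma Q_computable: "computable_with_queries n h T \<Longrightarrow> computable_with_queries n h (Q n h)"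
  unfolding Q_def by (rule LeastI)

text \<open>Correctness of \<open>a\<close> depends on the input only through its word, so
  verification composes like any other kernel. Numbers outside the alphabet are never correct and
  give the zero kernel.\<close>

lemma query_cost_verify_comp:
  assumes f: "f \<subseteq> cube N \<times> {1..K}" and V: "0 \<le> V" "0 \<le> c'"
    and q: "query_cost m (\<lambda>x y. if g x \<noteq> g y then 1 else 0) (\<lambda>_. c')"
    and le: "\<And>a. a \<in> {1..K} \<Longrightarrow> 2 * ADV N (\<lambda>z. (z, a) \<in> f) < V"
  shows "query_cost (N * m) (\<lambda>x y. if ((x, a) \<in> rel_comp N m f g) \<noteq> ((y, a) \<in> rel_comp N m f g) then 1 else 0)
    (\<lambda>_. V * c')"
proof (cases "a \<in> {1..K}")
  case True
  have "query_cost N (\<lambda>z w. if ((z, a) \<in> f) \<noteq> ((w, a) \<in> f) then 1 else 0) (\<lambda>_. V)"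
    using query_cost_ADV[of "V - 2 * ADV N (\<lambda>z. (z, a) \<in> f)" N "\<lambda>z. (z, a) \<in> f"] le[OF True] by simp
  from query_cost_compose[OF this q V(2)] show ?thesis
    by (rule query_cost_mono) (simp_all add: rel_comp_iff)
next
  case False
  then have "(x, a) \<notin> rel_comp N m f g" for x using f by (auto simp: rel_comp_iff)
  then show ?thesis using query_cost_zero[of "N * m" "\<lambda>_. V * c'"] V by simp
qed

text \<open>If \<open>g\<close> is constant or some answer is always correct, then both the product
  and the query complexity are zero. Otherwise \<open>B\<close> is at least 1, and some answer has a
  nonconstant verification function, whose adversary bound is at least 1, so \<open>ver\<close>
  forces \<open>A\<close> to be at least 54. Additive errors can then be absorbed into constant
  factors.\<close>

lemma Q_rel_comp_bounds:
  fixes N m K :: nat and f g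
  defines "A \<equiv> ADV_rel N K f" and "B \<equiv> ADV m g" and "h \<equiv> rel_comp N m f g"
  assumes N: "1 \<le> N" and m: "1 \<le> m" and f: "f \<subseteq> cube N \<times> {1..K}"
    and total: "\<And>z. z \<in> cube N \<Longrightarrow> \<exists>a\<in>{1..K}. (z, a) \<in> f"
    and ver: "\<And>a. a \<in> {1..K} \<Longrightarrow> ADV N (\<lambda>z. (z, a) \<in> f) \<le> 1 / 54 * A"
  shows "1 / 48 * (A * B) \<le> real (Q (N * m) h) \<and> real (Q (N * m) h) \<le> 73 * (A * B)"
proof -
  have Nm: "0 < N * m" using N m by simp
  have A0: "0 \<le> A" unfolding A_def by (rule ADV_rel_nonneg[OF total])
  have B0: "0 \<le> B" unfolding B_def by (rule ADV_nonneg)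
  have trivial: ?thesis if "A * B \<le> 0" and a: "\<And>x. x \<in> cube (N * m) \<Longrightarrow> (x, a) \<in> h" for a
  proof -
    have "Q (N * m) h = 0" using Q_le[OF computable_constant_answer[OF Nm a]] by simp
    moreover have "A * B = 0" by (rule antisym[OF that(1) mult_nonneg_nonneg[OF A0 B0]])
    ultimately show ?thesis by auto
  qed
  consider "\<forall>x\<in>cube m. \<forall>y\<in>cube m. g x = g y" | a where "a \<in> {1..K}" "\<forall>z\<in>cube N. (z, a) \<in> f"
    | x y where "x \<in> cube m" "y \<in> cube m" "g x \<noteq> g y" "\<forall>a\<in>{1..K}. \<exists>z\<in>cube N. (z, a) \<notin> f" by blast
  then show ?thesis
  proof cases
    case 1
    then have "B = 0" unfolding B_def by (intro ADV_constant) blast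
    obtain x0 where x0: "x0 \<in> cube m" using cube_nonempty by blast
    obtain a where a: "(replicate N (g x0), a) \<in> f" using total[of "replicate N (g x0)"] by (auto simp: cube_def)
    have "word N m g x = replicate N (g x0)" if "x \<in> cube (N * m)" for x
    proof (rule nth_equalityI)
      fix j assume "j < length (word N m g x)"
      then have j: "j < N" by (simp add: word_def)
      then have "g (block m j x) = g x0" using 1 x0 block_cube[OF that j] by blast
      then show "word N m g x ! j = replicate N (g x0) ! j" using j by simp
    qed (simp add: word_def)
    then show ?thesis using a \<open>B = 0\<close> by (intro trivial[of a]) (auto simp: h_def rel_comp_iff)
  next
    case 2
    have "A \<le> 0" unfolding A_def by (rule ADV_rel_constant_answer[OF 2(1)]) (use 2 in blast)
    then show ?thesis using A0 2(2) by (intro trivial[of a]) (auto simp: h_def rel_comp_iff)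
  next
    case 3
    have B1: "1 \<le> B" unfolding B_def by (rule ADV_ge_1[OF 3(1-3)])
    have A54: "54 \<le> A"
    proof -
      obtain z where z: "z \<in> cube N" using cube_nonempty by blast
      then obtain a where a: "a \<in> {1..K}" "(z, a) \<in> f" using total by blast
      then obtain z' where z': "z' \<in> cube N" "(z', a) \<notin> f" using 3(4) by blast
      have "1 \<le> ADV N (\<lambda>z. (z, a) \<in> f)" using ADV_ge_1[OF z z'(1), of "\<lambda>z. (z, a) \<in> f"] a z' by simp
      then show ?thesis using ver[OF a(1)] by linarith
    qed
    have AB: "54 \<le> A * B" using mult_mono[OF A54 B1] A0 by simp
    have qg: "query_cost m (\<lambda>x y. if g x \<noteq> g y then 1 else 0) (\<lambda>_. 3 * B)"
      using query_cost_ADV[of B m g] B1 by (simp add: B_def)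
    \<comment> \<open>72 = 12 * 2 * 3: the factor of the algorithm, a relational solution of cost
      \<open>2 * A\<close> and a dual solution of cost \<open>3 * B\<close>. Rounding up is covered
      by 73, as \<open>A * B \<ge> 54\<close>.\<close>
    define T where "T = nat \<lceil>72 * (A * B)\<rceil>"
    have T: "72 * (A * B) \<le> real T" "real T \<le> 73 * (A * B)" unfolding T_def using AB by linarith+
    have comp: "computable_with_queries (N * m) h T"
    proof (rule computable_of_rel_value[OF _ Nm])
      have "rel_value N K f (2 * A)" using A54 by (intro rel_value_of_less[OF total]) (auto simp: A_def)
      from rel_value_compose[OF this qg] show "rel_value (N * m) K h (2 * A * (3 * B))" unfolding h_def using B0 by simp
      show "12 * (2 * A * (3 * B)) \<le> real T" using T(1) by simp
      show "0 < T" using T(1) AB by (cases T) auto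
    qed
    have upper: "real (Q (N * m) h) \<le> 73 * (A * B)" using Q_le[OF comp] T(2) by linarith
    have total': "\<exists>a\<in>{1..K}. (x, a) \<in> h" if "x \<in> cube (N * m)" for x
      using total[of "word N m g x"] that by (auto simp: h_def rel_comp_iff)
    define I where "I = ADV_rel (N * m) K h"
    \<comment> \<open>A value just above the infimum \<open>I\<close>; the excess is small against
      the lower bound \<open>A * B / 2\<close> shown next for \<open>W\<close>.\<close>
    define W where "W = I + A * B / 8"
    have I0: "0 \<le> I" unfolding I_def by (rule ADV_rel_nonneg[OF total'])
    have W: "0 \<le> W" using I0 AB by (simp add: W_def)
    have val: "rel_value (N * m) K h W" using AB by (intro rel_value_of_less[OF total']) (auto simp: W_def I_def)
    have low: "A * B / 2 \<le> W"
    proof -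
      obtain \<Gamma> where G: "adv_feasible m g \<Gamma>" "B / 2 < spectral_norm (cube m) \<Gamma>"
        using ADV_witness[of "B / 2" m g] B1 by (auto simp: B_def)
      then have "A \<le> W / spectral_norm (cube m) \<Gamma>"
        unfolding A_def using val W B1 by (intro ADV_rel_le rel_value_decompose) (auto simp: h_def)
      then have "A * spectral_norm (cube m) \<Gamma> \<le> W" using G(2) B1 by (simp add: field_simps)
      moreover have "A * (B / 2) \<le> A * spectral_norm (cube m) \<Gamma>" using G(2) A0 by (intro mult_left_mono) auto
      ultimately show ?thesis by simp
    qed
    \<comment> \<open>Verification: twice \<open>ADV\<close> is at most \<open>A / 27\<close>,
      strictly below \<open>A / 18\<close>; multiplied by \<open>3 * B\<close> this is
      \<open>A * B / 6\<close>.\<close>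
    have "rel_value (N * m) K h (2 * real (Q (N * m) h) + A / 18 * (3 * B) + W / 3)"
    proof (rule rel_value_of_algorithm[OF Q_computable[OF comp] _ val W])
      show "query_cost (N * m) (\<lambda>x y. if ((x, a) \<in> h) \<noteq> ((y, a) \<in> h) then 1 else 0) (\<lambda>_. A / 18 * (3 * B))" for a
        unfolding h_def
      proof (rule query_cost_verify_comp[OF f _ _ qg])
        show "2 * ADV N (\<lambda>z. (z, a) \<in> f) < A / 18" if "a \<in> {1..K}" for a
          using ver[OF that] A54 by simp
      qed (use A0 B0 in auto)
      show "a \<in> {1..K}" if "(x, a) \<in> h" for x a using that f by (auto simp: h_def rel_comp_iff)
    qed
    then have "I \<le> 2 * real (Q (N * m) h) + A * B / 6 + W / 3" unfolding I_def using ADV_rel_le by fastforce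
    \<comment> \<open>The first inequality gives \<open>i \<ge> 3 * p / 8\<close>, the second
      \<open>2 * i / 3 \<le> 2 * q + 5 * p / 24\<close>; together
      \<open>p / 24 \<le> 2 * q\<close>.\<close>
    moreover have "1 / 48 * p \<le> q" if "p / 2 \<le> i + p / 8" "i \<le> 2 * q + p / 6 + (i + p / 8) / 3"
      for p q i :: real using that by (simp add: field_simps)
    ultimately have "1 / 48 * (A * B) \<le> real (Q (N * m) h)" using low unfolding W_def by blast
    then show ?thesis using upper by blast
  qed
qed

theorem corollary26:
  fixes K m :: "nat \<Rightarrow> nat"
    and f :: "nat \<Rightarrow> (bool list \<times> nat) set"
    and g :: "nat \<Rightarrow> bool list \<Rightarrow> bool"
  assumes "\<And>N. N \<ge> 1 \<Longrightarrow> K N \<ge> 1"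
    and "\<And>N. N \<ge> 1 \<Longrightarrow> m N \<ge> 1"
    and "\<And>N. N \<ge> 1 \<Longrightarrow> f N \<subseteq> cube N \<times> {1..K N}"
    and "\<And>N z. N \<ge> 1 \<Longrightarrow> z \<in> cube N \<Longrightarrow> \<exists>a\<in>{1..K N}. (z, a) \<in> f N"
    and "efficiently_verifiable K f"
  shows "\<exists>c C :: real. \<exists>N\<^sub>0. 0 < c \<and> c \<le> C \<and>
           (\<forall>N\<ge>N\<^sub>0. N \<ge> 1 \<longrightarrow>
              c * (ADV_rel N (K N) (f N) * ADV (m N) (g N))
                \<le> real (Q (N * m N) (rel_comp N (m N) (f N) (g N))) \<and>
              real (Q (N * m N) (rel_comp N (m N) (f N) (g N)))
                \<le> C * (ADV_rel N (K N) (f N) * ADV (m N) (g N)))"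
proof -
  have "\<exists>N\<^sub>0. \<forall>N\<ge>N\<^sub>0. N \<ge> 1 \<longrightarrow>
      (\<forall>a\<in>{1..K N}. ADV N (\<lambda>z. (z, a) \<in> f N) \<le> 1 / 54 * ADV_rel N (K N) (f N))"
    using assms(5) unfolding efficiently_verifiable_def by (elim allE[of _ "1 / 54"]) simp
  then obtain N\<^sub>0 where N\<^sub>0: "\<And>N a. N \<ge> N\<^sub>0 \<Longrightarrow> N \<ge> 1 \<Longrightarrow> a \<in> {1..K N} \<Longrightarrow>
      ADV N (\<lambda>z. (z, a) \<in> f N) \<le> 1 / 54 * ADV_rel N (K N) (f N)" by blast
  show ?thesis
  proof (rule exI[of _ "1 / 48"], rule exI[of _ 73], rule exI[of _ N\<^sub>0], intro conjI allI impI)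
    fix N assume N: "N \<ge> N\<^sub>0" "N \<ge> 1"
    note bounds = Q_rel_comp_bounds[OF N(2) assms(2)[OF N(2)] assms(3)[OF N(2)] assms(4)[OF N(2)] N\<^sub>0[OF N], where g="g N"]
    show "1 / 48 * (ADV_rel N (K N) (f N) * ADV (m N) (g N))
        \<le> real (Q (N * m N) (rel_comp N (m N) (f N) (g N)))"
      "real (Q (N * m N) (rel_comp N (m N) (f N) (g N)))
        \<le> 73 * (ADV_rel N (K N) (f N) * ADV (m N) (g N))"
      using bounds by blast+
  qed simp_all
qed

end
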